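(* Let $\mathbb{X},\mathbb{A},A(\cdot),c,q$ be as in the context. Suppose that: (HT) there exist a state $\ell\in\mathbb{X}$ and a constant $K_\ell$ such that $\sum_{n=0}^\infty{}_\ell Q_\phi^n\mathbf{e}(x)\le K_\ell<\infty$ for all $\phi\in\mathbb{F}$ and $x\in\mathbb{X}$, and this state $\ell$ is isolated from $\mathbb{X}$; (W-i) the set-valued mapping $x\mapsto A(x)$ is compact-valued and continuous on $\mathbb{X}$; (W-ii) the transition kernel $q$ is weakly continuous. Consider the MDP defined by the HV-AG transformation described in the context (with a continuous function $\mu_\ell$ and a discount factor $\bar\beta$ as specified there). Then $\bar p$ is a weakly continuous transition probability kernel (from $\mathrm{Gr}(\bar A)$ to $\bar{\mathbb{X}}$). If in addition $(x,a)\mapsto c(x,a)$ is lower semicontinuous on $\mathrm{Gr}(A)$, then there exists a stationary $\bar\beta$-optimal policy for the MDP defined by the HV-AG transformation, and for this MDP a stationary policy $\phi$ is $\bar\beta$-optimal if and only if for all $x\in\mathbb{X}$ $$\bar v(x)=\bar c(x,\phi(x))+\bar\beta\int_{\mathbb{X}}\bar v(y)\,\bar p(dy|x,\phi(x))=\min_{a\in A(x)}\Big[\bar c(x,a)+\bar\beta\int_{\mathbb{X}}\bar v(y)\,\bar p(dy|x,a)\Big].$$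
   Context: Setting. $\mathbb{X}$ and $\mathbb{A}$ are Borel subsets of complete separable metric spaces, with Borel $\sigma$-algebras. For each $x\in\mathbb{X}$, $A(x)$ is a nonempty Borel subset of $\mathbb{A}$. $\mathrm{Gr}(A):=\{(x,a):x\in\mathbb{X},a\in A(x)\}$ is Borel in $\mathbb{X}\times\mathbb{A}$ and contains the graph of a Borel function $\mathbb{X}\to\mathbb{A}$. The one-step cost $c:\mathrm{Gr}(A)\to[0,\infty)$ is Borel. For each $(x,a)\in\mathrm{Gr}(A)$, $q(\cdot|x,a)$ is a finite measure on $(\mathbb{X},\mathcal{B}(\mathbb{X}))$, $q(B|\cdot)$ is Borel on $\mathrm{Gr}(A)$ for each $B\in\mathcal{B}(\mathbb{X})$, and $\sup_{\mathrm{Gr}(A)}q(\mathbb{X}|x,a)<\infty$ (the mass need not be one). $\mathbb{F}$ is the set of Borel $\phi:\mathbb{X}\to\mathbb{A}$ with $\phi(x)\in A(x)$ for all $x$ (stationary policies). For $\phi\in\mathbb{F}$, $z\in\mathbb{X}$ and Borel $u$: ${}_zQ_\phi u(x):=\int_{\mathbb{X}\setminus\{z\}}u(y)\,q(dy|x,\phi(x))$, ${}_zQ_\phi^0u:=u$, ${}_zQ_\phi^nu:={}_zQ_\phi({}_zQ_\phi^{n-1}u)$ for $n\ge1$. $\mathbf{e}(x):=1$ for all $x$. The state $\ell$ is isolated from $\mathbb{X}$ if there is $\epsilon>0$ such that the distance from $\ell$ to every element of $\mathbb{X}\setminus\{\ell\}$ is larger than $\epsilon$. A set-valued mapping $s\mapsto\Phi(s)\subseteq\mathbb{T}$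 between metric spaces is compact-valued if every $\Phi(s)$ is compact, and continuous if for every open $O\subseteq\mathbb{T}$ the sets $\{s:\Phi(s)\subseteq O\}$ and $\{s:\Phi(s)\cap O\neq\emptyset\}$ are open. A transition kernel $\kappa$ from $\mathbb{S}$ to $\mathbb{T}$ (finite measures $\kappa(\cdot|s)$, Borel in $s$) is weakly continuous if $s\mapsto\int f\,d\kappa(\cdot|s)$ is continuous for every bounded continuous $f:\mathbb{T}\to\mathbb{R}$; it is a transition probability kernel if every $\kappa(\cdot|s)$ is a probability measure. Here $q$ is viewed as a kernel from $\mathrm{Gr}(A)$ to $\mathbb{X}$. HV-AG transformation. Let $\mu_\ell:\mathbb{X}\to[1,\infty)$ be a continuous function with $\mu_\ell\le K_\ell$ and $\mu_\ell(x)\ge1+\int_{\mathbb{X}\setminus\{\ell\}}\mu_\ell(y)\,q(dy|x,a)$ for all $(x,a)\in\mathrm{Gr}(A)$ (under the hypotheses of the claim such a $\mu_\ell$ exists), and choose a discount factor $\bar\beta\in[(K_\ell-1)/K_\ell,1)$ with $\bar\beta>0$. The new MDP has: - state space $\bar{\mathbb{X}}:=\mathbb{X}\cup\{\bar x\}$, where $\bar x\notin\mathbb{X}$ is isolated from $\mathbb{X}$ (its distance to all points of $\mathbb{X}$ is bounded below by a positive constant); - action space $\bar{\mathbb{A}}:=\mathbb{A}\cup\{\bar a\}$, with $\bar A(x):=A(x)$ for $x\in\mathbb{X}$ and $\bar A(\bar x):=\{\bar a\}$; - costs $\bar c(x,a):=c(x,a)/\mu_\ell(x)$ for $(x,a)\in\mathrm{Gr}(A)$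 and $\bar c(\bar x,\bar a):=0$; - transition probabilities, for $(x,a)\in\mathrm{Gr}(A)$: $\bar p(B|x,a):=\frac{1}{\bar\beta\mu_\ell(x)}\int_B\mu_\ell(y)\,q(dy|x,a)$ for Borel $B\subseteq\mathbb{X}\setminus\{\ell\}$; $\bar p(\{\ell\}|x,a):=\frac{1}{\bar\beta\mu_\ell(x)}\big[\mu_\ell(x)-1-\int_{\mathbb{X}\setminus\{\ell\}}\mu_\ell(y)\,q(dy|x,a)\big]$; $\bar p(\{\bar x\}|x,a):=1-\frac{\mu_\ell(x)-1}{\bar\beta\mu_\ell(x)}$; and $\bar p(\{\bar x\}|\bar x,\bar a):=1$. Policies are sequences of Borel-measurable, history-dependent, possibly randomized decision rules $\pi_n(\cdot|x_0a_0\cdots x_n)$ concentrated on the set of actions available at $x_n$. A stationary policy $\phi\in\mathbb{F}$ is extended to $\bar{\mathbb{X}}$ by $\phi(\bar x)=\bar a$; this identifies the policies of the new MDP with those of the original one. $\bar v^\pi(x):=\bar{\mathbb{E}}_x^\pi\sum_{n=0}^\infty\bar\beta^n\bar c(x_n,a_n)\in[0,\infty]$ is the expected total discounted cost in the new MDP (process governed by $\bar p$ and $\pi$, $x_0=x$), and $\bar v(x):=\inf_\pi\bar v^\pi(x)$. A policy $\pi$ is $\bar\beta$-optimal if $\bar v^\pi(x)=\bar v(x)$ for all $x\in\bar{\mathbb{X}}$. *)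

theory Defs
  imports "HOL-Probability.Probability"
begin

text \<open>
  The type \<open>'x option\<close> is \<open>'x\<close> with one isolated point \<open>None\<close>. The metric is truncated at \<open>1\<close>
  so that \<open>None\<close> can be placed at distance \<open>1\<close> from every point; the topology on the
  \<open>Some\<close>-part is that of \<open>'x\<close>.
\<close>

instantiation option :: (metric_space) metric_space
begin

definition dist_option :: "'a option \<Rightarrow> 'a option \<Rightarrow> real" where
  "dist_option u v =
    (case (u, v) of (Some x, Some y) \<Rightarrow> min 1 (dist x y) | (None, None) \<Rightarrow> 0 | _ \<Rightarrow> 1)"

definition uniformity_option :: "('a option \<times> 'a option) filter" where
  "uniformity_option = (INF e\<in>{0 <..}. principal {(x, y). dist x y < e})"

definition open_option :: "'a option set \<Rightarrow> bool" where
  "open_option U \<longleftrightarrow> (\<forall>x\<in>U. eventually (\<lambda>(x', y). x' = x \<longrightarrow> y \<in> U) uniformity)"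

instance
proof
  fix u v w :: "'a option"
  show "dist u v = 0 \<longleftrightarrow> u = v"
    by (cases u; cases v) (auto simp: dist_option_def min_def)
  show "dist u v \<le> dist u w + dist v w"
  proof (cases u; cases v; cases w)
    fix x y z assume "u = Some x" "v = Some y" "w = Some z"
    moreover have "dist x y \<le> dist x z + dist y z" by (rule dist_triangle2)
    moreover have "0 \<le> dist x z" "0 \<le> dist y z" by auto
    ultimately show ?thesis unfolding dist_option_def by (simp add: min_def del: zero_le_dist)
  qed (auto simp: dist_option_def)
qed (rule uniformity_option_def open_option_def)+

end

lemma dist_option_simps [simp]:
  "dist (Some x) (Some y) = min 1 (dist x y)"
  "dist None (Some y) = 1" "dist (Some x) None = 1"
  by (auto simp: dist_option_def)

lemma open_option_iff: "open U \<longleftrightarrow> open (Some -` U)" for U :: "'a::metric_space option set"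
proof
  assume U: "open U"
  show "open (Some -` U)"
    unfolding open_dist
  proof (intro ballI)
    fix x assume "x \<in> Some -` U"
    then obtain e where e: "e > 0" "\<And>v. dist v (Some x) < e \<Longrightarrow> v \<in> U"
      using U unfolding open_dist by auto
    have "Some y \<in> U" if "dist y x < e" for y
      using that by (intro e(2)) auto
    with e(1) show "\<exists>e>0. \<forall>y. dist y x < e \<longrightarrow> y \<in> Some -` U" by auto
  qed
next
  assume U: "open (Some -` U)"
  show "open U"
    unfolding open_dist
  proof (intro ballI)
    fix u assume u: "u \<in> U"
    show "\<exists>e>0. \<forall>v. dist v u < e \<longrightarrow> v \<in> U"
    proof (cases u)
      case None
      have "v \<in> U" if "dist v u < 1" for v
        using that u None by (cases v) auto
      then show ?thesis by (intro exI[of _ 1]) auto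
    next
      case (Some x)
      then obtain e where e: "e > 0" "\<And>y. dist y x < e \<Longrightarrow> Some y \<in> U"
        using U u unfolding open_dist by auto
      have "v \<in> U" if "dist v u < min 1 e" for v
        using that e(2) Some by (cases v) (auto simp: min_def split: if_splits)
      then show ?thesis using e(1) by (intro exI[of _ "min 1 e"]) auto
    qed
  qed
qed

instance option :: (complete_space) complete_space
proof
  fix U :: "nat \<Rightarrow> 'a option"
  assume C: "Cauchy U"
  then obtain N where N: "\<And>m n. m \<ge> N \<Longrightarrow> n \<ge> N \<Longrightarrow> dist (U m) (U n) < 1"
    unfolding Cauchy_def by (meson zero_less_one)
  show "convergent U"
  proof (cases "U N")
    case None
    have "U n = None" if "n \<ge> N" for n
      using N[of n N] that None by (cases "U n") auto
    then have "U \<longlonglongrightarrow> None"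
      by (intro tendsto_eventually eventually_sequentiallyI)
    then show ?thesis by (rule convergentI)
  next
    case (Some x)
    define Y where "Y n = the (U (n + N))" for n
    have Y: "U (n + N) = Some (Y n)" for n
      using N[of "n + N" N] Some by (cases "U (n + N)") (auto simp: Y_def)
    have "Cauchy Y"
      unfolding Cauchy_def
    proof (intro allI impI)
      fix e :: real assume "e > 0"
      then have "min 1 e > 0" by simp
      then obtain M where M: "\<And>m n. m \<ge> M \<Longrightarrow> n \<ge> M \<Longrightarrow> dist (U m) (U n) < min 1 e"
        using C unfolding Cauchy_def by meson
      have "dist (Y m) (Y n) < e" if "m \<ge> M" "n \<ge> M" for m n
        using M[of "m + N" "n + N"] that by (auto simp: Y min_def split: if_splits)
      then show "\<exists>M. \<forall>m\<ge>M. \<forall>n\<ge>M. dist (Y m) (Y n) < e" by blast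
    qed
    then obtain L where L: "Y \<longlonglongrightarrow> L"
      using Cauchy_convergent_iff convergent_def by blast
    have "(\<lambda>n. U (n + N)) \<longlonglongrightarrow> Some L"
      unfolding Y
    proof (rule tendstoI)
      fix e :: real assume "e > 0"
      from tendstoD[OF L this] show "\<forall>\<^sub>F n in sequentially. dist (Some (Y n)) (Some L) < e"
        by eventually_elim auto
    qed
    then have "U \<longlonglongrightarrow> Some L" by (rule LIMSEQ_offset)
    then show ?thesis by (rule convergentI)
  qed
qed

instance option :: ("{metric_space, second_countable_topology}") second_countable_topology
proof
  obtain B :: "'a set set" where B: "countable B" "topological_basis B"
    using ex_countable_basis by auto
  define B' :: "'a option set set" where "B' = insert {None} ((`) Some ` B)"
  have "topological_basis B'"
  proof (rule topological_basisI)
    fix V assume "V \<in> B'"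
    then consider "V = {None}" | W where "W \<in> B" "V = Some ` W"
      unfolding B'_def by blast
    then show "open V"
    proof cases
      case 1
      have "Some -` {None} = ({} :: 'a set)" by auto
      then show ?thesis using 1 by (simp add: open_option_iff)
    next
      case 2
      have "Some -` (Some ` W) = W" by auto
      moreover have "open W" using topological_basis_open[OF B(2) 2(1)] .
      ultimately show ?thesis by (simp only: open_option_iff 2(2))
    qed
  next
    fix V :: "'a option set" and u assume V: "open V" "u \<in> V"
    show "\<exists>W\<in>B'. u \<in> W \<and> W \<subseteq> V"
    proof (cases u)
      case None
      then show ?thesis using V by (auto simp: B'_def)
    next
      case (Some x)
      then obtain W where "W \<in> B" "x \<in> W" "W \<subseteq> Some -` V"
        using topological_basisE[OF B(2), of "Some -` V" x] V by (auto simp: open_option_iff)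
      then show ?thesis using Some by (auto simp: B'_def)
    qed
  qed
  moreover have "countable B'" using B(1) by (simp add: B'_def)
  ultimately show "\<exists>B::'a option set set. countable B \<and> open = generate_topology B"
    using topological_basis_imp_subbasis by blast
qed

instance option :: (polish_space) polish_space ..

abbreviation borel_on :: "'s::topological_space set \<Rightarrow> 's measure" where
  "borel_on S \<equiv> restrict_space borel S"

definition transition_kernel ::
    "'s::topological_space set \<Rightarrow> 't::topological_space set \<Rightarrow> ('s \<Rightarrow> 't measure) \<Rightarrow> bool" where
  "transition_kernel S T \<kappa> \<longleftrightarrow>
    (\<forall>s\<in>S. finite_measure (\<kappa> s) \<and> sets (\<kappa> s) = sets (borel_on T)) \<and>
    (\<forall>B\<in>sets (borel_on T). (\<lambda>s. measure (\<kappa> s) B) \<in> borel_measurable (borel_on S))"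

definition transition_prob_kernel ::
    "'s::topological_space set \<Rightarrow> 't::topological_space set \<Rightarrow> ('s \<Rightarrow> 't measure) \<Rightarrow> bool" where
  "transition_prob_kernel S T \<kappa> \<longleftrightarrow> transition_kernel S T \<kappa> \<and> (\<forall>s\<in>S. prob_space (\<kappa> s))"

definition weakly_continuous ::
    "'s::topological_space set \<Rightarrow> 't::topological_space set \<Rightarrow> ('s \<Rightarrow> 't measure) \<Rightarrow> bool" where
  "weakly_continuous S T \<kappa> \<longleftrightarrow>
    (\<forall>f::'t \<Rightarrow> real. continuous_on T f \<longrightarrow> bounded (f ` T) \<longrightarrow>
      continuous_on S (\<lambda>s. \<integral>y. f y \<partial>\<kappa> s))"

definition compact_valued :: "'s set \<Rightarrow> ('s \<Rightarrow> 't::topological_space set) \<Rightarrow> bool" where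
  "compact_valued S \<Phi> \<longleftrightarrow> (\<forall>s\<in>S. compact (\<Phi> s))"

definition continuous_set_map ::
    "'s::topological_space set \<Rightarrow> 't::topological_space set \<Rightarrow> ('s \<Rightarrow> 't set) \<Rightarrow> bool" where
  "continuous_set_map S T \<Phi> \<longleftrightarrow>
    (\<forall>U. openin (top_of_set T) U \<longrightarrow>
      openin (top_of_set S) {s\<in>S. \<Phi> s \<subseteq> U} \<and>
      openin (top_of_set S) {s\<in>S. \<Phi> s \<inter> U \<noteq> {}})"

definition lower_semicontinuous_on :: "'s::topological_space set \<Rightarrow> ('s \<Rightarrow> real) \<Rightarrow> bool" where
  "lower_semicontinuous_on S f \<longleftrightarrow>
    (\<forall>s\<in>S. \<forall>r<f s. eventually (\<lambda>t. r < f t) (at s within S))"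

definition isolated_from :: "'s::metric_space \<Rightarrow> 's set \<Rightarrow> bool" where
  "isolated_from z S \<longleftrightarrow> (\<exists>\<epsilon>>0. \<forall>x\<in>S - {z}. dist z x > \<epsilon>)"

definition is_min_of :: "'b::linorder \<Rightarrow> 'b set \<Rightarrow> bool" where
  "is_min_of m S \<longleftrightarrow> m \<in> S \<and> (\<forall>s\<in>S. m \<le> s)"

text \<open>The graph of \<open>A\<close> over the state set \<open>X\<close> is \<open>Sigma X A\<close>.\<close>

definition stationary_policies ::
    "'s::topological_space set \<Rightarrow> 'b::topological_space set \<Rightarrow> ('s \<Rightarrow> 'b set) \<Rightarrow> ('s \<Rightarrow> 'b) set" where
  "stationary_policies X Act A =
    {\<phi>. \<phi> \<in> borel_on X \<rightarrow>\<^sub>M borel_on Act \<and> (\<forall>x\<in>X. \<phi> x \<in> A x)}"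

definition mdp ::
    "'s::polish_space set \<Rightarrow> 'b::polish_space set \<Rightarrow> ('s \<Rightarrow> 'b set) \<Rightarrow> ('s \<times> 'b \<Rightarrow> real) \<Rightarrow>
      ('s \<times> 'b \<Rightarrow> 's measure) \<Rightarrow> bool" where
  "mdp X Act A c q \<longleftrightarrow>
    X \<in> sets borel \<and> Act \<in> sets borel \<and>
    (\<forall>x\<in>X. A x \<noteq> {} \<and> A x \<subseteq> Act \<and> A x \<in> sets borel) \<and>
    Sigma X A \<in> sets borel \<and>
    stationary_policies X Act A \<noteq> {} \<and>
    c \<in> borel_measurable (borel_on (Sigma X A)) \<and> (\<forall>z\<in>Sigma X A. 0 \<le> c z) \<and>
    transition_kernel (Sigma X A) X q \<and>
    (\<exists>C. \<forall>z\<in>Sigma X A. measure (q z) X \<le> C)"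

definition Q_op ::
    "'s set \<Rightarrow> ('s \<times> 'b \<Rightarrow> 's measure) \<Rightarrow> 's \<Rightarrow> ('s \<Rightarrow> 'b) \<Rightarrow> ('s \<Rightarrow> ennreal) \<Rightarrow> 's \<Rightarrow> ennreal" where
  "Q_op X q z \<phi> u x = (\<integral>\<^sup>+y\<in>X - {z}. u y \<partial>q (x, \<phi> x))"

definition hitting_time_bound ::
    "'s::metric_space set \<Rightarrow> 'b::topological_space set \<Rightarrow> ('s \<Rightarrow> 'b set) \<Rightarrow>
      ('s \<times> 'b \<Rightarrow> 's measure) \<Rightarrow> 's \<Rightarrow> real \<Rightarrow> bool" where
  "hitting_time_bound X Act A q l K \<longleftrightarrow>
    (\<forall>\<phi>\<in>stationary_policies X Act A. \<forall>x\<in>X.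
      (\<Sum>n. (Q_op X q l \<phi> ^^ n) (\<lambda>_. 1) x) \<le> ennreal K)"

text \<open>
  A policy maps the epoch \<open>n\<close>, the past state-action pairs \<open>(x\<^sub>0,a\<^sub>0), \<dots>, (x\<^sub>n\<^sub>-\<^sub>1,a\<^sub>n\<^sub>-\<^sub>1)\<close>
  (a function on \<open>{0..<n}\<close>) and the current state \<open>x\<^sub>n\<close> to a distribution on actions.
\<close>

type_synonym ('s, 'b) policy = "nat \<Rightarrow> (nat \<Rightarrow> 's \<times> 'b) \<Rightarrow> 's \<Rightarrow> 'b measure"

abbreviation pair_space ::
    "'s::topological_space set \<Rightarrow> 'b::topological_space set \<Rightarrow> ('s \<times> 'b) measure" where
  "pair_space X Act \<equiv> borel_on X \<Otimes>\<^sub>M borel_on Act"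

definition policies ::
    "'s::topological_space set \<Rightarrow> 'b::topological_space set \<Rightarrow> ('s \<Rightarrow> 'b set) \<Rightarrow> ('s, 'b) policy set" where
  "policies X Act A = {\<pi>. \<forall>n.
    (\<lambda>(h, x). \<pi> n h x) \<in>
      (\<Pi>\<^sub>M i\<in>{0..<n}. pair_space X Act) \<Otimes>\<^sub>M borel_on X \<rightarrow>\<^sub>M prob_algebra (borel_on Act) \<and>
    (\<forall>h\<in>space (\<Pi>\<^sub>M i\<in>{0..<n}. pair_space X Act). \<forall>x\<in>X. emeasure (\<pi> n h x) (A x) = 1)}"

definition stationary ::
    "'b::topological_space set \<Rightarrow> ('s \<Rightarrow> 'b) \<Rightarrow> ('s, 'b) policy" where
  "stationary Act \<phi> = (\<lambda>n h x. return (borel_on Act) (\<phi> x))"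

text \<open>
  Conditional law of \<open>(x\<^sub>n,a\<^sub>n)\<close> given the past. Since a transition law is only given on the graph
  of \<open>A\<close>, while histories range over all of \<open>(X \<times> Act)\<^sup>n\<close>, it is continued arbitrarily off the
  graph (the state stays put); policies give such histories probability zero.
\<close>

definition step_kernel ::
    "'s::topological_space set \<Rightarrow> 'b::topological_space set \<Rightarrow> ('s \<Rightarrow> 'b set) \<Rightarrow>
      ('s \<times> 'b \<Rightarrow> 's measure) \<Rightarrow> ('s, 'b) policy \<Rightarrow> 's \<Rightarrow> nat \<Rightarrow> (nat \<Rightarrow> 's \<times> 'b) \<Rightarrow>
      ('s \<times> 'b) measure" where
  "step_kernel X Act A p \<pi> x0 n h =
    (if n = 0 then return (borel_on X) x0
     else if h (n - 1) \<in> Sigma X A then p (h (n - 1))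
     else return (borel_on X) (fst (h (n - 1))))
    \<bind> (\<lambda>x. distr (\<pi> n h x) (pair_space X Act) (Pair x))"

text \<open>The law of \<open>((x\<^sub>n,a\<^sub>n))\<^sub>n\<close> on \<open>(X \<times> Act)\<^sup>\<infinity>\<close>, by the Ionescu-Tulcea construction.\<close>

definition process_law ::
    "'s::topological_space set \<Rightarrow> 'b::topological_space set \<Rightarrow> ('s \<Rightarrow> 'b set) \<Rightarrow>
      ('s \<times> 'b \<Rightarrow> 's measure) \<Rightarrow> ('s, 'b) policy \<Rightarrow> 's \<Rightarrow> (nat \<Rightarrow> 's \<times> 'b) measure" where
  "process_law X Act A p \<pi> x0 =
    projective_family.lim UNIV
      (Ionescu_Tulcea.CI (step_kernel X Act A p \<pi> x0) (\<lambda>_. pair_space X Act))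
      (\<lambda>_. pair_space X Act)"

definition discounted_cost ::
    "'s::topological_space set \<Rightarrow> 'b::topological_space set \<Rightarrow> ('s \<Rightarrow> 'b set) \<Rightarrow>
      ('s \<times> 'b \<Rightarrow> real) \<Rightarrow> ('s \<times> 'b \<Rightarrow> 's measure) \<Rightarrow> real \<Rightarrow> ('s, 'b) policy \<Rightarrow> 's \<Rightarrow> ennreal" where
  "discounted_cost X Act A c p \<beta> \<pi> x =
    (\<integral>\<^sup>+\<omega>. (\<Sum>n. ennreal (\<beta> ^ n * c (\<omega> n))) \<partial>process_law X Act A p \<pi> x)"

definition value_function ::
    "'s::topological_space set \<Rightarrow> 'b::topological_space set \<Rightarrow> ('s \<Rightarrow> 'b set) \<Rightarrow>
      ('s \<times> 'b \<Rightarrow> real) \<Rightarrow> ('s \<times> 'b \<Rightarrow> 's measure) \<Rightarrow> real \<Rightarrow> 's \<Rightarrow> ennreal" where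
  "value_function X Act A c p \<beta> x = (INF \<pi>\<in>policies X Act A. discounted_cost X Act A c p \<beta> \<pi> x)"

definition discount_optimal ::
    "'s::topological_space set \<Rightarrow> 'b::topological_space set \<Rightarrow> ('s \<Rightarrow> 'b set) \<Rightarrow>
      ('s \<times> 'b \<Rightarrow> real) \<Rightarrow> ('s \<times> 'b \<Rightarrow> 's measure) \<Rightarrow> real \<Rightarrow> ('s, 'b) policy \<Rightarrow> bool" where
  "discount_optimal X Act A c p \<beta> \<pi> \<longleftrightarrow> \<pi> \<in> policies X Act A \<and>
    (\<forall>x\<in>X. discounted_cost X Act A c p \<beta> \<pi> x = value_function X Act A c p \<beta> x)"

definition hv_weight ::
    "'s::topological_space set \<Rightarrow> ('s \<Rightarrow> 'b set) \<Rightarrow> ('s \<times> 'b \<Rightarrow> 's measure) \<Rightarrow> 's \<Rightarrow> real \<Rightarrow>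
      ('s \<Rightarrow> real) \<Rightarrow> bool" where
  "hv_weight X A q l K \<mu> \<longleftrightarrow>
    continuous_on X \<mu> \<and> (\<forall>x\<in>X. 1 \<le> \<mu> x \<and> \<mu> x \<le> K) \<and>
    (\<forall>x\<in>X. \<forall>a\<in>A x. \<mu> x \<ge> 1 + (LINT y:X - {l}|q (x, a). \<mu> y))"

text \<open>The absorbing state and its only action are both \<open>None\<close>.\<close>

abbreviation adjoin :: "'s set \<Rightarrow> 's option set" where
  "adjoin S \<equiv> insert None (Some ` S)"

definition hv_actions :: "('s \<Rightarrow> 'b set) \<Rightarrow> 's option \<Rightarrow> 'b option set" where
  "hv_actions A s = (case s of Some x \<Rightarrow> Some ` A x | None \<Rightarrow> {None})"

definition hv_cost :: "('s \<times> 'b \<Rightarrow> real) \<Rightarrow> ('s \<Rightarrow> real) \<Rightarrow> 's option \<times> 'b option \<Rightarrow> real" where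
  "hv_cost c \<mu> z = (case z of (Some x, Some a) \<Rightarrow> c (x, a) / \<mu> x | _ \<Rightarrow> 0)"

definition hv_kernel ::
    "'s::metric_space set \<Rightarrow> ('s \<times> 'b \<Rightarrow> 's measure) \<Rightarrow> 's \<Rightarrow> ('s \<Rightarrow> real) \<Rightarrow> real \<Rightarrow>
      's option \<times> 'b option \<Rightarrow> 's option measure" where
  "hv_kernel X q l \<mu> \<beta> z = (case z of
     (Some x, Some a) \<Rightarrow> measure_of (adjoin X) (sets (borel_on (adjoin X))) (\<lambda>B.
        ennreal (1 / (\<beta> * \<mu> x)) * (\<integral>\<^sup>+y\<in>{y\<in>X - {l}. Some y \<in> B}. ennreal (\<mu> y) \<partial>q (x, a))
      + ennreal (1 / (\<beta> * \<mu> x) * (\<mu> x - 1 - (LINT y:X - {l}|q (x, a). \<mu> y))) * indicator B (Some l)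
      + ennreal (1 - (\<mu> x - 1) / (\<beta> * \<mu> x)) * indicator B None)
   | _ \<Rightarrow> return (borel_on (adjoin X)) None)"

text \<open>The set function above is countably additive, so it is the measure it generates.\<close>

lemma emeasure_hv_kernel:
  fixes X :: "'s::polish_space set"
  assumes q: "sets (q (x, a)) = sets (borel_on X)" and X: "X \<in> sets borel"
    and mu: "continuous_on X \<mu>" and B: "B \<in> sets (borel_on (adjoin X))"
  shows "emeasure (hv_kernel X q l \<mu> \<beta> (Some x, Some a)) B =
        ennreal (1 / (\<beta> * \<mu> x)) * (\<integral>\<^sup>+y\<in>{y\<in>X - {l}. Some y \<in> B}. ennreal (\<mu> y) \<partial>q (x, a))
      + ennreal (1 / (\<beta> * \<mu> x) * (\<mu> x - 1 - (LINT y:X - {l}|q (x, a). \<mu> y))) * indicator B (Some l)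
      + ennreal (1 - (\<mu> x - 1) / (\<beta> * \<mu> x)) * indicator B None"
proof -
  let ?N = "borel_on (adjoin X)"
  let ?c = "ennreal (1 / (\<beta> * \<mu> x))"
  let ?d = "ennreal (1 / (\<beta> * \<mu> x) * (\<mu> x - 1 - (LINT y:X - {l}|q (x, a). \<mu> y)))"
  let ?e = "ennreal (1 - (\<mu> x - 1) / (\<beta> * \<mu> x))"
  let ?I = "\<lambda>B. (\<integral>\<^sup>+y\<in>{y\<in>X - {l}. Some y \<in> B}. ennreal (\<mu> y) \<partial>q (x, a))"
  let ?f = "\<lambda>B. ?c * ?I B + ?d * indicator B (Some l) + ?e * indicator B None"
  have sp: "space ?N = adjoin X" by (simp add: space_restrict_space)
  have some: "Some \<in> borel_on X \<rightarrow>\<^sub>M ?N"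
    by (intro measurable_restrict_space3 borel_measurable_continuous_onI)
       (auto simp: continuous_on_open_vimage open_option_iff)
  have [measurable]: "\<mu> \<in> borel_measurable (q (x, a))"
    using borel_measurable_continuous_on_restrict[OF mu] measurable_cong_sets[OF q refl] by blast
  have spq: "space (q (x, a)) = X"
    using sets_eq_imp_space_eq[OF q] by (simp add: space_restrict_space)
  have l: "X - {l} \<in> sets (borel_on X)"
    using X by (auto simp: sets_restrict_space_iff)
  have J: "{y \<in> X - {l}. Some y \<in> C} \<in> sets (q (x, a))" if "C \<in> sets ?N" for C
  proof -
    have "Some -` C \<inter> space (borel_on X) \<in> sets (borel_on X)"
      using some that by (rule measurable_sets)
    from sets.Int[OF this l] have "(Some -` C \<inter> space (borel_on X)) \<inter> (X - {l}) \<in> sets (q (x, a))"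
      by (simp add: q)
    moreover have "(Some -` C \<inter> space (borel_on X)) \<inter> (X - {l}) = {y \<in> X - {l}. Some y \<in> C}"
      by (auto simp: space_restrict_space)
    ultimately show ?thesis by simp
  qed
  have "countably_additive (sets ?N) ?f"
  proof (rule countably_additiveI)
    fix D :: "nat \<Rightarrow> 's option set"
    assume D: "range D \<subseteq> sets ?N" "disjoint_family D" "(\<Union>i. D i) \<in> sets ?N"
    have ind: "(\<Sum>i. indicator (D i) u) = (indicator (\<Union>i. D i) u :: ennreal)" for u
      by (rule suminf_indicator[OF D(2)])
    have "(\<Sum>i. ?I (D i)) = (\<integral>\<^sup>+y. (\<Sum>i. ennreal (\<mu> y) * indicator {y\<in>X - {l}. Some y \<in> D i} y) \<partial>q (x, a))"
    proof (subst nn_integral_suminf)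
      fix i
      have [measurable]: "{y \<in> X - {l}. Some y \<in> D i} \<in> sets (q (x, a))" using D(1) by (intro J) auto
      show "(\<lambda>y. ennreal (\<mu> y) * indicator {y \<in> X - {l}. Some y \<in> D i} y) \<in> borel_measurable (q (x, a))"
        by measurable
    qed simp
    also have "\<dots> = ?I (\<Union>i. D i)"
    proof (rule nn_integral_cong)
      fix y
      have "(indicator {y \<in> X - {l}. Some y \<in> E} y :: ennreal) = indicator (X - {l}) y * indicator E (Some y)" for E
        by (auto simp: indicator_def)
      then show "(\<Sum>i. ennreal (\<mu> y) * indicator {y\<in>X - {l}. Some y \<in> D i} y) =
          ennreal (\<mu> y) * indicator {y\<in>X - {l}. Some y \<in> (\<Union>i. D i)} y"
        using ind[of "Some y"] by (simp only: ennreal_suminf_cmult)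
    qed
    finally have I: "(\<Sum>i. ?I (D i)) = ?I (\<Union>i. D i)" .
    have "(\<Sum>i. ?f (D i)) = ?c * (\<Sum>i. ?I (D i)) + ?d * (\<Sum>i. indicator (D i) (Some l)) + ?e * (\<Sum>i. indicator (D i) None)"
      by (simp only: suminf_add[symmetric] summableI ennreal_suminf_cmult)
    then show "(\<Sum>i. ?f (D i)) = ?f (\<Union>i. D i)"
      by (simp only: I ind)
  qed
  moreover have "positive (sets ?N) ?f" by (simp add: positive_def)
  moreover have "sigma_algebra (adjoin X) (sets ?N)"
    using sets.sigma_algebra_axioms[of ?N] by (simp only: sp)
  ultimately have "emeasure (measure_of (adjoin X) (sets ?N) ?f) B = ?f B"
    using B by (intro emeasure_measure_of_sigma) auto
  then show ?thesis by (simp add: hv_kernel_def)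
qed

end

theory Submission
  imports Defs
begin

text \<open>
  Weak continuity of the transformed kernel reduces to that of \<open>q\<close>: as \<open>l\<close> is isolated, the
  function equal to \<open>\<mu>\<close> off \<open>l\<close> and to \<open>0\<close> at \<open>l\<close> is continuous and bounded, so every mean of a
  bounded continuous function under the new kernel is a continuous combination of \<open>q\<close>-means.

  For nonnegative lower semicontinuous costs the value iterates \<open>v\<^sub>n = T\<^sup>n 0\<close> are lower
  semicontinuous and increase to some \<open>v\<^sub>\<infinity>\<close>. Compactness of the action sets gives
  \<open>v\<^sub>\<infinity> = T v\<^sub>\<infinity>\<close> and a Borel minimiser \<open>\<phi>\<close>. Each \<open>v\<^sub>n\<close> bounds the \<open>n\<close>-stage cost of every policy
  from below, while every \<open>u \<ge> T\<^sub>\<phi> u\<close> with \<open>u \<ge> 0\<close> dominates the cost of the stationary policy \<open>\<phi>\<close>;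
  hence \<open>v\<^sub>\<infinity>\<close> is the value function and \<open>\<phi>\<close> is optimal. The same two facts give the
  characterisation of the optimal stationary policies, infinite values included.
\<close>

section \<open>Lower semicontinuity and measurable minimisers\<close>

text \<open>Costs are unbounded and the value may be infinite, so no contraction is available; the
  comparison arguments run through monotone limits in \<open>ennreal\<close> and never subtract. The
  obstacle is then measurability: the value function is an infimum over uncountably many policies,
  and an infimum over actions of Borel functions need not be Borel. Lower semicontinuity, phrased
  through closed sublevel sets, removes it: suprema become intersections, and minimising over
  compact fibres becomes projecting a closed subset of the graph, which stays closed. The constants
  of the transformation have one origin, the requirement that the new kernel be a probability: the
  inequality for \<open>\<mu>\<close> is nonnegativity of the mass moved to \<open>l\<close>, and
  \<open>(K - 1) / K \<le> \<beta>\<close> gives nonnegativity of the mass sent to the absorbing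
  state. That state costs nothing, so its value is zero, and the integral in the optimality equation
  may be restricted to the original states.\<close>

definition lsc_on :: "'s::topological_space set \<Rightarrow> ('s \<Rightarrow> ennreal) \<Rightarrow> bool" where
  "lsc_on S f \<longleftrightarrow> (\<forall>r. closedin (top_of_set S) {s\<in>S. f s \<le> r})"

text \<open>A tube-lemma argument. For \<open>x\<close> outside the projection, the compact fibre
  \<open>A x\<close> is covered by the second sides of finitely many boxes missing \<open>C\<close>.
  The states \<open>y\<close> with \<open>A y\<close> inside that cover form an open set by
  continuity of the set map, so a whole neighbourhood of \<open>x\<close> avoids the
  projection.\<close>

lemma closedin_fst_image:
  fixes X :: "'x::topological_space set" and A :: "'x \<Rightarrow> 'a::topological_space set"
  assumes A: "compact_valued X A" "continuous_set_map X Act A" "\<And>x. x \<in> X \<Longrightarrow> A x \<subseteq> Act"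
    and C: "closedin (top_of_set (Sigma X A)) C"
  shows "closedin (top_of_set X) (fst ` C)"
proof -
  obtain T where T: "closed T" "C = Sigma X A \<inter> T"
    using C by (auto simp: closedin_closed)
  have "\<exists>V. openin (top_of_set X) V \<and> x \<in> V \<and> V \<subseteq> X - fst ` C" if x: "x \<in> X - fst ` C" for x
  proof -
    have "\<exists>V U. open V \<and> open U \<and> x \<in> V \<and> a \<in> U \<and> V \<times> U \<subseteq> - T" if "a \<in> A x" for a
    proof -
      have "open (- T)" "(x, a) \<in> - T" using T x that by force+
      then obtain V U where "open V" "open U" "(x, a) \<in> V \<times> U" "V \<times> U \<subseteq> - T"
        by (rule open_prod_elim)
      then show ?thesis by blast
    qed
    then obtain V U where VU: "\<And>a. a \<in> A x \<Longrightarrow> open (V a) \<and> open (U a) \<and> x \<in> V a \<and> a \<in> U a \<and> V a \<times> U a \<subseteq> - T"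
      by metis
    have "compact (A x)" using A x by (auto simp: compact_valued_def)
    moreover have "A x \<subseteq> (\<Union>a\<in>A x. U a)" using VU by auto
    ultimately obtain D where D: "D \<subseteq> A x" "finite D" "A x \<subseteq> (\<Union>a\<in>D. U a)"
      using VU by (elim compactE_image) auto
    define W where "W = X \<inter> (\<Inter>a\<in>D. V a) \<inter> {y\<in>X. A y \<subseteq> Act \<inter> (\<Union>a\<in>D. U a)}"
    have o1: "openin (top_of_set Act) (Act \<inter> (\<Union>a\<in>D. U a))"
      using VU D by (intro openin_open_Int) auto
    have "openin (top_of_set X) {y\<in>X. A y \<subseteq> Act \<inter> (\<Union>a\<in>D. U a)}"
      using A(2) o1 unfolding continuous_set_map_def by blast
    then have "openin (top_of_set X) W" unfolding W_def
      using VU D by (intro openin_Int openin_open_Int) auto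
    moreover have "x \<in> W" using x D VU A(3) by (auto simp: W_def)
    moreover have "W \<subseteq> X - fst ` C"
    proof
      fix y assume y: "y \<in> W"
      have "(y, b) \<notin> T" if "b \<in> A y" for b
      proof -
        have "b \<in> (\<Union>a\<in>D. U a)" using y that by (auto simp: W_def)
        then obtain a where a: "a \<in> D" "b \<in> U a" by auto
        then have "(y, b) \<in> V a \<times> U a" using y by (auto simp: W_def)
        then show ?thesis using VU[of a] a D by blast
      qed
      then show "y \<in> X - fst ` C" using y by (auto simp: W_def T)
    qed
    ultimately show ?thesis by blast
  qed
  then have "openin (top_of_set X) (X - fst ` C)" by (subst openin_subopen) blast
  moreover have "fst ` C \<subseteq> X" using T by auto
  ultimately show ?thesis by (auto simp: closedin_def)
qed

text \<open>The sets \<open>{a \<in> K. f a \<le> f b}\<close> are closed and ordered by inclusion,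
  so they have the finite intersection property; any point common to all of them is a
  minimiser.\<close>

lemma lsc_attains_inf:
  fixes f :: "'s::t2_space \<Rightarrow> ennreal"
  assumes K: "compact K" "K \<noteq> {}" and f: "lsc_on K f"
  obtains a where "a \<in> K" "\<And>b. b \<in> K \<Longrightarrow> f a \<le> f b"
proof -
  let ?F = "(\<lambda>b. {a\<in>K. f a \<le> f b}) ` K"
  have "K \<inter> \<Inter>?F \<noteq> {}"
  proof (rule compact_imp_fip[OF K(1)])
    show "closed T" if T: "T \<in> ?F" for T
    proof -
      from T f have "closedin (top_of_set K) T" by (auto simp: lsc_on_def)
      then show ?thesis using K(1) compact_imp_closed closedin_closed_trans by blast
    qed
  next
    fix F' assume F': "finite F'" "F' \<subseteq> ?F"
    then obtain D where D: "finite D" "D \<subseteq> K" "F' = (\<lambda>b. {a\<in>K. f a \<le> f b}) ` D"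
      by (meson finite_subset_image)
    show "K \<inter> \<Inter>F' \<noteq> {}"
    proof (cases "D = {}")
      case False
      then have "Min (f ` D) \<in> f ` D" using D by (intro Min_in) auto
      then obtain a where a: "a \<in> D" "f a = Min (f ` D)" by auto
      then have "\<forall>b\<in>D. f a \<le> f b" using D by auto
      then show ?thesis using a D by auto
    qed (use D K in auto)
  qed
  then show ?thesis using that by blast
qed

text \<open>Cantor's intersection theorem. It yields the limit point of the lexicographic selection
  and, later, one action that serves all horizons.\<close>

lemma compact_decseq_nonempty:
  fixes F :: "nat \<Rightarrow> 'a::t2_space set"
  assumes F: "\<And>n. compact (F n)" "\<And>n. F n \<noteq> {}" "decseq F"
  shows "(\<Inter>n. F n) \<noteq> {}"
proof -
  have "F 0 \<inter> \<Inter>(range F) \<noteq> {}"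
  proof (rule compact_imp_fip[OF F(1)])
    show "closed T" if "T \<in> range F" for T
      using that F(1) by (auto intro: compact_imp_closed)
  next
    fix F' assume "finite F'" "F' \<subseteq> range F"
    then obtain I where I: "finite I" "F' = F ` I" by (meson finite_subset_image)
    have "\<exists>n. \<forall>i\<in>I. i \<le> n" using I(1) by (simp add: finite_nat_set_iff_bounded_le)
    then obtain n where n: "\<And>i. i \<in> I \<Longrightarrow> i \<le> n" by auto
    have "F n \<subseteq> F 0" "\<And>i. i \<in> I \<Longrightarrow> F n \<subseteq> F i" using n F(3) by (simp_all add: decseq_def)
    then have "F n \<subseteq> F 0 \<inter> \<Inter>F'" unfolding I(2) by blast
    then show "F 0 \<inter> \<Inter>F' \<noteq> {}" using F(2)[of n] by blast
  qed
  then show ?thesis by blast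
qed

lemma lsc_on_subset: "lsc_on S f \<Longrightarrow> T \<subseteq> S \<Longrightarrow> lsc_on T f"
  unfolding lsc_on_def
proof
  fix r assume S: "\<forall>r. closedin (top_of_set S) {s \<in> S. f s \<le> r}" "T \<subseteq> S"
  obtain C where "closed C" "{s \<in> S. f s \<le> r} = S \<inter> C"
    using S(1) unfolding closedin_closed by metis
  then show "closedin (top_of_set T) {s \<in> T. f s \<le> r}"
    using S(2) unfolding closedin_closed by (intro exI[of _ C]) blast
qed

lemma lsc_on_compose:
  assumes f: "lsc_on S f" and g: "continuous_on T g" "g \<in> T \<rightarrow> S"
  shows "lsc_on T (\<lambda>t. f (g t))"
  unfolding lsc_on_def
proof
  fix r
  have "closedin (top_of_set T) (T \<inter> g -` {s \<in> S. f s \<le> r})"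
    using f g by (intro continuous_closedin_preimage_gen) (auto simp: lsc_on_def)
  also have "T \<inter> g -` {s \<in> S. f s \<le> r} = {t \<in> T. f (g t) \<le> r}" using g by auto
  finally show "closedin (top_of_set T) {t \<in> T. f (g t) \<le> r}" .
qed

lemma lsc_on_SUP:
  assumes "\<And>i. i \<in> I \<Longrightarrow> lsc_on S (f i)"
  shows "lsc_on S (\<lambda>s. SUP i\<in>I. f i s)"
  unfolding lsc_on_def
proof
  fix r
  have "{s\<in>S. (SUP i\<in>I. f i s) \<le> r} = S \<inter> (\<Inter>i\<in>I. {s\<in>S. f i s \<le> r})"
    by (auto simp: SUP_le_iff)
  also have "closedin (top_of_set S) \<dots>"
  proof (cases "I = {}")
    case False
    with assms show ?thesis unfolding lsc_on_def
      by (intro closedin_Int closedin_INT) auto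
  qed simp
  finally show "closedin (top_of_set S) {s\<in>S. (SUP i\<in>I. f i s) \<le> r}" .
qed

lemma lsc_on_measurable:
  assumes "lsc_on S f" shows "f \<in> borel_measurable (borel_on S)"
proof (rule borel_measurableI_le)
  fix r
  obtain T where "closed T" "{s\<in>S. f s \<le> r} = S \<inter> T"
    using assms unfolding lsc_on_def closedin_closed by metis
  then have "{s\<in>S. f s \<le> r} \<in> sets (borel_on S)" by (auto simp: sets_restrict_space)
  then show "{s \<in> space (borel_on S). f s \<le> r} \<in> sets (borel_on S)" by (simp add: space_restrict_space)
qed

text \<open>
  Lexicographic minimisation of the distances to a dense sequence singles out one point of each
  compact set, and measurability is preserved at every stage.
\<close>

lemma compact_measurable_selector:
  fixes F :: "'x \<Rightarrow> 'a::{metric_space, second_countable_topology} set"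
  assumes F: "\<And>x. x \<in> space M \<Longrightarrow> compact (F x)" "\<And>x. x \<in> space M \<Longrightarrow> F x \<noteq> {}"
    and meas: "\<And>C. closed C \<Longrightarrow> {x \<in> space M. F x \<inter> C \<noteq> {}} \<in> sets M"
  obtains \<phi> where "\<phi> \<in> borel_measurable M" "\<And>x. x \<in> space M \<Longrightarrow> \<phi> x \<in> F x"
proof -
  obtain D :: "'a set" where D: "countable D" "\<And>U. open U \<Longrightarrow> U \<noteq> {} \<Longrightarrow> \<exists>d\<in>D. d \<in> U"
    using countable_dense_exists by blast
  have "D \<noteq> {}" using D(2)[of UNIV] by auto
  define d where "d = from_nat_into D"
  have dD: "range d = D" using D \<open>D \<noteq> {}\<close> by (simp add: d_def range_from_nat_into)
  \<comment> \<open>\<open>G k x\<close> holds the points of \<open>F x\<close> that survive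
    minimisation of the distances to \<open>d 0\<close>, ..., \<open>d (k - 1)\<close>, in that
    order.\<close>
  define G where "G = rec_nat F (\<lambda>k H x. {a \<in> H x. \<forall>b\<in>H x. dist a (d k) \<le> dist b (d k)})"
  have G0: "G 0 = F" and GS: "G (Suc k) x = {a \<in> G k x. \<forall>b\<in>G k x. dist a (d k) \<le> dist b (d k)}" for k x
    by (simp_all add: G_def)
  have cont: "continuous_on S (\<lambda>a. dist a (d k))" for S k by (intro continuous_intros)
  have G: "compact (G k x) \<and> G k x \<noteq> {}" if x: "x \<in> space M" for k x
  proof (induction k)
    case 0 then show ?case using F x by (simp add: G0)
  next
    case (Suc k)
    then obtain a where a: "a \<in> G k x" "\<forall>b\<in>G k x. dist a (d k) \<le> dist b (d k)"
      using continuous_attains_inf[OF _ _ cont, of "G k x" k] by auto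
    have "G (Suc k) x = G k x \<inter> cball (d k) (dist a (d k))"
      using a by (force simp: GS dist_commute)
    moreover have "a \<in> G (Suc k) x" using a by (simp add: GS)
    ultimately show ?case using Suc by (auto intro: compact_Int_closed)
  qed
  have Gdec: "G n x \<subseteq> G m x" if "m \<le> n" for m n x
    using that by (induction rule: dec_induct) (auto simp: GS)
  have Gmeas: "{x \<in> space M. G k x \<inter> C \<noteq> {}} \<in> sets M" if "closed C" for k C
    using that
  proof (induction k arbitrary: C)
    case 0 then show ?case using meas by (simp add: G0)
  next
    case (Suc k)
    \<comment> \<open>Two minima are compared through rational radii: \<open>C\<close> contains a
      minimiser of the distance to \<open>d k\<close> iff every rational closed ball around
      \<open>d k\<close> that meets \<open>G k x\<close> also meets it within \<open>C\<close>. The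
      right side involves only countably many hitting sets of stage \<open>k\<close>.\<close>
    have "G (Suc k) x \<inter> C \<noteq> {} \<longleftrightarrow>
        (\<forall>r\<in>\<rat>. \<not> (G k x \<inter> cball (d k) r \<noteq> {}) \<or> G k x \<inter> (C \<inter> cball (d k) r) \<noteq> {})"
      (is "?L \<longleftrightarrow> ?R") if x: "x \<in> space M" for x
    proof
      assume ?L
      then obtain a where a: "a \<in> C" "a \<in> G k x" "\<forall>b\<in>G k x. dist a (d k) \<le> dist b (d k)"
        by (auto simp: GS)
      show ?R
      proof (intro ballI)
        fix r :: real
        have "G k x \<inter> (C \<inter> cball (d k) r) \<noteq> {}" if "G k x \<inter> cball (d k) r \<noteq> {}"
        proof -
          from that obtain b where "b \<in> G k x" "dist (d k) b \<le> r" by auto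
          then have "a \<in> G k x \<inter> (C \<inter> cball (d k) r)"
            using a by (force simp: dist_commute)
          then show ?thesis by blast
        qed
        then show "\<not> (G k x \<inter> cball (d k) r \<noteq> {}) \<or> G k x \<inter> (C \<inter> cball (d k) r) \<noteq> {}" by blast
      qed
    next
      assume R: ?R
      have "G (Suc k) x \<noteq> {}" using G x by blast
      then obtain b where b: "b \<in> G k x" "\<forall>a\<in>G k x. dist b (d k) \<le> dist a (d k)"
        by (auto simp: GS)
      have R': "G k x \<inter> (C \<inter> cball (d k) r) \<noteq> {}" if "r \<in> \<rat>" "dist b (d k) < r" for r
        using R that b(1) by (force simp: dist_commute)
      obtain r where r: "dist b (d k) < r" "r \<in> \<rat>"
        using Rats_dense_in_real[of "dist b (d k)" "dist b (d k) + 1"] by auto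
      then have ne: "G k x \<inter> C \<noteq> {}" using R' by blast
      have "compact (G k x \<inter> C)" using G x Suc.prems by (blast intro: compact_Int_closed)
      then obtain a where a: "a \<in> G k x \<inter> C" "\<forall>y\<in>G k x \<inter> C. dist a (d k) \<le> dist y (d k)"
        using continuous_attains_inf[OF _ ne cont] by auto
      have "dist a (d k) \<le> dist b (d k)"
      proof (rule ccontr)
        assume "\<not> ?thesis"
        then obtain r where r: "dist b (d k) < r" "r < dist a (d k)" "r \<in> \<rat>"
          using Rats_dense_in_real[of "dist b (d k)" "dist a (d k)"] by auto
        from R'[OF r(3,1)] obtain y where "y \<in> G k x \<inter> (C \<inter> cball (d k) r)" by blast
        then have "y \<in> G k x \<inter> C" "dist y (d k) \<le> r" by (simp_all add: dist_commute)
        then show False using a(2) r(2) by (meson leD order_trans)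
      qed
      then have "a \<in> G (Suc k) x" using a b by (force simp: GS)
      then show ?L using a by auto
    qed
    then have "{x \<in> space M. G (Suc k) x \<inter> C \<noteq> {}} = {x \<in> space M. \<forall>r\<in>\<rat>. \<not> (G k x \<inter> cball (d k) r \<noteq> {}) \<or> G k x \<inter> (C \<inter> cball (d k) r) \<noteq> {}}"
      by blast
    also have "\<dots> \<in> sets M"
    proof (rule sets.sets_Collect_countable_All'[OF _ countable_rat])
      fix r :: real
      have 1: "{x \<in> space M. G k x \<inter> cball (d k) r \<noteq> {}} \<in> sets M"
        and 2: "{x \<in> space M. G k x \<inter> (C \<inter> cball (d k) r) \<noteq> {}} \<in> sets M"
        using Suc.prems by (auto intro!: Suc.IH)
      show "{x \<in> space M. \<not> (G k x \<inter> cball (d k) r \<noteq> {}) \<or> G k x \<inter> (C \<inter> cball (d k) r) \<noteq> {}} \<in> sets M"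
        by (rule sets.sets_Collect_disj[OF 2 sets.sets_Collect_neg[OF 1]])
    qed
    finally show ?case .
  qed
  define \<phi> where "\<phi> x = (SOME a. \<forall>k. a \<in> G k x)" for x
  \<comment> \<open>Two points surviving every stage are equidistant from each \<open>d k\<close>; a
    \<open>d k\<close> closer to \<open>a\<close> than half of \<open>dist a b\<close> then
    contradicts the triangle inequality.\<close>
  have uniq: "a = b" if "\<forall>k. a \<in> G k x" "\<forall>k. b \<in> G k x" for a b x
  proof (rule ccontr)
    assume "a \<noteq> b"
    then obtain k where k: "d k \<in> ball a (dist a b / 2)"
      using D(2)[of "ball a (dist a b / 2)"] dD by auto
    have "a \<in> G (Suc k) x" "b \<in> G (Suc k) x" using that by blast+
    then have "dist b (d k) \<le> dist a (d k)" by (auto simp: GS)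
    with k show False using dist_triangle[of a b "d k"] by (simp add: dist_commute)
  qed
  have ex: "\<exists>a. \<forall>k. a \<in> G k x \<inter> C" if "x \<in> space M" "closed C" "\<And>k. G k x \<inter> C \<noteq> {}" for x C
  proof -
    have "compact (G k x \<inter> C)" for k using that G by (blast intro: compact_Int_closed)
    moreover have "decseq (\<lambda>k. G k x \<inter> C)" using Gdec by (auto simp: decseq_def)
    ultimately have "(\<Inter>k. G k x \<inter> C) \<noteq> {}" using that(3) by (intro compact_decseq_nonempty)
    then show ?thesis by blast
  qed
  have \<phi>: "\<phi> x \<in> G k x" if "x \<in> space M" for x k
    using someI_ex[OF ex[of x UNIV, simplified]] that G unfolding \<phi>_def by auto
  have "\<phi> -` C \<inter> space M \<in> sets M" if C: "closed C" for C
  proof -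
    \<comment> \<open>By compactness, meeting \<open>C\<close> at every stage yields a survivor of
      all stages inside \<open>C\<close>; survivors are unique, so it is \<open>\<phi> x\<close>.
      The preimage is thus a countable intersection of measurable hitting sets.\<close>
    have "\<phi> -` C \<inter> space M = {x \<in> space M. \<forall>k. G k x \<inter> C \<noteq> {}}"
    proof safe
      fix x assume x: "x \<in> space M" "\<forall>k. G k x \<inter> C \<noteq> {}"
      from ex[OF x(1) C] x(2) obtain a where a: "\<forall>k. a \<in> G k x \<inter> C" by auto
      then have "a = \<phi> x" using \<phi> x(1) by (intro uniq[of _ x]) auto
      then show "x \<in> \<phi> -` C" using a by auto
    qed (use \<phi> in blast)
    also have "\<dots> \<in> sets M"
      using Gmeas[OF C] by (intro sets.sets_Collect_countable_All) auto
    finally show ?thesis .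
  qed
  note cl = this
  have "\<phi> \<in> borel_measurable M"
  proof (rule borel_measurableI)
    fix S :: "'a set" assume "open S"
    then have "\<phi> -` (- S) \<inter> space M \<in> sets M" by (intro cl) auto
    then have "space M - (\<phi> -` (- S) \<inter> space M) \<in> sets M" by auto
    moreover have "space M - (\<phi> -` (- S) \<inter> space M) = \<phi> -` S \<inter> space M" by auto
    ultimately show "\<phi> -` S \<inter> space M \<in> sets M" by simp
  qed
  then show ?thesis using \<phi>[of _ 0] by (intro that) (auto simp: G0)
qed

text \<open>The hitting sets of the argmin map \<open>F\<close> are measurable because
  \<open>F x\<close> meets \<open>C\<close> iff the minimum over \<open>A x \<inter> C\<close> does
  not exceed the minimum over \<open>A x\<close>, a comparison tested on a countable dense set of
  levels. Each single-level set is the projection of a closed part of the graph.\<close>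

lemma argmin_selector:
  fixes X :: "'x::t2_space set" and A :: "'x \<Rightarrow> 'a::{metric_space, second_countable_topology} set"
  assumes A: "compact_valued X A" "continuous_set_map X Act A" "\<And>x. x \<in> X \<Longrightarrow> A x \<subseteq> Act"
     "\<And>x. x \<in> X \<Longrightarrow> A x \<noteq> {}"
    and w: "lsc_on (Sigma X A) w"
  shows "\<exists>\<phi>\<in>stationary_policies X Act A.
    (\<forall>x\<in>X. \<forall>a\<in>A x. w (x, \<phi> x) \<le> w (x, a)) \<and> lsc_on X (\<lambda>x. w (x, \<phi> x))"
proof -
  have slice: "lsc_on (A x) (\<lambda>a. w (x, a))" if "x \<in> X" for x
    using that by (intro lsc_on_compose[OF w, of _ "\<lambda>a. (x, a)"]) (auto intro!: continuous_intros)
  have cl: "{x\<in>X. \<exists>a\<in>A x \<inter> C. w (x, a) \<le> r} \<in> sets (borel_on X)" if "closed C" for C r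
  proof -
    have "closedin (top_of_set (Sigma X A)) ({z\<in>Sigma X A. w z \<le> r} \<inter> (Sigma X A \<inter> UNIV \<times> C))"
      using w that unfolding lsc_on_def
      by (intro closedin_Int closedin_closed_Int closed_Times) auto
    from closedin_fst_image[OF A(1-3) this]
    also have "fst ` ({z\<in>Sigma X A. w z \<le> r} \<inter> (Sigma X A \<inter> UNIV \<times> C)) =
        {x\<in>X. \<exists>a\<in>A x \<inter> C. w (x, a) \<le> r}"
      by (auto simp: image_iff intro!: bexI[rotated])
    finally show ?thesis by (auto simp: sets_restrict_space closedin_closed)
  qed
  then have cl': "{x\<in>space (borel_on X). \<exists>a\<in>A x \<inter> C. w (x, a) \<le> r} \<in> sets (borel_on X)" if "closed C" for C r
    using that by (simp add: space_restrict_space)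
  define F where "F x = {a\<in>A x. \<forall>b\<in>A x. w (x, a) \<le> w (x, b)}" for x
  have cA: "compact (A x)" if "x \<in> X" for x using A that by (auto simp: compact_valued_def)
  have attain: "\<exists>a\<in>A x \<inter> C. \<forall>b\<in>A x \<inter> C. w (x, a) \<le> w (x, b)"
    if x: "x \<in> X" and C: "closed C" and ne: "A x \<inter> C \<noteq> {}" for x C
  proof -
    have "lsc_on (A x \<inter> C) (\<lambda>a. w (x, a))" using slice[OF x] by (rule lsc_on_subset) blast
    moreover have "compact (A x \<inter> C)" using cA[OF x] C by (rule compact_Int_closed)
    ultimately obtain a where "a \<in> A x \<inter> C" "\<And>b. b \<in> A x \<inter> C \<Longrightarrow> w (x, a) \<le> w (x, b)"
      using ne lsc_attains_inf by blast
    then show ?thesis by blast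
  qed
  obtain D :: "ennreal set" where D: "countable D" "\<And>U. open U \<Longrightarrow> U \<noteq> {} \<Longrightarrow> \<exists>d\<in>D. d \<in> U"
    using countable_dense_exists by blast
  obtain \<phi> where \<phi>: "\<phi> \<in> borel_measurable (borel_on X)" "\<And>x. x \<in> space (borel_on X) \<Longrightarrow> \<phi> x \<in> F x"
  proof (rule compact_measurable_selector[of "borel_on X" F])
    fix x assume "x \<in> space (borel_on X)"
    then have x: "x \<in> X" by (simp add: space_restrict_space)
    from attain[OF x closed_UNIV] A(4)[OF x] obtain a where a: "a \<in> A x" "\<forall>b\<in>A x. w (x, a) \<le> w (x, b)" by auto
    then show "F x \<noteq> {}" by (auto simp: F_def)
    have "F x = {b\<in>A x. w (x, b) \<le> w (x, a)}" using a by (auto simp: F_def intro: order_trans)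
    then have "closedin (top_of_set (A x)) (F x)" using slice[OF x] by (simp add: lsc_on_def)
    then show "compact (F x)" using cA[OF x] closedin_compact by blast
  next
    fix C :: "'a set" assume C: "closed C"
    \<comment> \<open>The conjunct with level \<open>top\<close> says only that \<open>A x\<close>
      meets \<open>C\<close>, so that the minimum over \<open>A x \<inter> C\<close> exists. A dense
      \<open>D\<close> suffices because a strict gap between the two minima would contain one of its
      points; \<open>UNIV\<close> brings the other condition into the form of
      \<open>cl'\<close>.\<close>
    have "F x \<inter> C \<noteq> {} \<longleftrightarrow> (\<exists>a\<in>A x \<inter> C. w (x, a) \<le> top) \<and> (\<forall>r\<in>D. \<not> (\<exists>a\<in>A x \<inter> UNIV. w (x, a) \<le> r) \<or> (\<exists>a\<in>A x \<inter> C. w (x, a) \<le> r))"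
      (is "?L \<longleftrightarrow> ?R") if x: "x \<in> X" for x
    proof
      assume ?L
      then obtain a where a: "a \<in> A x" "a \<in> C" "\<And>b. b \<in> A x \<Longrightarrow> w (x, a) \<le> w (x, b)"
        by (auto simp: F_def)
      then show ?R by (metis IntI Int_UNIV_right order_trans top_greatest)
    next
      assume R: ?R
      from attain[OF x C] R obtain a where a: "a\<in>A x \<inter> C" "\<forall>b\<in>A x \<inter> C. w (x, a) \<le> w (x, b)" by auto
      from attain[OF x closed_UNIV] A(4)[OF x] obtain b where b: "b \<in> A x" "\<forall>y\<in>A x. w (x, b) \<le> w (x, y)" by auto
      have "w (x, a) \<le> w (x, b)"
      proof (rule ccontr)
        assume "\<not> ?thesis"
        then have "w (x, b) < w (x, a)" by simp
        then have "{w (x, b)<..<w (x, a)} \<noteq> {}" using dense by auto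
        then obtain r where "r \<in> D" "w (x, b) < r" "r < w (x, a)"
          using D(2)[of "{w (x, b)<..<w (x, a)}"] by auto
        then have "\<exists>y\<in>A x \<inter> C. w (x, y) \<le> r" using R b(1) by fastforce
        then show False using a(2) \<open>r < w (x, a)\<close> by (meson leD le_less_trans order_trans)
      qed
      then have "a \<in> F x" using a b by (auto simp: F_def intro: order_trans)
      then show ?L using a by auto
    qed
    then have "{x \<in> space (borel_on X). F x \<inter> C \<noteq> {}} = {x \<in> space (borel_on X).
       (\<exists>a\<in>A x \<inter> C. w (x, a) \<le> top) \<and> (\<forall>r\<in>D. \<not> (\<exists>a\<in>A x \<inter> UNIV. w (x, a) \<le> r) \<or> (\<exists>a\<in>A x \<inter> C. w (x, a) \<le> r))}"
      by (auto simp only: space_restrict_space space_borel Int_UNIV_right)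
    also have "\<dots> \<in> sets (borel_on X)"
      by (intro sets.sets_Collect_conj sets.sets_Collect_countable_All' sets.sets_Collect_disj
          sets.sets_Collect_neg cl' C closed_UNIV D(1))
    finally show "{x \<in> space (borel_on X). F x \<inter> C \<noteq> {}} \<in> sets (borel_on X)" .
  qed blast
  have \<phi>F: "\<phi> x \<in> F x" if "x \<in> X" for x using \<phi>(2) that by (simp add: space_restrict_space)
  show ?thesis
  proof (intro bexI[of _ \<phi>] conjI ballI)
    show "\<phi> \<in> stationary_policies X Act A"
    proof -
      have "\<phi> x \<in> A x" if "x \<in> X" for x using \<phi>F[OF that] by (simp add: F_def)
      moreover from this A(3) have "\<phi> x \<in> Act" if "x \<in> X" for x using that by blast
      ultimately show ?thesis
        using \<phi>(1) unfolding stationary_policies_def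
        by (auto simp: space_restrict_space intro!: measurable_restrict_space2)
    qed
    show "w (x, \<phi> x) \<le> w (x, a)" if "x \<in> X" "a \<in> A x" for x a
      using \<phi>F that by (auto simp: F_def)
    show "lsc_on X (\<lambda>x. w (x, \<phi> x))"
      unfolding lsc_on_def
    proof
      fix r
      \<comment> \<open>A sublevel set of the minimum is the projection of the same sublevel set of
        \<open>w\<close>, since the minimum is attained at \<open>\<phi> x\<close>.\<close>
      have "closedin (top_of_set (Sigma X A)) {z\<in>Sigma X A. w z \<le> r}" using w by (simp add: lsc_on_def)
      from closedin_fst_image[OF A(1-3) this]
      have "closedin (top_of_set X) (fst ` {z\<in>Sigma X A. w z \<le> r})" .
      also have "fst ` {z\<in>Sigma X A. w z \<le> r} = {x\<in>X. w (x, \<phi> x) \<le> r}"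
      proof safe
        show "w (fst (x, a), \<phi> (fst (x, a))) \<le> r" if "x \<in> X" "a \<in> A x" "w (x, a) \<le> r" for x a
          using \<phi>F[OF that(1)] that by (auto simp: F_def intro: order_trans)
        show "x \<in> fst ` {z\<in>Sigma X A. w z \<le> r}" if "x \<in> X" "w (x, \<phi> x) \<le> r" for x
          using \<phi>F[OF that(1)] that by (intro image_eqI[of _ _ "(x, \<phi> x)"]) (auto simp: F_def)
      qed simp
      finally show "closedin (top_of_set X) {x\<in>X. w (x, \<phi> x) \<le> r}" .
    qed
  qed
qed

section \<open>Baire approximation and weakly continuous kernels\<close>

lemma lsc_on_continuous:
  fixes f :: "'s::topological_space \<Rightarrow> real"
  assumes "continuous_on S f"
  shows "lsc_on S (\<lambda>s. ennreal (f s))"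
proof -
  have "continuous_on S (\<lambda>s. ennreal (f s))" using assms by (rule continuous_on_ennreal)
  then have "closedin (top_of_set S) (S \<inter> (\<lambda>s. ennreal (f s)) -` {..r})" for r
    by (intro continuous_closedin_preimage) auto
  moreover have "S \<inter> (\<lambda>s. ennreal (f s)) -` {..r} = {s\<in>S. ennreal (f s) \<le> r}" for r by auto
  ultimately show ?thesis by (simp add: lsc_on_def)
qed

lemma lsc_on_ennreal:
  assumes "lower_semicontinuous_on S f"
  shows "lsc_on S (\<lambda>s. ennreal (f s))"
  unfolding lsc_on_def
proof
  fix r
  have "openin (top_of_set S) {s\<in>S. r < ennreal (f s)}"
  proof (cases r)
    case (real r')
    have "\<exists>W. openin (top_of_set S) W \<and> s \<in> W \<and> W \<subseteq> {t\<in>S. r' < f t}" if "s \<in> {s\<in>S. r' < f s}" for s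
    proof -
      have "eventually (\<lambda>t. r' < f t) (at s within S)"
        using assms that by (auto simp: lower_semicontinuous_on_def)
      then obtain T where "open T" "s \<in> T" "\<And>t. t \<in> T \<Longrightarrow> t \<noteq> s \<Longrightarrow> t \<in> S \<Longrightarrow> r' < f t"
        unfolding eventually_at_topological by auto
      then show ?thesis using that by (intro exI[of _ "S \<inter> T"]) (auto intro: openin_open_Int)
    qed
    then have "openin (top_of_set S) {s\<in>S. r' < f s}" by (subst openin_subopen) blast
    \<comment> \<open>As \<open>r'\<close> is nonnegative, the truncation of negative values by
      \<open>ennreal\<close> does not affect this strict comparison.\<close>
    moreover have "r < ennreal (f s) \<longleftrightarrow> r' < f s" for s using real by (simp add: ennreal_less_iff)
    ultimately show ?thesis by simp
  qed simp
  moreover have "S - {s\<in>S. ennreal (f s) \<le> r} = {s\<in>S. r < ennreal (f s)}" by auto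
  ultimately show "closedin (top_of_set S) {s\<in>S. ennreal (f s) \<le> r}" by (auto simp: closedin_def)
qed

text \<open>Baire's theorem, with the Pasch-Hausdorff regularisations as approximants.\<close>

lemma lsc_on_SUP_continuous:
  fixes S :: "'s::metric_space set"
  assumes u: "lsc_on S u"
  obtains f :: "nat \<Rightarrow> 's \<Rightarrow> real" where "\<And>n. continuous_on S (f n)"
    "\<And>n s. s \<in> S \<Longrightarrow> 0 \<le> f n s \<and> f n s \<le> real n" "\<And>s. s \<in> S \<Longrightarrow> incseq (\<lambda>n. f n s)"
    "\<And>s. s \<in> S \<Longrightarrow> (SUP n. ennreal (f n s)) = u s"
proof -
  \<comment> \<open>Truncation at \<open>n\<close> keeps the infimum below finite even where
    \<open>u\<close> is infinite, and supplies the uniform bound \<open>n\<close>.\<close>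
  define g where "g n y = enn2real (min (u y) (of_nat n))" for n :: nat and y
  have g0: "0 \<le> g n y" and gn: "g n y \<le> real n" and gg: "ennreal (g n y) = min (u y) (of_nat n)" for n y
  proof -
    have lt: "min (u y) (of_nat n) < top" by (simp add: min_less_iff_disj of_nat_less_top)
    then show *: "ennreal (g n y) = min (u y) (of_nat n)" by (simp add: g_def ennreal_enn2real)
    show "0 \<le> g n y" by (simp add: g_def)
    have "ennreal (g n y) \<le> ennreal (real n)" unfolding * by (simp add: ennreal_of_nat_eq_real_of_nat)
    then show "g n y \<le> real n" by simp
  qed
  \<comment> \<open>On a nonempty \<open>S\<close> this is the largest minorant of
    \<open>g n\<close> with Lipschitz constant \<open>n\<close>.\<close>
  define f where "f n s = (INF y\<in>S. g n y + real n * dist s y)" for n s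
  have bdd: "bdd_below ((\<lambda>y. g n y + real n * dist s y) ` S)" for n s
    by (rule bdd_belowI[of _ 0]) (auto simp: g0)
  have fle: "f n s \<le> g n y + real n * dist s y" if "y \<in> S" for n s y
    unfolding f_def using bdd that by (rule cINF_lower)
  have fge: "r \<le> f n s" if "s \<in> S" "\<And>y. y \<in> S \<Longrightarrow> r \<le> g n y + real n * dist s y" for n s r
    unfolding f_def using that by (intro cINF_greatest) auto
  have lip: "f n s \<le> f n t + real n * dist s t" if "s \<in> S" "t \<in> S" for n s t
  proof -
    have "f n s - real n * dist s t \<le> f n t"
    proof (rule fge[OF that(2)])
      fix y assume "y \<in> S"
      from fle[OF this, of n s] have "f n s \<le> g n y + real n * dist s y" .
      also have "real n * dist s y \<le> real n * (dist s t + dist t y)"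
        by (intro mult_left_mono dist_triangle) auto
      finally show "f n s - real n * dist s t \<le> g n y + real n * dist t y" by (simp add: algebra_simps)
    qed
    then show ?thesis by simp
  qed
  show ?thesis
  proof (rule that)
    show "continuous_on S (f n)" for n
      unfolding continuous_on_iff
    proof (intro ballI allI impI)
      fix x e assume x: "x \<in> S" and e: "(0::real) < e"
      have "dist (f n y) (f n x) < e" if "y \<in> S" "dist y x < e / (real n + 1)" for y
      proof -
        have "dist (f n y) (f n x) \<le> real n * dist y x"
          using lip[OF x that(1), of n] lip[OF that(1) x, of n] by (simp add: dist_real_def dist_commute)
        also have "\<dots> \<le> (real n + 1) * dist y x" by (intro mult_right_mono) auto
        also have "\<dots> < e" using that(2) by (simp add: field_simps)
        finally show ?thesis .
      qed
      then show "\<exists>d>0. \<forall>x'\<in>S. dist x' x < d \<longrightarrow> dist (f n x') (f n x) < e"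
        using e by (intro exI[of _ "e / (real n + 1)"]) auto
    qed
    show "0 \<le> f n s \<and> f n s \<le> real n" if "s \<in> S" for n s
      using fge[OF that, of 0 n] fle[OF that, of n s] gn[of n s] g0[of n] by auto
    show "incseq (\<lambda>n. f n s)" if s: "s \<in> S" for s
    proof (rule incseq_SucI, rule fge[OF s])
      fix n y assume y: "y \<in> S"
      have "f n s \<le> g n y + real n * dist s y" by (rule fle[OF y])
      also have "g n y \<le> g (Suc n) y"
      proof -
        have "ennreal (g n y) \<le> ennreal (g (Suc n) y)" unfolding gg
          by (intro min.mono order_refl) simp
        then show ?thesis using g0 by (simp add: ennreal_le_iff)
      qed
      also have "real n * dist s y \<le> real (Suc n) * dist s y" by (intro mult_right_mono) auto
      finally show "f n s \<le> g (Suc n) y + real (Suc n) * dist s y" by simp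
    qed
    show "(SUP n. ennreal (f n s)) = u s" if s: "s \<in> S" for s
    proof (rule antisym)
      have "ennreal (f n s) \<le> u s" for n
      proof -
        have "ennreal (f n s) \<le> ennreal (g n s)" using fle[OF s, of n s] by (simp add: ennreal_leI)
        then show ?thesis by (simp add: gg)
      qed
      then show "(SUP n. ennreal (f n s)) \<le> u s" by (intro SUP_least)
      show "u s \<le> (SUP n. ennreal (f n s))"
      proof (rule dense_le)
        fix r assume r: "r < u s"
        then obtain \<rho> where \<rho>: "r = ennreal \<rho>" "0 \<le> \<rho>" by (cases r) auto
        have "openin (top_of_set S) (S - {t\<in>S. u t \<le> r})"
          using u unfolding lsc_on_def by (auto simp: closedin_def)
        moreover have "s \<in> S - {t\<in>S. u t \<le> r}" using r s by auto
        ultimately have "\<exists>e>0. ball s e \<inter> S \<subseteq> S - {t\<in>S. u t \<le> r}"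
          unfolding openin_contains_ball by (elim conjE bspec)
        then obtain e where e: "e > 0" "ball s e \<inter> S \<subseteq> S - {t\<in>S. u t \<le> r}" by auto
        \<comment> \<open>The index has two tasks: with \<open>n\<close> at least
          \<open>\<rho>\<close>, truncation does not push points near \<open>s\<close> below the
          level; with \<open>n * e\<close> at least \<open>\<rho>\<close>, the distance penalty
          alone reaches the level for points at distance \<open>e\<close> or more.\<close>
        obtain n :: nat where n: "\<rho> \<le> real n" "\<rho> \<le> real n * e"
        proof -
          obtain n :: nat where "max \<rho> (\<rho> / e) \<le> real n" using real_arch_simple by blast
          then show ?thesis using e(1) by (intro that[of n]) (auto simp: field_simps)
        qed
        have "\<rho> \<le> f n s"
        proof (rule fge[OF s])
          fix y assume y: "y \<in> S"
          show "\<rho> \<le> g n y + real n * dist s y"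
          proof (cases "dist s y < e")
            case True
            then have "r < u y" using e(2) y by (auto simp: not_le)
            then have "ennreal \<rho> \<le> ennreal (g n y)"
              unfolding gg using n(1) \<rho> by (auto simp: ennreal_of_nat_eq_real_of_nat intro: ennreal_leI)
            then have "\<rho> \<le> g n y" using g0 by (simp add: ennreal_le_iff)
            then show ?thesis by (simp add: add_increasing2)
          next
            case False
            then have "real n * e \<le> real n * dist s y" by (intro mult_left_mono) auto
            with n(2) g0[of n y] show ?thesis by linarith
          qed
        qed
        then show "r \<le> (SUP n. ennreal (f n s))"
          unfolding \<rho> by (intro SUP_upper2[of n]) (auto intro: ennreal_leI)
      qed
    qed
  qed
qed

lemma lsc_on_cong: "(\<And>s. s \<in> S \<Longrightarrow> f s = g s) \<Longrightarrow> lsc_on S f = lsc_on S g"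
  unfolding lsc_on_def by (simp cong: conj_cong)

text \<open>Sums behave well on the continuous approximants: both suprema run over increasing
  sequences, so they merge into one supremum of continuous functions. Infinite values need no
  separate case.\<close>

lemma lsc_on_add_mult:
  fixes S :: "'s::metric_space set"
  assumes u: "lsc_on S u" and v: "lsc_on S v" and b: "0 \<le> (b::real)"
  shows "lsc_on S (\<lambda>s. u s + ennreal b * v s)"
proof -
  obtain f where f: "\<And>n. continuous_on S (f n)"
    "\<And>n s. s \<in> S \<Longrightarrow> 0 \<le> f n s \<and> f n s \<le> real n" "\<And>s. s \<in> S \<Longrightarrow> incseq (\<lambda>n. f n s)"
    "\<And>s. s \<in> S \<Longrightarrow> (SUP n. ennreal (f n s)) = u s"
    using lsc_on_SUP_continuous[OF u] by blast
  obtain g where g: "\<And>n. continuous_on S (g n)"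
    "\<And>n s. s \<in> S \<Longrightarrow> 0 \<le> g n s \<and> g n s \<le> real n" "\<And>s. s \<in> S \<Longrightarrow> incseq (\<lambda>n. g n s)"
    "\<And>s. s \<in> S \<Longrightarrow> (SUP n. ennreal (g n s)) = v s"
    using lsc_on_SUP_continuous[OF v] by blast
  have "u s + ennreal b * v s = (SUP n. ennreal (f n s + b * g n s))" if s: "s \<in> S" for s
  proof -
    have "u s + ennreal b * v s = (SUP n. ennreal (f n s)) + (SUP n. ennreal b * ennreal (g n s))"
      by (simp add: f(4)[OF s] g(4)[OF s] SUP_mult_left_ennreal[symmetric])
    also have "\<dots> = (SUP n. ennreal (f n s) + ennreal b * ennreal (g n s))"
      using f(3)[OF s] g(3)[OF s]
      by (intro ennreal_SUP_add[symmetric])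
        (auto simp: incseq_def intro!: ennreal_leI mult_left_mono)
    also have "\<dots> = (SUP n. ennreal (f n s + b * g n s))"
      using f(2)[OF s] g(2)[OF s] b by (simp add: ennreal_plus ennreal_mult)
    finally show ?thesis .
  qed
  moreover have "lsc_on S (\<lambda>s. SUP n. ennreal (f n s + b * g n s))"
    using f(1) g(1) by (intro lsc_on_SUP lsc_on_continuous continuous_intros)
  ultimately show ?thesis by (simp cong: lsc_on_cong)
qed

lemma continuous_on_borel_measurable_kernel:
  assumes "sets M = sets (borel_on T)" "continuous_on T (f :: _ \<Rightarrow> real)"
  shows "f \<in> borel_measurable M"
  using borel_measurable_continuous_on_restrict[OF assms(2)] measurable_cong_sets[OF assms(1) refl] by blast

lemma space_borel_on: "sets M = sets (borel_on T) \<Longrightarrow> space M = T"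
  using sets_eq_imp_space_eq[of M "borel_on T"] by (simp add: space_restrict_space)

text \<open>The lower half of the portmanteau theorem, for kernels of finite measures: the
  approximants of \<open>u\<close> are bounded and continuous, so their means vary continuously, and
  monotone convergence exhibits the integral as the supremum of these means.\<close>

lemma weakly_continuous_lsc_integral:
  fixes S :: "'s::metric_space set" and T :: "'t::metric_space set"
  assumes k: "transition_kernel S T \<kappa>" and wc: "weakly_continuous S T \<kappa>" and u: "lsc_on T u"
  shows "lsc_on S (\<lambda>s. \<integral>\<^sup>+y. u y \<partial>\<kappa> s)"
proof -
  obtain f where f: "\<And>n. continuous_on T (f n)"
    "\<And>n s. s \<in> T \<Longrightarrow> 0 \<le> f n s \<and> f n s \<le> real n" "\<And>s. s \<in> T \<Longrightarrow> incseq (\<lambda>n. f n s)"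
    "\<And>s. s \<in> T \<Longrightarrow> (SUP n. ennreal (f n s)) = u s"
    using lsc_on_SUP_continuous[OF u] by blast
  have "(\<integral>\<^sup>+y. u y \<partial>\<kappa> s) = (SUP n. ennreal (\<integral>y. f n y \<partial>\<kappa> s))" if s: "s \<in> S" for s
  proof -
    from k s have fin: "finite_measure (\<kappa> s)" and sets: "sets (\<kappa> s) = sets (borel_on T)"
      by (auto simp: transition_kernel_def)
    interpret finite_measure "\<kappa> s" by fact
    note sp = space_borel_on[OF sets]
    have [measurable]: "f n \<in> borel_measurable (\<kappa> s)" for n
      using sets f(1) by (rule continuous_on_borel_measurable_kernel)
    have "(\<integral>\<^sup>+y. u y \<partial>\<kappa> s) = (\<integral>\<^sup>+y. (SUP n. ennreal (f n y)) \<partial>\<kappa> s)"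
      using f(4) by (intro nn_integral_cong) (simp add: sp)
    also have "\<dots> = (SUP n. \<integral>\<^sup>+y. ennreal (f n y) \<partial>\<kappa> s)"
      using f(3) by (intro nn_integral_monotone_convergence_SUP_AE)
        (auto simp: sp incseq_def intro!: AE_I2 ennreal_leI)
    also have "\<dots> = (SUP n. ennreal (\<integral>y. f n y \<partial>\<kappa> s))"
    proof (intro SUP_cong refl nn_integral_eq_integral)
      show "integrable (\<kappa> s) (f n)" for n
        using f(2) by (intro integrable_const_bound[of _ "real n"] AE_I2) (auto simp: sp)
      show "AE y in \<kappa> s. 0 \<le> f n y" for n using f(2) by (intro AE_I2) (auto simp: sp)
    qed
    finally show ?thesis .
  qed
  moreover have "lsc_on S (\<lambda>s. SUP n. ennreal (\<integral>y. f n y \<partial>\<kappa> s))"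
  proof (intro lsc_on_SUP lsc_on_continuous)
    fix n
    have "bounded (f n ` T)" using f(2) by (intro boundedI[of _ "real n"]) auto
    then show "continuous_on S (\<lambda>s. \<integral>y. f n y \<partial>\<kappa> s)"
      using wc f(1) by (auto simp: weakly_continuous_def)
  qed
  ultimately show ?thesis by (simp cong: lsc_on_cong)
qed

section \<open>Finite-horizon costs of a controlled process\<close>

lemma id_measurable_pair_space: "(\<lambda>z. z) \<in> pair_space X Act \<rightarrow>\<^sub>M borel"
  for X :: "'s::second_countable_topology set" and Act :: "'b::second_countable_topology set"
proof -
  have "(\<lambda>z. (fst z, snd z)) \<in> pair_space X Act \<rightarrow>\<^sub>M borel \<Otimes>\<^sub>M borel"
    by (intro measurable_Pair measurable_compose[OF measurable_fst] measurable_compose[OF measurable_snd]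
      measurable_restrict_space1) simp_all
  then show ?thesis by (simp add: borel_prod)
qed

text \<open>The graph is Borel for the product topology, while policies and histories live on the
  product of two trace sigma-algebras. Second countability identifies the two; each inclusion is
  measurability of the identity.\<close>

lemma sets_pair_space: "sets (pair_space X Act) = sets (borel_on (X \<times> Act))"
  for X :: "'s::second_countable_topology set" and Act :: "'b::second_countable_topology set"
proof (rule antisym)
  have sp: "space (pair_space X Act) = X \<times> Act" by (simp add: space_pair_measure space_restrict_space)
  have "(\<lambda>z. z) \<in> pair_space X Act \<rightarrow>\<^sub>M borel_on (X \<times> Act)"
    using id_measurable_pair_space by (rule measurable_restrict_space2[rotated]) (simp add: sp)
  note id' = this
  show "sets (borel_on (X \<times> Act)) \<subseteq> sets (pair_space X Act)"
  proof
    fix B assume B: "B \<in> sets (borel_on (X \<times> Act))"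
    then have "B \<subseteq> X \<times> Act" using sets.sets_into_space[OF B] by (simp add: space_restrict_space)
    then show "B \<in> sets (pair_space X Act)"
      using measurable_sets[OF id' B] by (simp add: sp Int_absorb2)
  qed
  have "fst \<in> borel_on (X \<times> Act) \<rightarrow>\<^sub>M borel_on X"
    by (intro measurable_restrict_space2 measurable_restrict_space1)
      (auto simp: space_restrict_space intro!: borel_measurable_continuous_onI continuous_intros)
  moreover have "snd \<in> borel_on (X \<times> Act) \<rightarrow>\<^sub>M borel_on Act"
    by (intro measurable_restrict_space2 measurable_restrict_space1)
      (auto simp: space_restrict_space intro!: borel_measurable_continuous_onI continuous_intros)
  ultimately have "(\<lambda>z. (fst z, snd z)) \<in> borel_on (X \<times> Act) \<rightarrow>\<^sub>M pair_space X Act"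
    by (rule measurable_Pair)
  then have id: "(\<lambda>z. z) \<in> borel_on (X \<times> Act) \<rightarrow>\<^sub>M pair_space X Act" by simp
  show "sets (pair_space X Act) \<subseteq> sets (borel_on (X \<times> Act))"
  proof
    fix B assume B: "B \<in> sets (pair_space X Act)"
    then have "B \<subseteq> X \<times> Act" using sets.sets_into_space[OF B] by (simp add: sp)
    then show "B \<in> sets (borel_on (X \<times> Act))"
      using measurable_sets[OF id B] by (simp add: space_restrict_space Int_absorb2)
  qed
qed

text \<open>The data under which single policies are evaluated; compactness and continuity enter
  with \<open>semicontinuous_mdp\<close>.\<close>

locale markov_decision =
  fixes X :: "'s::polish_space set" and Act :: "'b::polish_space set" and A :: "'s \<Rightarrow> 'b set"
    and c :: "'s \<times> 'b \<Rightarrow> real" and p :: "'s \<times> 'b \<Rightarrow> 's measure" and \<beta> :: real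
  assumes A_subset: "x \<in> X \<Longrightarrow> A x \<subseteq> Act"
    and graph_borel: "Sigma X A \<in> sets borel"
    and cost_measurable: "c \<in> borel_measurable (borel_on (Sigma X A))"
    and prob_kernel: "transition_prob_kernel (Sigma X A) X p"
    and discount_nonneg: "0 \<le> \<beta>"
begin

abbreviation "XA \<equiv> pair_space X Act"

text \<open>Off the graph, \<open>kern\<close> follows the convention of \<open>step_kernel\<close>.\<close>

definition cost :: "'s \<times> 'b \<Rightarrow> ennreal" where
  "cost z = (if z \<in> Sigma X A then ennreal (c z) else 0)"

definition kern :: "'s \<times> 'b \<Rightarrow> 's measure" where
  "kern z = (if z \<in> Sigma X A then p z else return (borel_on X) (fst z))"

definition stage :: "('s \<Rightarrow> ennreal) \<Rightarrow> 's \<times> 'b \<Rightarrow> ennreal" where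
  "stage w z = cost z + ennreal \<beta> * (\<integral>\<^sup>+y. w y \<partial>kern z)"

lemma space_X [simp]: "space (borel_on X) = X" by (simp add: space_restrict_space)
lemma space_Act [simp]: "space (borel_on Act) = Act" by (simp add: space_restrict_space)
lemma space_XA: "space XA = X \<times> Act" by (simp add: space_pair_measure)

lemma graph_subset: "Sigma X A \<subseteq> X \<times> Act" using A_subset by auto

lemma graph_sets [measurable]: "Sigma X A \<in> sets XA"
  using graph_borel graph_subset unfolding sets_pair_space sets_restrict_space by blast

lemma sets_graph: "sets (restrict_space XA (Sigma X A)) = sets (borel_on (Sigma X A))"
proof -
  have "sets (restrict_space XA (Sigma X A)) = sets (restrict_space (borel_on (X \<times> Act)) (Sigma X A))"
    by (rule sets_restrict_space_cong[OF sets_pair_space])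
  also have "\<dots> = sets (borel_on (Sigma X A))"
    using graph_subset by (simp add: sets_restrict_space image_image Int_assoc[symmetric] Int_absorb2)
  finally show ?thesis .
qed

lemma cost_borel [measurable]: "cost \<in> borel_measurable XA"
proof -
  have "(\<lambda>z. ennreal (c z)) \<in> borel_measurable (restrict_space XA (Sigma X A))"
    using cost_measurable measurable_cong_sets[OF sets_graph refl] by (intro measurable_compose[OF _ measurable_ennreal]) blast
  then have "(\<lambda>z. if z \<in> Sigma X A then ennreal (c z) else 0) \<in> borel_measurable XA"
    by (subst measurable_If_restrict_space_iff) simp_all
  then show ?thesis by (simp add: cost_def[abs_def])
qed

lemma p_prob: "z \<in> Sigma X A \<Longrightarrow> prob_space (p z)"
  and p_sets: "z \<in> Sigma X A \<Longrightarrow> sets (p z) = sets (borel_on X)"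
  using prob_kernel by (auto simp: transition_prob_kernel_def transition_kernel_def)

text \<open>Passes from measurability at each Borel set to measurability as a map into the space of
  probability measures, the form in which kernels are composed.\<close>

lemma p_measurable: "p \<in> borel_on (Sigma X A) \<rightarrow>\<^sub>M prob_algebra (borel_on X)"
proof (intro measurable_prob_algebraI measurable_subprob_algebra)
  fix z assume "z \<in> space (borel_on (Sigma X A))"
  then have z: "z \<in> Sigma X A" by (simp add: space_restrict_space)
  show "prob_space (p z)" "subprob_space (p z)" "sets (p z) = sets (borel_on X)"
    using p_prob[OF z] p_sets[OF z] prob_space_imp_subprob_space by auto
next
  fix B assume "B \<in> sets (borel_on X)"
  then have "(\<lambda>z. ennreal (measure (p z) B)) \<in> borel_measurable (borel_on (Sigma X A))"
    using prob_kernel by (auto simp: transition_prob_kernel_def transition_kernel_def)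
  moreover have "emeasure (p z) B = ennreal (measure (p z) B)" if "z \<in> space (borel_on (Sigma X A))" for z
  proof -
    interpret prob_space "p z" using that by (intro p_prob) (simp add: space_restrict_space)
    show ?thesis by (rule emeasure_eq_measure)
  qed
  ultimately show "(\<lambda>z. emeasure (p z) B) \<in> borel_measurable (borel_on (Sigma X A))"
    by (simp cong: measurable_cong)
qed

lemma kern_measurable [measurable]: "kern \<in> XA \<rightarrow>\<^sub>M prob_algebra (borel_on X)"
proof -
  have "p \<in> restrict_space XA (Sigma X A) \<rightarrow>\<^sub>M prob_algebra (borel_on X)"
    using p_measurable measurable_cong_sets[OF sets_graph refl] by blast
  moreover have "(\<lambda>z. return (borel_on X) (fst z)) \<in> restrict_space XA {z. z \<notin> Sigma X A} \<rightarrow>\<^sub>M prob_algebra (borel_on X)"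
    by (intro measurable_restrict_space1) measurable
  ultimately have "(\<lambda>z. if z \<in> Sigma X A then p z else return (borel_on X) (fst z)) \<in> XA \<rightarrow>\<^sub>M prob_algebra (borel_on X)"
    by (subst measurable_If_restrict_space_iff) simp_all
  then show ?thesis by (simp add: kern_def[abs_def])
qed

lemma integral_kern_measurable:
  assumes "w \<in> borel_measurable (borel_on X)"
  shows "(\<lambda>z. \<integral>\<^sup>+y. w y \<partial>kern z) \<in> borel_measurable XA"
  by (rule measurable_compose[OF measurable_prob_algebraD[OF kern_measurable] nn_integral_measurable_subprob_algebra[OF assms]])

lemma stage_measurable [measurable]:
  assumes "w \<in> borel_measurable (borel_on X)"
  shows "stage w \<in> borel_measurable XA"
  unfolding stage_def[abs_def] using integral_kern_measurable[OF assms] by measurable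

end

locale controlled_process = markov_decision X Act A c p \<beta>
  for X :: "'s::polish_space set" and Act :: "'b::polish_space set" and A c p \<beta> +
  fixes \<pi> :: "('s, 'b) policy" and x0 :: 's
  assumes policy: "\<pi> \<in> policies X Act A" and initial: "x0 \<in> X"
begin

abbreviation "hist (n::nat) \<equiv> (\<Pi>\<^sub>M i\<in>{0..<n}. XA)"

lemma policy_measurable: "(\<lambda>(h, x). \<pi> n h x) \<in> hist n \<Otimes>\<^sub>M borel_on X \<rightarrow>\<^sub>M prob_algebra (borel_on Act)"
  using policy by (auto simp: policies_def)

lemma policy_AE:
  assumes "h \<in> space (hist n)" "x \<in> X"
  shows "AE a in \<pi> n h x. a \<in> A x"
proof -
  have e: "emeasure (\<pi> n h x) (A x) = 1" using policy assms by (auto simp: policies_def)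
  have "\<pi> n h x \<in> space (prob_algebra (borel_on Act))"
    using measurable_space[OF policy_measurable, of "(h, x)"] assms by (simp add: space_pair_measure)
  then interpret prob_space "\<pi> n h x" by (simp add: space_prob_algebra)
  \<comment> \<open>Sets that are not measurable get measure zero, so measure one already forces
    measurability of \<open>A x\<close>.\<close>
  from e emeasure_notin_sets[of "A x" "\<pi> n h x"] have "A x \<in> sets (\<pi> n h x)" by fastforce
  then show ?thesis using AE_prob_1[of "A x"] e by (simp add: measure_def)
qed

lemma policy_measurable_fixed_history:
  assumes "h \<in> space (hist n)"
  shows "(\<lambda>x. \<pi> n h x) \<in> borel_on X \<rightarrow>\<^sub>M prob_algebra (borel_on Act)"
  using measurable_compose[OF measurable_Pair1'[OF assms] policy_measurable] by simp

text \<open>Law of the state at epoch \<open>n\<close> alone, before the action is drawn. Splitting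
  the step kernel here lets a terminal cost be charged at time \<open>n\<close> without choosing a
  further action.\<close>

definition next_state :: "nat \<Rightarrow> (nat \<Rightarrow> 's \<times> 'b) \<Rightarrow> 's measure" where
  "next_state n h = (if n = 0 then return (borel_on X) x0 else kern (h (n - 1)))"

lemma next_state_measurable: "next_state n \<in> hist n \<rightarrow>\<^sub>M prob_algebra (borel_on X)"
proof (cases n)
  case 0
  have "return (borel_on X) x0 \<in> space (prob_algebra (borel_on X))"
    using initial by (intro measurable_space[OF measurable_return_prob_space]) simp
  with 0 show ?thesis by (simp add: next_state_def[abs_def])
next
  case (Suc m)
  have "(\<lambda>h. h m) \<in> hist n \<rightarrow>\<^sub>M XA" using Suc by (intro measurable_component_singleton) auto
  from measurable_compose[OF this kern_measurable] Suc show ?thesis by (simp add: next_state_def[abs_def])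
qed

abbreviation "K \<equiv> step_kernel X Act A p \<pi> x0"

lemma step_kernel_eq: "K n h = next_state n h \<bind> (\<lambda>x. distr (\<pi> n h x) XA (Pair x))"
  by (simp add: step_kernel_def next_state_def kern_def)

lemma step_kernel_measurable: "K n \<in> hist n \<rightarrow>\<^sub>M prob_algebra XA"
  unfolding step_kernel_eq[abs_def]
proof (rule measurable_bind_prob_space2[OF next_state_measurable])
  have "(\<lambda>z. distr (case z of (h, x) \<Rightarrow> \<pi> n h x) XA (Pair (snd z))) \<in> hist n \<Otimes>\<^sub>M borel_on X \<rightarrow>\<^sub>M prob_algebra XA"
    by (rule measurable_distr_prob_space2[OF policy_measurable]) measurable
  then show "(\<lambda>(h, x). distr (\<pi> n h x) XA (Pair x)) \<in> hist n \<Otimes>\<^sub>M borel_on X \<rightarrow>\<^sub>M prob_algebra XA"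
    by (simp add: case_prod_beta')
qed

lemma nn_integral_step_kernel:
  assumes h: "h \<in> space (hist n)" and f[measurable]: "f \<in> borel_measurable XA"
  shows "(\<integral>\<^sup>+z. f z \<partial>K n h) = (\<integral>\<^sup>+x. \<integral>\<^sup>+a. f (x, a) \<partial>\<pi> n h x \<partial>next_state n h)"
proof -
  have sn: "sets (next_state n h) = sets (borel_on X)"
    using measurable_space[OF next_state_measurable h] by (simp add: space_prob_algebra)
  have "(\<lambda>x. distr (\<pi> n h x) XA (Pair x)) \<in> borel_on X \<rightarrow>\<^sub>M prob_algebra XA"
    by (rule measurable_distr_prob_space2[OF policy_measurable_fixed_history[OF h]]) measurable
  then have d: "(\<lambda>x. distr (\<pi> n h x) XA (Pair x)) \<in> next_state n h \<rightarrow>\<^sub>M subprob_algebra XA"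
    using measurable_cong_sets[OF sn refl] measurable_prob_algebraD by blast
  have "(\<integral>\<^sup>+z. f z \<partial>K n h) = (\<integral>\<^sup>+x. \<integral>\<^sup>+z. f z \<partial>distr (\<pi> n h x) XA (Pair x) \<partial>next_state n h)"
    unfolding step_kernel_eq by (rule nn_integral_bind[OF f d])
  also have "\<dots> = (\<integral>\<^sup>+x. \<integral>\<^sup>+a. f (x, a) \<partial>\<pi> n h x \<partial>next_state n h)"
  proof (intro nn_integral_cong nn_integral_distr)
    fix x assume "x \<in> space (next_state n h)"
    then have x: "x \<in> X" using space_borel_on[OF sn] by simp
    have "sets (\<pi> n h x) = sets (borel_on Act)"
      using measurable_space[OF policy_measurable_fixed_history[OF h], of x] x by (simp add: space_prob_algebra)
    then show "Pair x \<in> \<pi> n h x \<rightarrow>\<^sub>M XA"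
      using measurable_cong_sets x measurable_Pair1'[of x "borel_on X" "borel_on Act"] by (metis space_X)
    show "f \<in> borel_measurable (distr (\<pi> n h x) XA (Pair x))" by simp
  qed
  finally show ?thesis .
qed

section \<open>Laws of finite histories and of the infinite process\<close>

sublocale IT: Ionescu_Tulcea K "\<lambda>_. XA"
proof (rule Ionescu_Tulcea.intro)
  show "K i \<in> hist i \<rightarrow>\<^sub>M subprob_algebra XA" for i
    by (rule measurable_prob_algebraD[OF step_kernel_measurable])
  show "prob_space (K i h)" if "h \<in> space (hist i)" for i h
    using measurable_space[OF step_kernel_measurable that] by (simp add: space_prob_algebra)
qed

abbreviation "law \<equiv> process_law X Act A p \<pi> x0"
text \<open>Law of the first \<open>n\<close> state-action pairs. The seed is the empty history: the
  extensional product over the empty index set has \<open>\<lambda>_. undefined\<close> as its only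
  point.\<close>

abbreviation "L n \<equiv> IT.C 0 n (\<lambda>_. undefined)"

lemma law_eq: "law = IT.PF.lim" by (simp add: process_law_def)

lemma sets_law: "sets law = sets (PiM UNIV (\<lambda>_. XA))" by (simp add: law_eq)

lemma undefined_hist: "(\<lambda>_. undefined) \<in> space (hist 0)"
  by (simp add: space_PiM PiE_def extensional_def Pi_def)

lemma sets_L: "sets (L n) = sets (hist n)"
  using IT.sets_C[OF undefined_hist, of n] by simp

text \<open>Marginals of the projective limit are given by \<open>IT.CI\<close>; for an initial
  segment of epochs the embedding in its description is the identity, which leaves the iterated
  kernel.\<close>

lemma restrict_law: "distr law (hist n) (\<lambda>\<omega>. restrict \<omega> {0..<n}) = L n"
proof -
  have "distr law (hist n) (\<lambda>\<omega>. restrict \<omega> {0..<n}) = IT.CI {0..<n}"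
    unfolding law_eq by (rule IT.distr_lim) simp
  also have "\<dots> = L n"
  proof (rule measure_eqI)
    show s: "sets (IT.CI {0..<n}) = sets (L n)" by (simp add: IT.CI_def sets_L)
    fix B assume "B \<in> sets (IT.CI {0..<n})"
    then have B: "B \<in> sets (hist n)" by (simp add: IT.CI_def)
    have "emeasure (IT.CI {0..<n}) B = emeasure (L n) (prod_emb {0..<n} (\<lambda>_. XA) {0..<n} B)"
      using B by (intro IT.emeasure_CI) auto
    then show "emeasure (IT.CI {0..<n}) B = emeasure (L n) B"
      using sets.sets_into_space[OF B] by (simp add: prod_emb_id space_PiM)
  qed
  finally show ?thesis .
qed

lemma nn_integral_law:
  assumes f: "f \<in> borel_measurable (hist n)"
  shows "(\<integral>\<^sup>+\<omega>. f (restrict \<omega> {0..<n}) \<partial>law) = (\<integral>\<^sup>+h. f h \<partial>L n)"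
proof -
  have "(\<lambda>\<omega>. restrict \<omega> {0..<n}) \<in> law \<rightarrow>\<^sub>M hist n"
    unfolding measurable_cong_sets[OF sets_law refl] by (rule measurable_restrict_subset) simp
  then show ?thesis using f by (simp add: restrict_law[symmetric] nn_integral_distr)
qed

lemma nn_integral_L_Suc:
  assumes f: "f \<in> borel_measurable (hist (Suc n))"
  shows "(\<integral>\<^sup>+h. f h \<partial>L (Suc n)) = (\<integral>\<^sup>+h. \<integral>\<^sup>+z. f (h(n := z)) \<partial>K n h \<partial>L n)"
proof -
  have eP: "IT.eP n \<in> L n \<rightarrow>\<^sub>M subprob_algebra (hist (Suc n))"
    using IT.measurable_eP[of n] measurable_cong_sets[OF sets_L refl] by blast
  have "(\<integral>\<^sup>+h. f h \<partial>L (Suc n)) = (\<integral>\<^sup>+h. \<integral>\<^sup>+h'. f h' \<partial>IT.eP n h \<partial>L n)"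
    by (simp add: nn_integral_bind[OF f eP])
  also have "\<dots> = (\<integral>\<^sup>+h. \<integral>\<^sup>+z. f (h(n := z)) \<partial>K n h \<partial>L n)"
    using sets_eq_imp_space_eq[OF sets_L] f by (intro nn_integral_cong IT.nn_integral_eP) simp_all
  finally show ?thesis .
qed

text \<open>Makes the arbitrary continuation of costs and transitions off the graph harmless. The
  probability of being off the graph at epoch \<open>n\<close> is an integral over the action law,
  which is concentrated on \<open>A x\<close> whatever the past; countably many null events then
  combine.\<close>

lemma AE_graph: "AE \<omega> in law. \<forall>n. \<omega> n \<in> Sigma X A"
proof (subst AE_all_countable, rule allI)
  fix n
  let ?B = "X \<times> Act - Sigma X A"
  define f :: "(nat \<Rightarrow> 's \<times> 'b) \<Rightarrow> ennreal" where "f h = indicator ?B (h n)" for h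
  have B: "?B \<in> sets XA" using sets.compl_sets[OF graph_sets] by (simp add: space_XA)
  have comp: "(\<lambda>h. h n) \<in> hist (Suc n) \<rightarrow>\<^sub>M XA" by (rule measurable_component_singleton) simp
  have f: "f \<in> borel_measurable (hist (Suc n))"
    unfolding f_def[abs_def] by (rule measurable_compose[OF comp borel_measurable_indicator[OF B]])
  have "(\<integral>\<^sup>+\<omega>. f (restrict \<omega> {0..<Suc n}) \<partial>law) = (\<integral>\<^sup>+h. \<integral>\<^sup>+z. indicator ?B z \<partial>K n h \<partial>L n)"
    unfolding nn_integral_law[OF f] nn_integral_L_Suc[OF f] by (simp add: f_def)
  also have "\<dots> = (\<integral>\<^sup>+h. 0 \<partial>L n)"
  proof (rule nn_integral_cong)
    fix h assume "h \<in> space (L n)"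
    then have h: "h \<in> space (hist n)" using sets_eq_imp_space_eq[OF sets_L] by simp
    have sn: "sets (next_state n h) = sets (borel_on X)"
      using measurable_space[OF next_state_measurable h] by (simp add: space_prob_algebra)
    have "(\<integral>\<^sup>+a. indicator ?B (x, a) \<partial>\<pi> n h x) = (0 :: ennreal)" if "x \<in> space (next_state n h)" for x
    proof -
      have x: "x \<in> X" using that space_borel_on[OF sn] by simp
      have "(\<integral>\<^sup>+a. indicator ?B (x, a) \<partial>\<pi> n h x) = (\<integral>\<^sup>+a. 0 \<partial>\<pi> n h x)"
        using policy_AE[OF h x] by (intro nn_integral_cong_AE) (auto simp: x)
      then show ?thesis by simp
    qed
    then have "(\<integral>\<^sup>+x. \<integral>\<^sup>+a. indicator ?B (x, a) \<partial>\<pi> n h x \<partial>next_state n h) = (\<integral>\<^sup>+x. 0 \<partial>next_state n h)"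
      by (intro nn_integral_cong)
    then show "(\<integral>\<^sup>+z. indicator ?B z \<partial>K n h) = 0"
      by (simp add: nn_integral_step_kernel[OF h borel_measurable_indicator[OF B]])
  qed
  finally have 0: "(\<integral>\<^sup>+\<omega>. f (restrict \<omega> {0..<Suc n}) \<partial>law) = 0" by simp
  have "(\<lambda>\<omega>. restrict \<omega> {0..<Suc n}) \<in> law \<rightarrow>\<^sub>M hist (Suc n)"
    unfolding measurable_cong_sets[OF sets_law refl] by (rule measurable_restrict_subset) simp
  from measurable_compose[OF this f] 0
  have "AE \<omega> in law. f (restrict \<omega> {0..<Suc n}) = 0" by (simp add: nn_integral_0_iff_AE)
  moreover have "\<omega> n \<in> X \<times> Act" if "\<omega> \<in> space law" for \<omega>
    using that sets_eq_imp_space_eq[OF sets_law] by (auto simp: space_PiM space_XA)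
  ultimately show "AE \<omega> in law. \<omega> n \<in> Sigma X A"
    by (auto simp: f_def indicator_def elim!: AE_mp split: if_splits)
qed

section \<open>Costs over finite horizons and exchange of terminal costs\<close>

definition partial_cost :: "nat \<Rightarrow> (nat \<Rightarrow> 's \<times> 'b) \<Rightarrow> ennreal" where
  "partial_cost n h = (\<Sum>i<n. ennreal (\<beta> ^ i) * cost (h i))"

lemma partial_cost_measurable: "partial_cost n \<in> borel_measurable (hist n)"
  unfolding partial_cost_def[abs_def] by measurable

text \<open>Expected cost of the first \<open>n\<close> stages, plus the discounted terminal cost \<open>w\<close> at time \<open>n\<close>.\<close>

definition horizon :: "nat \<Rightarrow> ('s \<Rightarrow> ennreal) \<Rightarrow> ennreal" where
  "horizon n w = (\<integral>\<^sup>+h. partial_cost n h + ennreal (\<beta> ^ n) * (\<integral>\<^sup>+x. w x \<partial>next_state n h) \<partial>L n)"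

lemma horizon_0:
  assumes "w \<in> borel_measurable (borel_on X)"
  shows "horizon 0 w = w x0"
proof -
  interpret prob_space "L 0" by (rule IT.prob_space_C[OF undefined_hist])
  show ?thesis using assms initial
    by (simp add: horizon_def partial_cost_def next_state_def nn_integral_return emeasure_space_1 del: IT.C.simps)
qed

text \<open>Integrating out epoch \<open>n\<close> merges its running cost with the terminal cost
  one step later: after the factor \<open>\<beta> ^ n\<close> is taken out of both, what remains is
  \<open>stage w\<close>.\<close>

lemma horizon_Suc:
  assumes w: "w \<in> borel_measurable (borel_on X)"
  shows "horizon (Suc n) w = (\<integral>\<^sup>+h. partial_cost n h +
    ennreal (\<beta> ^ n) * (\<integral>\<^sup>+x. \<integral>\<^sup>+a. stage w (x, a) \<partial>\<pi> n h x \<partial>next_state n h) \<partial>L n)"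
proof -
  let ?f = "\<lambda>h. partial_cost (Suc n) h + ennreal (\<beta> ^ Suc n) * (\<integral>\<^sup>+x. w x \<partial>next_state (Suc n) h)"
  have f: "?f \<in> borel_measurable (hist (Suc n))"
    using partial_cost_measurable[of "Suc n"]
      measurable_compose[OF measurable_prob_algebraD[OF next_state_measurable] nn_integral_measurable_subprob_algebra[OF w], of "Suc n"]
    by measurable
  have "horizon (Suc n) w = (\<integral>\<^sup>+h. \<integral>\<^sup>+z. ?f (h(n := z)) \<partial>K n h \<partial>L n)"
    unfolding horizon_def by (rule nn_integral_L_Suc[OF f])
  also have "\<dots> = (\<integral>\<^sup>+h. partial_cost n h +
    ennreal (\<beta> ^ n) * (\<integral>\<^sup>+x. \<integral>\<^sup>+a. stage w (x, a) \<partial>\<pi> n h x \<partial>next_state n h) \<partial>L n)"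
  proof (rule nn_integral_cong)
    fix h assume "h \<in> space (L n)"
    then have h: "h \<in> space (hist n)" using sets_eq_imp_space_eq[OF sets_L] by simp
    have "K n h \<in> space (prob_algebra XA)" by (rule measurable_space[OF step_kernel_measurable h])
    then interpret prob_space "K n h" by (simp add: space_prob_algebra)
    have sK: "sets (K n h) = sets XA" using \<open>K n h \<in> _\<close> by (simp add: space_prob_algebra)
    have st: "stage w \<in> borel_measurable (K n h)"
      using stage_measurable[OF w] measurable_cong_sets[OF sK refl] by blast
    have "?f (h(n := z)) = partial_cost n h + ennreal (\<beta> ^ n) * stage w z" for z
      using discount_nonneg
      by (simp add: partial_cost_def next_state_def stage_def distrib_left ennreal_mult' mult_ac add_ac)
    then have "(\<integral>\<^sup>+z. ?f (h(n := z)) \<partial>K n h) = partial_cost n h + ennreal (\<beta> ^ n) * (\<integral>\<^sup>+z. stage w z \<partial>K n h)"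
      using st by (simp add: nn_integral_add nn_integral_cmult emeasure_space_1)
    then show "(\<integral>\<^sup>+z. ?f (h(n := z)) \<partial>K n h) = partial_cost n h +
        ennreal (\<beta> ^ n) * (\<integral>\<^sup>+x. \<integral>\<^sup>+a. stage w (x, a) \<partial>\<pi> n h x \<partial>next_state n h)"
      by (simp add: nn_integral_step_kernel[OF h stage_measurable[OF w]])
  qed
  finally show ?thesis .
qed

lemma next_state_space:
  assumes "h \<in> space (L n)"
  shows "h \<in> space (hist n)" "space (next_state n h) = X"
proof -
  show h: "h \<in> space (hist n)" using sets_eq_imp_space_eq[OF sets_L] assms by simp
  show "space (next_state n h) = X"
    using measurable_space[OF next_state_measurable h] by (intro space_borel_on) (simp add: space_prob_algebra)
qed

text \<open>One step of backward induction: a terminal cost \<open>v\<close> at time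
  \<open>n\<close> is exchanged for \<open>w\<close> at time \<open>n + 1\<close>. The hypothesis
  ranges over all histories because the policy may depend on the past.\<close>

lemma horizon_le_Suc:
  assumes "w \<in> borel_measurable (borel_on X)"
    and "\<And>h x. h \<in> space (hist n) \<Longrightarrow> x \<in> X \<Longrightarrow> v x \<le> (\<integral>\<^sup>+a. stage w (x, a) \<partial>\<pi> n h x)"
  shows "horizon n v \<le> horizon (Suc n) w"
  unfolding horizon_Suc[OF assms(1)] unfolding horizon_def
  using next_state_space assms(2)
  by (intro nn_integral_mono add_left_mono mult_left_mono) auto

lemma horizon_eq_Suc:
  assumes "w \<in> borel_measurable (borel_on X)"
    and "\<And>h x. h \<in> space (hist n) \<Longrightarrow> x \<in> X \<Longrightarrow> v x = (\<integral>\<^sup>+a. stage w (x, a) \<partial>\<pi> n h x)"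
  shows "horizon n v = horizon (Suc n) w"
  unfolding horizon_Suc[OF assms(1)] unfolding horizon_def
  using next_state_space assms(2)
  by (intro nn_integral_cong arg_cong2[where f="(+)"] arg_cong2[where f="(*)"] refl) auto

text \<open>Almost surely the path stays on the graph, where \<open>cost\<close> agrees with
  \<open>c\<close>. The nonnegative series may then be integrated term by term, and its partial sums
  are finite-horizon costs with zero terminal cost.\<close>

lemma discounted_cost_eq_SUP:
  "discounted_cost X Act A c p \<beta> \<pi> x0 = (SUP n. horizon n (\<lambda>_. 0))"
proof -
  have "discounted_cost X Act A c p \<beta> \<pi> x0 = (\<integral>\<^sup>+\<omega>. (\<Sum>n. ennreal (\<beta> ^ n) * cost (\<omega> n)) \<partial>law)"
    unfolding discounted_cost_def
  proof (rule nn_integral_cong_AE)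
    show "AE \<omega> in law. (\<Sum>n. ennreal (\<beta> ^ n * c (\<omega> n))) = (\<Sum>n. ennreal (\<beta> ^ n) * cost (\<omega> n))"
      using AE_graph by eventually_elim (simp add: cost_def ennreal_mult' discount_nonneg del: mem_Sigma_iff)
  qed
  also have "\<dots> = (\<Sum>n. \<integral>\<^sup>+\<omega>. ennreal (\<beta> ^ n) * cost (\<omega> n) \<partial>law)"
  proof (rule nn_integral_suminf)
    fix n
    have "(\<lambda>\<omega>. cost (\<omega> n)) \<in> borel_measurable law"
      unfolding measurable_cong_sets[OF sets_law refl]
      by measurable
    then show "(\<lambda>\<omega>. ennreal (\<beta> ^ n) * cost (\<omega> n)) \<in> borel_measurable law" by measurable
  qed
  also have "\<dots> = (SUP N. \<Sum>n<N. \<integral>\<^sup>+\<omega>. ennreal (\<beta> ^ n) * cost (\<omega> n) \<partial>law)"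
    by (rule suminf_eq_SUP)
  also have "\<dots> = (SUP N. horizon N (\<lambda>_. 0))"
  proof (rule SUP_cong[OF refl])
    fix N
    have "(\<Sum>n<N. \<integral>\<^sup>+\<omega>. ennreal (\<beta> ^ n) * cost (\<omega> n) \<partial>law) = (\<integral>\<^sup>+\<omega>. (\<Sum>n<N. ennreal (\<beta> ^ n) * cost (\<omega> n)) \<partial>law)"
    proof (rule nn_integral_sum[symmetric])
      fix n
      have "(\<lambda>\<omega>. cost (\<omega> n)) \<in> borel_measurable law"
        unfolding measurable_cong_sets[OF sets_law refl]
        by measurable
      then show "(\<lambda>\<omega>. ennreal (\<beta> ^ n) * cost (\<omega> n)) \<in> borel_measurable law" by measurable
    qed
    also have "\<dots> = (\<integral>\<^sup>+\<omega>. partial_cost N (restrict \<omega> {0..<N}) \<partial>law)"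
      by (intro nn_integral_cong) (simp add: partial_cost_def)
    also have "\<dots> = horizon N (\<lambda>_. 0)"
      unfolding nn_integral_law[OF partial_cost_measurable] by (simp add: horizon_def)
    finally show "(\<Sum>n<N. \<integral>\<^sup>+\<omega>. ennreal (\<beta> ^ n) * cost (\<omega> n) \<partial>law) = horizon N (\<lambda>_. 0)" .
  qed
  finally show ?thesis .
qed

end

section \<open>Value iteration\<close>

context markov_decision
begin

lemma space_kern: "z \<in> X \<times> Act \<Longrightarrow> space (kern z) = X"
  using measurable_space[OF kern_measurable, of z]
  by (intro space_borel_on) (simp add: space_prob_algebra space_XA)

lemma sets_kern: "z \<in> X \<times> Act \<Longrightarrow> sets (kern z) = sets (borel_on X)"
  using measurable_space[OF kern_measurable, of z] by (simp add: space_prob_algebra space_XA)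

text \<open>Monotonicity of the integral concerns arbitrary functions, so this also compares with
  the value function, which is introduced as an infimum over policies. An inequality on
  \<open>X\<close> is enough because \<open>kern z\<close> lives there.\<close>

lemma stage_mono:
  assumes "\<And>y. y \<in> X \<Longrightarrow> u y \<le> w y" "z \<in> X \<times> Act"
  shows "stage u z \<le> stage w z"
  unfolding stage_def using assms space_kern[OF assms(2)]
  by (intro add_left_mono mult_left_mono nn_integral_mono) auto

lemma stage_SUP:
  assumes w: "\<And>n. w n \<in> borel_measurable (borel_on X)"
    and inc: "\<And>m n y. m \<le> n \<Longrightarrow> y \<in> X \<Longrightarrow> w m y \<le> w n y" and z: "z \<in> X \<times> Act"
  shows "stage (\<lambda>y. SUP n. w n y) z = (SUP n::nat. stage (w n) z)"
proof -
  have "w n \<in> borel_measurable (kern z)" for n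
    using w measurable_cong_sets[OF sets_kern[OF z] refl] by blast
  then have "(\<integral>\<^sup>+y. (SUP n. w n y) \<partial>kern z) = (SUP n. \<integral>\<^sup>+y. w n y \<partial>kern z)"
    using inc space_kern[OF z] by (intro nn_integral_monotone_convergence_SUP_AE) (auto intro!: AE_I2)
  moreover have "(SUP n. cost z + ennreal \<beta> * (\<integral>\<^sup>+y. w n y \<partial>kern z)) =
      cost z + ennreal \<beta> * (SUP n. \<integral>\<^sup>+y. w n y \<partial>kern z)"
    by (simp add: ennreal_SUP_add_right SUP_mult_left_ennreal)
  ultimately show ?thesis by (simp add: stage_def)
qed

lemma stationary_policy_space: "\<phi> \<in> stationary_policies X Act A \<Longrightarrow> x \<in> X \<Longrightarrow> \<phi> x \<in> A x \<and> (x, \<phi> x) \<in> X \<times> Act"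
  using A_subset by (fastforce simp: stationary_policies_def)

lemma stage_policy_measurable:
  assumes "\<phi> \<in> stationary_policies X Act A" "w \<in> borel_measurable (borel_on X)"
  shows "(\<lambda>x. stage w (x, \<phi> x)) \<in> borel_measurable (borel_on X)"
proof -
  have "(\<lambda>x. (x, \<phi> x)) \<in> borel_on X \<rightarrow>\<^sub>M XA"
    using assms(1) by (intro measurable_Pair) (auto simp: stationary_policies_def)
  from measurable_compose[OF this stage_measurable[OF assms(2)]] show ?thesis .
qed

lemma stationary_mem_policies:
  assumes \<phi>: "\<phi> \<in> stationary_policies X Act A"
  shows "stationary Act \<phi> \<in> policies X Act A"
  unfolding policies_def stationary_def
proof (intro CollectI allI conjI ballI)
  fix n
  have "\<phi> \<in> borel_on X \<rightarrow>\<^sub>M borel_on Act" using \<phi> by (simp add: stationary_policies_def)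
  then show "(\<lambda>(h, x). return (borel_on Act) (\<phi> x)) \<in> (\<Pi>\<^sub>M i\<in>{0..<n}. XA) \<Otimes>\<^sub>M borel_on X \<rightarrow>\<^sub>M prob_algebra (borel_on Act)"
    by measurable
next
  fix x assume x: "x \<in> X"
  have "A x \<in> sets (borel_on Act)" using sets_Pair1[OF graph_sets, of x] x by (simp add: vimage_def)
  then show "emeasure (return (borel_on Act) (\<phi> x)) (A x) = 1"
    using stationary_policy_space[OF \<phi> x] by simp
qed

text \<open>The deterministic rule makes the exchange of terminal costs an equality, so the
  \<open>n\<close>-th iterate charged at time \<open>m\<close> can be pushed forward until it
  becomes zero at time \<open>m + n\<close>.\<close>

lemma discounted_cost_stationary:
  assumes \<phi>: "\<phi> \<in> stationary_policies X Act A" and x: "x \<in> X"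
  shows "discounted_cost X Act A c p \<beta> (stationary Act \<phi>) x =
    (SUP n. ((\<lambda>w x. stage w (x, \<phi> x)) ^^ n) (\<lambda>_. 0) x)"
proof -
  interpret controlled_process X Act A c p \<beta> "stationary Act \<phi>" x
    by unfold_locales (use stationary_mem_policies[OF \<phi>] x in auto)
  define W where "W n = ((\<lambda>w x. stage w (x, \<phi> x)) ^^ n) (\<lambda>_. 0)" for n
  have W: "W n \<in> borel_measurable (borel_on X)" for n
    by (induction n) (simp_all add: W_def stage_policy_measurable[OF \<phi>])
  \<comment> \<open>The start \<open>m\<close> stays general because each exchange moves the
    terminal time by one.\<close>
  have "horizon m (W n) = horizon (m + n) (\<lambda>_. 0)" for m n
  proof (induction n arbitrary: m)
    case (Suc n)
    have "horizon m (W (Suc n)) = horizon (Suc m) (W n)"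
    proof (rule horizon_eq_Suc[OF W])
      fix h y assume y: "y \<in> X"
      have "(\<lambda>a. stage (W n) (y, a)) \<in> borel_measurable (borel_on Act)"
        using y by (intro measurable_compose[OF measurable_Pair1' stage_measurable[OF W]]) simp
      then have "(\<integral>\<^sup>+a. stage (W n) (y, a) \<partial>stationary Act \<phi> m h y) = stage (W n) (y, \<phi> y)"
        using stationary_policy_space[OF \<phi> y] by (simp add: stationary_def nn_integral_return)
      then show "W (Suc n) y = (\<integral>\<^sup>+a. stage (W n) (y, a) \<partial>stationary Act \<phi> m h y)" by (simp add: W_def)
    qed
    with Suc show ?case by simp
  qed (simp add: W_def)
  from this[of 0] horizon_0[OF W] have "horizon n (\<lambda>_. 0) = W n x" for n by simp
  then show ?thesis by (simp add: discounted_cost_eq_SUP W_def)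
qed

text \<open>\<open>W\<close> is any chain of subsolutions starting at zero. Averaging
  \<open>step\<close> over the randomised action, which is almost surely in \<open>A y\<close>,
  gives the hypothesis of \<open>horizon_le_Suc\<close> for every history; hence neither memory nor
  randomisation can beat the chain.\<close>

lemma discounted_cost_ge:
  assumes \<pi>: "\<pi> \<in> policies X Act A" and x: "x \<in> X"
    and W: "\<And>n. W n \<in> borel_measurable (borel_on X)" and W0: "W 0 = (\<lambda>_. 0)"
    and step: "\<And>n y a. y \<in> X \<Longrightarrow> a \<in> A y \<Longrightarrow> W (Suc n) y \<le> stage (W n) (y, a)"
  shows "W n x \<le> discounted_cost X Act A c p \<beta> \<pi> x"
proof -
  interpret controlled_process X Act A c p \<beta> \<pi> x
    by unfold_locales (use \<pi> x in auto)
  have "horizon m (W n) \<le> horizon (m + n) (\<lambda>_. 0)" for m n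
  proof (induction n arbitrary: m)
    case (Suc n)
    have "horizon m (W (Suc n)) \<le> horizon (Suc m) (W n)"
    proof (rule horizon_le_Suc[OF W])
      fix h y assume h: "h \<in> space (hist m)" and y: "y \<in> X"
      interpret prob_space "\<pi> m h y"
        using measurable_space[OF policy_measurable_fixed_history[OF h], of y] y by (simp add: space_prob_algebra)
      have "W (Suc n) y = (\<integral>\<^sup>+a. W (Suc n) y \<partial>\<pi> m h y)" by (simp add: emeasure_space_1)
      also have "\<dots> \<le> (\<integral>\<^sup>+a. stage (W n) (y, a) \<partial>\<pi> m h y)"
        using policy_AE[OF h y] step[OF y] by (intro nn_integral_mono_AE) (auto elim: AE_mp)
      finally show "W (Suc n) y \<le> (\<integral>\<^sup>+a. stage (W n) (y, a) \<partial>\<pi> m h y)" .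
    qed
    also have "\<dots> \<le> horizon (Suc m + n) (\<lambda>_. 0)" by (rule Suc)
    finally show ?case by simp
  qed (simp add: W0)
  from this[of 0 n] horizon_0[OF W] have "W n x \<le> horizon n (\<lambda>_. 0)" by simp
  then show ?thesis unfolding discounted_cost_eq_SUP by (meson SUP_upper2 UNIV_I)
qed

text \<open>Dropping the first term does not change the supremum of an increasing sequence, and
  monotone convergence carries the supremum through \<open>stage\<close>. \<open>J\<close> is fixed
  only by its values on \<open>X\<close>, so that it may be the value function.\<close>

lemma discounted_cost_stationary_fixpoint:
  assumes \<phi>: "\<phi> \<in> stationary_policies X Act A" and x: "x \<in> X"
    and J: "\<And>y. y \<in> X \<Longrightarrow> J y = discounted_cost X Act A c p \<beta> (stationary Act \<phi>) y"
  shows "J x = stage J (x, \<phi> x)"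
proof -
  define W where "W n = ((\<lambda>w x. stage w (x, \<phi> x)) ^^ n) (\<lambda>_. 0)" for n
  have WS: "W (Suc n) y = stage (W n) (y, \<phi> y)" for n y by (simp add: W_def)
  have W: "W n \<in> borel_measurable (borel_on X)" for n
    by (induction n) (simp_all add: W_def stage_policy_measurable[OF \<phi>])
  have step: "W n y \<le> W (Suc n) y" if "y \<in> X" for n y
    using that
  proof (induction n arbitrary: y)
    case (Suc n)
    then show ?case unfolding WS[of n] WS[of "Suc n"]
      using stationary_policy_space[OF \<phi>] by (intro stage_mono) auto
  qed (simp add: W_def)
  have inc: "W m y \<le> W n y" if "m \<le> n" "y \<in> X" for m n y
    using step[OF that(2)] that(1) by (rule lift_Suc_mono_le)
  have J': "J y = (SUP n. W n y)" if "y \<in> X" for y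
    unfolding J[OF that] discounted_cost_stationary[OF \<phi> that] W_def ..
  have z: "(x, \<phi> x) \<in> X \<times> Act" using stationary_policy_space[OF \<phi> x] by blast
  have "J x = (SUP n. W (Suc n) x)"
    unfolding J'[OF x]
  proof (rule antisym)
    show "(SUP n. W n x) \<le> (SUP n. W (Suc n) x)"
      using inc[OF le_SucI[OF order_refl] x] by (intro SUP_mono) auto
    show "(SUP n. W (Suc n) x) \<le> (SUP n. W n x)" by (intro SUP_mono) auto
  qed
  also have "\<dots> = stage (\<lambda>y. SUP n. W n y) (x, \<phi> x)"
    unfolding WS by (rule stage_SUP[OF W inc z, symmetric])
  also have "\<dots> = stage J (x, \<phi> x)"
    using J' z by (intro antisym stage_mono) auto
  finally show ?thesis .
qed

text \<open>A supersolution stays above all iterates started at zero, by induction with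
  \<open>stage_mono\<close>, hence above their supremum. Infinite values of \<open>u\<close> cause
  no trouble.\<close>

lemma discounted_cost_stationary_le:
  assumes \<phi>: "\<phi> \<in> stationary_policies X Act A" and x: "x \<in> X"
    and u: "\<And>y. y \<in> X \<Longrightarrow> stage u (y, \<phi> y) \<le> u y"
  shows "discounted_cost X Act A c p \<beta> (stationary Act \<phi>) x \<le> u x"
  unfolding discounted_cost_stationary[OF \<phi> x]
proof (rule SUP_least)
  fix n
  have "((\<lambda>w x. stage w (x, \<phi> x)) ^^ n) (\<lambda>_. 0) y \<le> u y" if "y \<in> X" for y
    using that
  proof (induction n arbitrary: y)
    case (Suc n)
    then have "stage (((\<lambda>w x. stage w (x, \<phi> x)) ^^ n) (\<lambda>_. 0)) (y, \<phi> y) \<le> stage u (y, \<phi> y)"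
      using stationary_policy_space[OF \<phi>] by (intro stage_mono) auto
    with u[OF Suc.prems] show ?case by simp
  qed simp
  then show "((\<lambda>w x. stage w (x, \<phi> x)) ^^ n) (\<lambda>_. 0) x \<le> u x" using x .
qed

end

locale semicontinuous_mdp = markov_decision X Act A c p \<beta>
  for X :: "'s::polish_space set" and Act :: "'b::polish_space set" and A c p \<beta> +
  assumes A_nonempty: "x \<in> X \<Longrightarrow> A x \<noteq> {}"
    and A_compact: "compact_valued X A"
    and A_continuous: "continuous_set_map X Act A"
    and p_continuous: "weakly_continuous (Sigma X A) X p"
    and c_lsc: "lower_semicontinuous_on (Sigma X A) c"
begin

lemma stage_graph: "z \<in> Sigma X A \<Longrightarrow> stage w z = ennreal (c z) + ennreal \<beta> * (\<integral>\<^sup>+y. w y \<partial>p z)"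
  by (simp add: stage_def cost_def kern_def)

lemma stage_lsc:
  assumes "lsc_on X w"
  shows "lsc_on (Sigma X A) (stage w)"
proof -
  have "transition_kernel (Sigma X A) X p" using prob_kernel by (simp add: transition_prob_kernel_def)
  then have "lsc_on (Sigma X A) (\<lambda>z. ennreal (c z) + ennreal \<beta> * (\<integral>\<^sup>+y. w y \<partial>p z))"
    by (rule lsc_on_add_mult[OF lsc_on_ennreal[OF c_lsc]
        weakly_continuous_lsc_integral[OF _ p_continuous assms] discount_nonneg])
  then show ?thesis by (simp add: stage_graph cong: lsc_on_cong)
qed

definition bellman :: "('s \<Rightarrow> ennreal) \<Rightarrow> 's \<Rightarrow> ennreal" where
  "bellman w x = (INF a\<in>A x. stage w (x, a))"

lemma bellman_selector:
  assumes "lsc_on X w"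
  obtains \<phi> where "\<phi> \<in> stationary_policies X Act A" "\<And>x. x \<in> X \<Longrightarrow> bellman w x = stage w (x, \<phi> x)"
    "lsc_on X (bellman w)"
proof -
  obtain \<phi> where \<phi>: "\<phi> \<in> stationary_policies X Act A"
    "\<And>x a. x \<in> X \<Longrightarrow> a \<in> A x \<Longrightarrow> stage w (x, \<phi> x) \<le> stage w (x, a)" "lsc_on X (\<lambda>x. stage w (x, \<phi> x))"
    using argmin_selector[OF A_compact A_continuous A_subset A_nonempty stage_lsc[OF assms]] by auto
  have "bellman w x = stage w (x, \<phi> x)" if "x \<in> X" for x
    unfolding bellman_def using stationary_policy_space[OF \<phi>(1) that] \<phi>(2)[OF that]
    by (intro antisym INF_lower INF_greatest) auto
  with \<phi> show ?thesis using that by (simp cong: lsc_on_cong)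
qed

definition iterate :: "nat \<Rightarrow> 's \<Rightarrow> ennreal" where
  "iterate n = (bellman ^^ n) (\<lambda>_. 0)"

lemma iterate_0: "iterate 0 = (\<lambda>_. 0)" and iterate_Suc: "iterate (Suc n) = bellman (iterate n)"
  by (simp_all add: iterate_def)

lemma iterate_lsc: "lsc_on X (iterate n)"
proof (induction n)
  case 0
  show ?case using lsc_on_continuous[of X "\<lambda>_. 0"] by (simp add: iterate_0)
next
  case (Suc n) then show ?case unfolding iterate_Suc using bellman_selector by blast
qed

lemma bellman_mono:
  assumes "\<And>y. y \<in> X \<Longrightarrow> u y \<le> w y" "x \<in> X"
  shows "bellman u x \<le> bellman w x"
  unfolding bellman_def using assms A_subset by (intro INF_superset_mono stage_mono) auto

lemma iterate_mono:
  assumes "m \<le> n" "x \<in> X" shows "iterate m x \<le> iterate n x"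
proof -
  have step: "iterate k x \<le> iterate (Suc k) x" if "x \<in> X" for k x
    using that
  proof (induction k arbitrary: x)
    case (Suc k) then show ?case
      unfolding iterate_Suc[of k] iterate_Suc[of "Suc k"] by (intro bellman_mono)
  qed (simp add: iterate_0)
  show ?thesis using step[OF assms(2)] assms(1) by (rule lift_Suc_mono_le)
qed

definition limit_value :: "'s \<Rightarrow> ennreal" where
  "limit_value x = (SUP n. iterate n x)"

lemma limit_value_lsc: "lsc_on X limit_value"
  unfolding limit_value_def[abs_def] by (intro lsc_on_SUP iterate_lsc)

lemma iterate_le_limit: "iterate n x \<le> limit_value x"
  unfolding limit_value_def by (rule SUP_upper) simp

text \<open>Compactness of the action sets lets the minimum over actions commute with the increasing limit.\<close>

lemma bellman_limit_value:
  assumes x: "x \<in> X"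
  shows "bellman limit_value x = limit_value x"
proof (rule antisym)
  \<comment> \<open>The level \<open>limit_value x\<close> is the same for all \<open>n\<close>, so
    these sets decrease. Each is nonempty because \<open>bellman (iterate n)\<close> is attained and
    equals the next iterate, which lies below the limit.\<close>
  let ?F = "\<lambda>n. {a\<in>A x. stage (iterate n) (x, a) \<le> limit_value x}"
  have "(\<Inter>n. ?F n) \<noteq> {}"
  proof (rule compact_decseq_nonempty)
    fix n
    have "lsc_on (A x) (\<lambda>a. stage (iterate n) (x, a))"
      using x by (intro lsc_on_compose[OF stage_lsc[OF iterate_lsc], of _ "\<lambda>a. (x, a)"]) (auto intro!: continuous_intros)
    then have "closedin (top_of_set (A x)) (?F n)" by (simp add: lsc_on_def)
    moreover have "compact (A x)" using A_compact x by (simp add: compact_valued_def)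
    ultimately show "compact (?F n)" using closedin_compact by blast
    obtain \<phi> where \<phi>: "\<phi> \<in> stationary_policies X Act A" "bellman (iterate n) x = stage (iterate n) (x, \<phi> x)"
      using bellman_selector[OF iterate_lsc[of n]] x by metis
    have "bellman (iterate n) x \<le> limit_value x" using iterate_le_limit[of "Suc n"] by (simp add: iterate_Suc)
    then have "\<phi> x \<in> ?F n" using \<phi> stationary_policy_space[OF \<phi>(1) x] by simp
    then show "?F n \<noteq> {}" by blast
  next
    have "stage (iterate m) (x, a) \<le> stage (iterate n) (x, a)" if "m \<le> n" "a \<in> A x" for m n a
      using that x A_subset[OF x] by (intro stage_mono iterate_mono) auto
    then show "decseq ?F" unfolding decseq_def by (auto intro: order_trans)
  qed
  \<comment> \<open>A single action that is good for every horizon at once; separate minimisers for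
    each \<open>n\<close> would not allow the limit to be taken inside \<open>stage\<close>.\<close>
  then obtain a where a: "a \<in> A x" "\<And>n. stage (iterate n) (x, a) \<le> limit_value x" by auto
  have "stage limit_value (x, a) = (SUP n. stage (iterate n) (x, a))"
    unfolding limit_value_def[abs_def] using x a(1) A_subset[OF x]
    by (intro stage_SUP lsc_on_measurable iterate_lsc iterate_mono) auto
  also have "\<dots> \<le> limit_value x" using a(2) by (rule SUP_least)
  finally show "bellman limit_value x \<le> limit_value x"
    unfolding bellman_def using a(1) by (intro INF_lower2)
  show "limit_value x \<le> bellman limit_value x"
    unfolding limit_value_def[of x]
  proof (rule SUP_least)
    fix n
    show "iterate n x \<le> bellman limit_value x"
    proof (cases n)
      case (Suc m)
      then show ?thesis using x iterate_le_limit by (auto simp: iterate_Suc intro!: bellman_mono)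
    qed (simp add: iterate_0)
  qed
qed

abbreviation "val \<equiv> value_function X Act A c p \<beta>"
abbreviation "optimal \<equiv> discount_optimal X Act A c p \<beta>"

lemma limit_value_le:
  assumes "\<pi> \<in> policies X Act A" "x \<in> X"
  shows "limit_value x \<le> discounted_cost X Act A c p \<beta> \<pi> x"
  unfolding limit_value_def
proof (rule SUP_least, rule discounted_cost_ge[OF assms, of iterate])
  show "iterate n \<in> borel_measurable (borel_on X)" for n by (rule lsc_on_measurable[OF iterate_lsc])
  show "iterate (Suc n) y \<le> stage (iterate n) (y, a)" if "y \<in> X" "a \<in> A y" for n y a
    unfolding iterate_Suc bellman_def using that by (intro INF_lower)
qed (rule iterate_0)

text \<open>A minimiser in the equation for \<open>limit_value\<close> makes that function a
  supersolution for the policy, and supersolutions dominate costs.\<close>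

lemma exists_stationary_le_limit:
  obtains \<phi> where "\<phi> \<in> stationary_policies X Act A"
    "\<And>x. x \<in> X \<Longrightarrow> discounted_cost X Act A c p \<beta> (stationary Act \<phi>) x \<le> limit_value x"
proof -
  obtain \<phi> where \<phi>: "\<phi> \<in> stationary_policies X Act A" "\<And>x. x \<in> X \<Longrightarrow> bellman limit_value x = stage limit_value (x, \<phi> x)"
    using bellman_selector[OF limit_value_lsc] by metis
  have "discounted_cost X Act A c p \<beta> (stationary Act \<phi>) x \<le> limit_value x" if "x \<in> X" for x
    using \<phi> that by (intro discounted_cost_stationary_le) (simp_all add: bellman_limit_value flip: \<phi>(2))
  then show ?thesis using that \<phi>(1) by blast
qed

text \<open>The value is squeezed between the lower bound valid for all policies and the cost of one
  stationary policy. As a by-product, this infimum over policies is lower semicontinuous on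
  \<open>X\<close>.\<close>

lemma value_eq_limit:
  assumes x: "x \<in> X" shows "val x = limit_value x"
proof (rule antisym)
  obtain \<phi> where \<phi>: "\<phi> \<in> stationary_policies X Act A"
    "\<And>x. x \<in> X \<Longrightarrow> discounted_cost X Act A c p \<beta> (stationary Act \<phi>) x \<le> limit_value x"
    by (rule exists_stationary_le_limit) blast
  show "val x \<le> limit_value x"
    unfolding value_function_def by (rule INF_lower2[OF stationary_mem_policies[OF \<phi>(1)]]) (rule \<phi>(2)[OF x])
  show "limit_value x \<le> val x"
    unfolding value_function_def using limit_value_le x by (intro INF_greatest)
qed

lemma exists_stationary_optimal:
  obtains \<phi> where "\<phi> \<in> stationary_policies X Act A" "optimal (stationary Act \<phi>)"
proof -
  obtain \<phi> where \<phi>: "\<phi> \<in> stationary_policies X Act A"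
    "\<And>x. x \<in> X \<Longrightarrow> discounted_cost X Act A c p \<beta> (stationary Act \<phi>) x \<le> limit_value x"
    by (rule exists_stationary_le_limit) blast
  have "optimal (stationary Act \<phi>)"
    unfolding discount_optimal_def
    using stationary_mem_policies[OF \<phi>(1)] \<phi>(2) limit_value_le by (auto simp: value_eq_limit intro!: antisym)
  then show ?thesis using that \<phi>(1) by blast
qed

text \<open>Necessity: an optimal policy has cost \<open>val\<close>, which then solves the
  evaluation equation of \<open>\<phi>\<close>, while \<open>val\<close> is also the minimum over
  actions. Sufficiency: the equation makes \<open>val\<close> a supersolution, so the cost is at
  most \<open>val\<close>, and it is never below \<open>val\<close> by definition.\<close>

lemma stationary_optimal_iff:
  assumes \<phi>: "\<phi> \<in> stationary_policies X Act A"
  shows "optimal (stationary Act \<phi>) \<longleftrightarrow>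
    (\<forall>x\<in>X. val x = stage val (x, \<phi> x) \<and> (\<forall>a\<in>A x. stage val (x, \<phi> x) \<le> stage val (x, a)))"
proof safe
  fix x assume opt: "optimal (stationary Act \<phi>)" and x: "x \<in> X"
  show eq: "val x = stage val (x, \<phi> x)"
    using opt by (intro discounted_cost_stationary_fixpoint[OF \<phi> x]) (simp add: discount_optimal_def)
  fix a assume a: "a \<in> A x"
  have "val x = bellman limit_value x" by (simp add: x value_eq_limit bellman_limit_value)
  also have "\<dots> \<le> stage limit_value (x, a)" unfolding bellman_def using a by (rule INF_lower)
  also have "\<dots> \<le> stage val (x, a)" using a x A_subset by (intro stage_mono) (auto simp: value_eq_limit)
  finally show "stage val (x, \<phi> x) \<le> stage val (x, a)" by (simp add: eq)
next
  assume "\<forall>x\<in>X. val x = stage val (x, \<phi> x) \<and> (\<forall>a\<in>A x. stage val (x, \<phi> x) \<le> stage val (x, a))"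
  then have "discounted_cost X Act A c p \<beta> (stationary Act \<phi>) x \<le> val x" if "x \<in> X" for x
    using that by (intro discounted_cost_stationary_le[OF \<phi>]) auto
  then show "optimal (stationary Act \<phi>)"
    unfolding discount_optimal_def using stationary_mem_policies[OF \<phi>]
    by (auto intro!: antisym simp: value_function_def intro: INF_lower)
qed

end

section \<open>Adjoining an isolated point\<close>

lemma open_Some_image: "open T \<Longrightarrow> open (Some ` T)" for T :: "'a::metric_space set"
  by (simp add: open_option_iff inj_vimage_image_eq)

lemma open_None: "open {None :: 'a::metric_space option}"
  by (simp add: open_option_iff vimage_def)

lemma open_map_prod_Some:
  fixes T :: "('a::metric_space \<times> 'b::metric_space) set"
  assumes "open T" shows "open (map_prod Some Some ` T)"
proof (subst open_subopen, intro ballI)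
  fix z assume "z \<in> map_prod Some Some ` T"
  then obtain x y where z: "z = (Some x, Some y)" "(x, y) \<in> T" by auto
  obtain U V where "open U" "open V" "(x, y) \<in> U \<times> V" "U \<times> V \<subseteq> T"
    using open_prod_elim[OF assms z(2)] .
  then show "\<exists>W. open W \<and> z \<in> W \<and> W \<subseteq> map_prod Some Some ` T"
    using z(1) by (intro exI[of _ "Some ` U \<times> Some ` V"]) (force intro!: open_Times open_Some_image)
qed

lemma open_None_None: "open {(None, None) :: 'a::metric_space option \<times> 'b::metric_space option}"
  using open_Times[OF open_None open_None] by simp

text \<open>At \<open>None\<close> the value of \<open>the\<close> is unspecified, but an isolated
  point imposes no condition.\<close>

lemma continuous_on_the: "continuous_on S (the :: 'a::metric_space option \<Rightarrow> 'a)"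
proof (rule continuous_on_subset[of UNIV])
  show "continuous_on UNIV (the :: 'a option \<Rightarrow> 'a)"
    by (auto simp: continuous_on_open_vimage open_option_iff vimage_def)
qed simp

text \<open>The new graph is a homeomorphic copy of the old one plus a single isolated point;
  continuity, measurability and semicontinuity on it thus reduce to the old graph.\<close>

lemma graph_hv_actions: "Sigma (adjoin X) (hv_actions A) = insert (None, None) (map_prod Some Some ` Sigma X A)"
  by (auto simp: hv_actions_def split: option.splits)

lemma continuous_on_graph_hv:
  fixes g :: "'s::metric_space option \<times> 'b::metric_space option \<Rightarrow> 'c::topological_space"
  assumes "continuous_on (Sigma X A) (\<lambda>z. g (map_prod Some Some z))"
  shows "continuous_on (Sigma (adjoin X) (hv_actions A)) g"
  unfolding continuous_on_topological
proof (intro ballI allI impI)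
  fix z B assume z: "z \<in> Sigma (adjoin X) (hv_actions A)" and B: "open B" "g z \<in> B"
  show "\<exists>U. open U \<and> z \<in> U \<and> (\<forall>y\<in>Sigma (adjoin X) (hv_actions A). y \<in> U \<longrightarrow> g y \<in> B)"
  proof (cases "z = (None, None)")
    case True then show ?thesis using open_None_None B by (intro exI[of _ "{(None, None)}"]) auto
  next
    case False
    with z have "z \<in> map_prod Some Some ` Sigma X A" unfolding graph_hv_actions by simp
    then obtain w where w: "w \<in> Sigma X A" "z = map_prod Some Some w" by (rule imageE) simp
    obtain T where T: "open T" "w \<in> T" "\<And>y. y \<in> Sigma X A \<Longrightarrow> y \<in> T \<Longrightarrow> g (map_prod Some Some y) \<in> B"
      using assms w B unfolding continuous_on_topological by metis
    have "g y \<in> B" if "y \<in> Sigma (adjoin X) (hv_actions A)" "y \<in> map_prod Some Some ` T" for y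
    proof -
      from that(2) obtain t where t: "t \<in> T" "y = map_prod Some Some t" by auto
      then have "t \<in> Sigma X A" using that(1) by (cases t) (auto simp: hv_actions_def)
      with T t show ?thesis by auto
    qed
    then show ?thesis using T w open_map_prod_Some[OF T(1)] by (intro exI[of _ "map_prod Some Some ` T"]) auto
  qed
qed

text \<open>Continuous images of Borel sets are in general only analytic; here the image is a
  preimage under the continuous left inverse, cut with an open set.\<close>

lemma map_prod_Some_image_borel:
  fixes S :: "('s::polish_space \<times> 'b::polish_space) set"
  assumes "S \<in> sets borel" shows "map_prod Some Some ` S \<in> sets borel"
proof -
  have "continuous_on UNIV (\<lambda>z :: 's option \<times> 'b option. (the (fst z), the (snd z)))"
    by (intro continuous_on_Pair continuous_on_compose2[OF continuous_on_the[of UNIV]] continuous_intros) auto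
  then have "(\<lambda>z. (the (fst z), the (snd z))) -` S \<inter> space borel \<in> sets borel"
    using assms by (intro measurable_sets[OF borel_measurable_continuous_onI])
  moreover have "open (range Some \<times> range Some :: ('s option \<times> 'b option) set)"
    by (intro open_Times open_Some_image) auto
  ultimately have "(\<lambda>z. (the (fst z), the (snd z))) -` S \<inter> (range Some \<times> range Some) \<in> sets borel" by auto
  moreover have "(\<lambda>z. (the (fst z), the (snd z))) -` S \<inter> (range Some \<times> range Some) = map_prod Some Some ` S"
    by force
  ultimately show ?thesis by simp
qed

lemma Some_image_borel:
  fixes S :: "'s::polish_space set"
  assumes "S \<in> sets borel" shows "Some ` S \<in> sets borel"
proof -
  have "the -` S \<inter> space borel \<in> sets (borel :: 's option measure)"
    using assms by (intro measurable_sets[OF borel_measurable_continuous_onI[OF continuous_on_the]])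
  moreover have "open (range Some :: 's option set)" by (intro open_Some_image) auto
  ultimately have "the -` S \<inter> range Some \<in> sets (borel :: 's option measure)" by auto
  moreover have "the -` S \<inter> range Some = Some ` S" by force
  ultimately show ?thesis by simp
qed

lemma graph_hv_borel:
  fixes X :: "'s::polish_space set" and A :: "'s \<Rightarrow> 'b::polish_space set"
  assumes "Sigma X A \<in> sets borel"
  shows "Sigma (adjoin X) (hv_actions A) \<in> sets borel"
  unfolding graph_hv_actions by (rule sets.insert_in_sets[OF _ map_prod_Some_image_borel[OF assms]]) simp

lemma measurable_graph_hv:
  fixes X :: "'s::polish_space set" and A :: "'s \<Rightarrow> 'b::polish_space set"
  assumes S: "Sigma X A \<in> sets borel"
    and g: "(\<lambda>z. g (map_prod Some Some z)) \<in> borel_on (Sigma X A) \<rightarrow>\<^sub>M M" and N: "g (None, None) \<in> space M"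
  shows "g \<in> borel_on (Sigma (adjoin X) (hv_actions A)) \<rightarrow>\<^sub>M M"
proof (rule measurableI)
  fix z assume "z \<in> space (borel_on (Sigma (adjoin X) (hv_actions A)))"
  then have "z \<in> insert (None, None) (map_prod Some Some ` Sigma X A)"
    by (simp add: space_restrict_space graph_hv_actions)
  then show "g z \<in> space M"
    using N measurable_space[OF g] by (auto simp: space_restrict_space)
next
  fix B assume B: "B \<in> sets M"
  let ?C = "(\<lambda>z. g (map_prod Some Some z)) -` B \<inter> Sigma X A"
  have "?C \<in> sets (borel_on (Sigma X A))"
    using measurable_sets[OF g B] by (simp add: space_restrict_space)
  then have "?C \<in> sets borel" using S by (simp add: sets_restrict_space_iff)
  then have "map_prod Some Some ` ?C \<in> sets borel" by (rule map_prod_Some_image_borel)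
  then have "map_prod Some Some ` ?C \<union> (if g (None, None) \<in> B then {(None, None)} else {}) \<in> sets borel" by auto
  moreover have "g -` B \<inter> Sigma (adjoin X) (hv_actions A) =
      map_prod Some Some ` ?C \<union> (if g (None, None) \<in> B then {(None, None)} else {})"
    unfolding graph_hv_actions by auto
  ultimately show "g -` B \<inter> space (borel_on (Sigma (adjoin X) (hv_actions A))) \<in> sets (borel_on (Sigma (adjoin X) (hv_actions A)))"
    using graph_hv_borel[OF S] by (auto simp: space_restrict_space sets_restrict_space_iff)
qed

lemma measurable_adjoin:
  fixes X :: "'s::polish_space set"
  assumes X: "X \<in> sets borel"
    and g: "(\<lambda>x. g (Some x)) \<in> borel_on X \<rightarrow>\<^sub>M M" and N: "g None \<in> space M"
  shows "g \<in> borel_on (adjoin X) \<rightarrow>\<^sub>M M"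
proof (rule measurableI)
  fix z assume "z \<in> space (borel_on (adjoin X))"
  then have "z = None \<or> z \<in> Some ` space (borel_on X)" by (simp add: space_restrict_space)
  then show "g z \<in> space M" using N measurable_space[OF g] by blast
next
  fix B assume B: "B \<in> sets M"
  let ?C = "(\<lambda>x. g (Some x)) -` B \<inter> X"
  have "?C \<in> sets (borel_on X)"
    using measurable_sets[OF g B] by (simp add: space_restrict_space)
  then have "?C \<in> sets borel" using X by (simp add: sets_restrict_space_iff)
  then have "Some ` ?C \<in> sets borel" by (rule Some_image_borel)
  then have "Some ` ?C \<union> (if g None \<in> B then {None} else {}) \<in> sets borel" by auto
  moreover have "g -` B \<inter> adjoin X = Some ` ?C \<union> (if g None \<in> B then {None} else {})" by auto
  moreover have "adjoin X \<in> sets borel" by (rule sets.insert_in_sets[OF _ Some_image_borel[OF X]]) simp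
  ultimately show "g -` B \<inter> space (borel_on (adjoin X)) \<in> sets (borel_on (adjoin X))"
    by (auto simp: space_restrict_space sets_restrict_space_iff)
qed

lemma Some_measurable: "Some \<in> borel_on X \<rightarrow>\<^sub>M borel_on (adjoin X)" for X :: "'s::metric_space set"
  by (intro measurable_restrict_space3 borel_measurable_continuous_onI)
    (auto simp: continuous_on_open_vimage open_option_iff)

lemma continuous_on_Some: "continuous_on S (Some :: 'b::metric_space \<Rightarrow> 'b option)"
proof (rule continuous_on_subset[of UNIV])
  show "continuous_on UNIV (Some :: 'b \<Rightarrow> 'b option)"
    by (simp add: continuous_on_open_vimage open_option_iff)
qed simp

lemma compact_valued_hv_actions:
  fixes A :: "'s \<Rightarrow> 'b::metric_space set"
  assumes "compact_valued X A" shows "compact_valued (adjoin X) (hv_actions A)"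
  unfolding compact_valued_def
proof
  fix s assume s: "s \<in> adjoin X"
  show "compact (hv_actions A s)"
  proof (cases s)
    case (Some x)
    then have "compact (A x)" using s assms by (auto simp: compact_valued_def)
    then show ?thesis using Some by (simp add: hv_actions_def compact_continuous_image[OF continuous_on_Some])
  qed (simp add: hv_actions_def)
qed

text \<open>\<open>None\<close> may be added to or left out of an open set freely, whence the term
  \<open>W \<inter> {None}\<close> in the witness.\<close>

lemma openin_adjoin:
  fixes W :: "'s::metric_space option set"
  assumes "W \<subseteq> adjoin X" "openin (top_of_set X) (Some -` W)"
  shows "openin (top_of_set (adjoin X)) W"
proof -
  obtain T where T: "open T" "Some -` W = X \<inter> T" using assms(2) by (auto simp: openin_open)
  have "open (Some ` T \<union> (W \<inter> {None}))"
  proof -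
    have "Some -` (Some ` T \<union> (W \<inter> {None})) = T" by auto
    then show ?thesis using T(1) by (simp only: open_option_iff)
  qed
  moreover have "W = adjoin X \<inter> (Some ` T \<union> (W \<inter> {None}))"
    using assms(1) T(2) by (auto simp: set_eq_iff split: option.splits)
  ultimately show ?thesis unfolding openin_open by blast
qed

lemma continuous_set_map_hv_actions:
  fixes A :: "'s::metric_space \<Rightarrow> 'b::metric_space set"
  assumes A: "continuous_set_map X Act A" "\<And>x. x \<in> X \<Longrightarrow> A x \<subseteq> Act"
  shows "continuous_set_map (adjoin X) (adjoin Act) (hv_actions A)"
  unfolding continuous_set_map_def
proof (intro allI impI conjI)
  fix U assume "openin (top_of_set (adjoin Act)) U"
  then obtain T where T: "open T" "U = adjoin Act \<inter> T" by (auto simp: openin_open)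
  then have "openin (top_of_set Act) (Act \<inter> Some -` T)" by (auto simp: open_option_iff openin_open)
  then have o: "openin (top_of_set X) {x\<in>X. A x \<subseteq> Act \<inter> Some -` T}"
    "openin (top_of_set X) {x\<in>X. A x \<inter> (Act \<inter> Some -` T) \<noteq> {}}"
    using A(1) by (auto simp: continuous_set_map_def)
  have "Some -` {s\<in>adjoin X. hv_actions A s \<subseteq> U} = {x\<in>X. A x \<subseteq> Act \<inter> Some -` T}"
    using A(2) T by (auto simp: hv_actions_def)
  then show "openin (top_of_set (adjoin X)) {s\<in>adjoin X. hv_actions A s \<subseteq> U}"
    using o by (intro openin_adjoin) auto
  have "Some -` {s\<in>adjoin X. hv_actions A s \<inter> U \<noteq> {}} = {x\<in>X. A x \<inter> (Act \<inter> Some -` T) \<noteq> {}}"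
    using A(2) T by (auto simp: hv_actions_def)
  then show "openin (top_of_set (adjoin X)) {s\<in>adjoin X. hv_actions A s \<inter> U \<noteq> {}}"
    using o by (intro openin_adjoin) auto
qed

section \<open>Correspondence of stationary policies in the two models\<close>

lemma map_option_stationary:
  fixes X :: "'s::polish_space set" and Act :: "'b::polish_space set"
  assumes X: "X \<in> sets borel" and \<phi>: "\<phi> \<in> stationary_policies X Act A"
  shows "map_option \<phi> \<in> stationary_policies (adjoin X) (adjoin Act) (hv_actions A)"
proof -
  have "map_option \<phi> \<in> borel_on (adjoin X) \<rightarrow>\<^sub>M borel_on (adjoin Act)"
    using \<phi> measurable_compose[OF _ Some_measurable, of \<phi>]
    by (intro measurable_adjoin[OF X]) (auto simp: stationary_policies_def space_restrict_space)
  then show ?thesis using \<phi> by (auto simp: stationary_policies_def hv_actions_def)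
qed

lemma stationary_policies_hv_restrict:
  fixes X :: "'s::polish_space set" and Act :: "'b::polish_space set"
  assumes A: "\<And>x. x \<in> X \<Longrightarrow> A x \<subseteq> Act"
    and \<psi>: "\<psi> \<in> stationary_policies (adjoin X) (adjoin Act) (hv_actions A)"
  obtains \<phi> where "\<phi> \<in> stationary_policies X Act A" "\<And>s. s \<in> adjoin X \<Longrightarrow> \<psi> s = map_option \<phi> s"
proof -
  \<comment> \<open>On \<open>X\<close> the unwrapping is sound, since at \<open>Some x\<close> the
    policy chooses from the copy of \<open>A x\<close> and so never returns
    \<open>None\<close>.\<close>
  define \<phi> where "\<phi> x = the (\<psi> (Some x))" for x
  have \<psi>A: "\<psi> s \<in> hv_actions A s" if "s \<in> adjoin X" for s using \<psi> that by (auto simp: stationary_policies_def)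
  have \<phi>A: "\<phi> x \<in> A x \<and> \<psi> (Some x) = Some (\<phi> x)" if "x \<in> X" for x
    using \<psi>A[of "Some x"] that by (auto simp: \<phi>_def hv_actions_def)
  have "(\<lambda>x. \<psi> (Some x)) \<in> borel_on X \<rightarrow>\<^sub>M borel_on (adjoin Act)"
    using \<psi> by (intro measurable_compose[OF Some_measurable]) (simp add: stationary_policies_def)
  then have "(\<lambda>x. \<psi> (Some x)) \<in> borel_on X \<rightarrow>\<^sub>M borel" by (simp add: measurable_restrict_space2_iff)
  from measurable_compose[OF this borel_measurable_continuous_onI[OF continuous_on_the]]
  have "\<phi> \<in> borel_measurable (borel_on X)" by (simp add: \<phi>_def[abs_def])
  moreover have "\<phi> x \<in> Act" if "x \<in> X" for x using \<phi>A[OF that] A[OF that] by blast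
  ultimately have "\<phi> \<in> stationary_policies X Act A"
    using \<phi>A by (auto simp: stationary_policies_def space_restrict_space intro!: measurable_restrict_space2)
  moreover have "\<psi> s = map_option \<phi> s" if "s \<in> adjoin X" for s
    using that \<phi>A \<psi>A[of None] by (auto simp: hv_actions_def)
  ultimately show ?thesis using that by blast
qed

text \<open>The measures may have mass above one and so need not lie in
  \<open>subprob_algebra\<close>. Measurability of the integral is therefore built up from
  indicators, where it is part of the definition of a kernel.\<close>

lemma nn_integral_kernel_measurable:
  assumes k: "transition_kernel S T \<kappa>" and f: "f \<in> borel_measurable (borel_on T)"
  shows "(\<lambda>s. \<integral>\<^sup>+y. f y \<partial>\<kappa> s) \<in> borel_measurable (borel_on S)"
proof -
  have sets: "sets (\<kappa> s) = sets (borel_on T)" and fin: "finite_measure (\<kappa> s)" if "s \<in> space (borel_on S)" for s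
    using k that by (auto simp: transition_kernel_def space_restrict_space)
  note m = measurable_cong_sets[OF sets refl, of _ borel]
  from f show ?thesis
  proof induction
    case (cong f g)
    have "(\<integral>\<^sup>+y. f y \<partial>\<kappa> s) = (\<integral>\<^sup>+y. g y \<partial>\<kappa> s)" if "s \<in> space (borel_on S)" for s
      using cong(3) sets_eq_imp_space_eq[OF sets[OF that]] by (intro nn_integral_cong) auto
    then show ?case using cong(4) by (simp cong: measurable_cong)
  next
    case (set B)
    have "(\<lambda>s. ennreal (measure (\<kappa> s) B)) \<in> borel_measurable (borel_on S)"
      using k set by (auto simp: transition_kernel_def)
    moreover have "(\<integral>\<^sup>+y. indicator B y \<partial>\<kappa> s) = ennreal (measure (\<kappa> s) B)" if "s \<in> space (borel_on S)" for s
      using set sets[OF that] finite_measure.emeasure_eq_measure[OF fin[OF that]] by simp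
    ultimately show ?case by (simp cong: measurable_cong)
  next
    case (mult u c)
    have "(\<integral>\<^sup>+y. c * u y \<partial>\<kappa> s) = c * (\<integral>\<^sup>+y. u y \<partial>\<kappa> s)" if "s \<in> space (borel_on S)" for s
      using mult m[OF that] by (intro nn_integral_cmult) auto
    then show ?case using mult by (simp cong: measurable_cong)
  next
    case (add u v)
    have "(\<integral>\<^sup>+y. v y + u y \<partial>\<kappa> s) = (\<integral>\<^sup>+y. v y \<partial>\<kappa> s) + (\<integral>\<^sup>+y. u y \<partial>\<kappa> s)" if "s \<in> space (borel_on S)" for s
      using add m[OF that] by (intro nn_integral_add) auto
    then show ?case using add by (simp cong: measurable_cong)
  next
    case (seq U)
    have "(\<integral>\<^sup>+y. (SUP i. U i) y \<partial>\<kappa> s) = (SUP i. \<integral>\<^sup>+y. U i y \<partial>\<kappa> s)" if "s \<in> space (borel_on S)" for s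
    proof -
      have "(\<integral>\<^sup>+y. (SUP i. U i y) \<partial>\<kappa> s) = (SUP i. \<integral>\<^sup>+y. U i y \<partial>\<kappa> s)"
        using seq m[OF that] by (intro nn_integral_monotone_convergence_SUP) auto
      then show ?thesis by (simp add: image_comp)
    qed
    then show ?case using seq by (simp cong: measurable_cong)
  qed
qed

section \<open>The transformed kernel\<close>

locale hv_model =
  fixes X :: "'s::polish_space set" and Act :: "'b::polish_space set" and A :: "'s \<Rightarrow> 'b set"
    and c :: "'s \<times> 'b \<Rightarrow> real" and q :: "'s \<times> 'b \<Rightarrow> 's measure" and l :: 's
    and K :: real and \<mu> :: "'s \<Rightarrow> real" and \<beta> :: real
  assumes model: "mdp X Act A c q"
    and l_mem: "l \<in> X" and l_isolated: "isolated_from l X"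
    and q_continuous: "weakly_continuous (Sigma X A) X q"
    and weight: "hv_weight X A q l K \<mu>"
    and discount: "(K - 1) / K \<le> \<beta>" "0 < \<beta>"
begin

lemma X_borel: "X \<in> sets borel"
  and A_subset: "x \<in> X \<Longrightarrow> A x \<subseteq> Act"
  and A_nonempty: "x \<in> X \<Longrightarrow> A x \<noteq> {}"
  and graph_borel: "Sigma X A \<in> sets borel"
  and c_measurable: "c \<in> borel_measurable (borel_on (Sigma X A))"
  and q_kernel: "transition_kernel (Sigma X A) X q"
  using model by (auto simp: mdp_def)

lemma mu_continuous: "continuous_on X \<mu>"
  and mu_ge: "x \<in> X \<Longrightarrow> 1 \<le> \<mu> x" and mu_le: "x \<in> X \<Longrightarrow> \<mu> x \<le> K"
  using weight by (auto simp: hv_weight_def)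

lemma q_finite: "z \<in> Sigma X A \<Longrightarrow> finite_measure (q z)"
  and q_sets: "z \<in> Sigma X A \<Longrightarrow> sets (q z) = sets (borel_on X)"
  using q_kernel by (auto simp: transition_kernel_def)

lemma q_space: "z \<in> Sigma X A \<Longrightarrow> space (q z) = X"
  by (rule space_borel_on[OF q_sets])

text \<open>Turns integrals of \<open>\<mu>\<close> over \<open>X - {l}\<close> into integrals over
  all of \<open>X\<close>, to which weak continuity of \<open>q\<close> applies.\<close>

definition wt :: "'s \<Rightarrow> real" where
  "wt y = (if y = l then 0 else \<mu> y)"

lemma wt_continuous: "continuous_on X wt"
proof -
  obtain e where e: "e > 0" "\<And>x. x \<in> X \<Longrightarrow> x \<noteq> l \<Longrightarrow> dist l x > e"
    using l_isolated by (auto simp: isolated_from_def)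
  have "continuous_on X (\<lambda>y. if y = l then 0 else 1 :: real)"
    unfolding continuous_on_iff
  proof (intro ballI allI impI)
    fix x \<epsilon> assume x: "x \<in> X" and "(0::real) < \<epsilon>"
    \<comment> \<open>The isolation radius works at every point: the indicator of the complement of
      \<open>l\<close> is constant on \<open>X\<close> within distance \<open>e\<close> of
      \<open>x\<close>.\<close>
    have "(y = l) = (x = l)" if "y \<in> X" "dist y x < e" for y
      using e(2)[OF x] e(2)[OF that(1)] that(2) by (metis dist_commute order.asym)
    then show "\<exists>d>0. \<forall>y\<in>X. dist y x < d \<longrightarrow> dist (if y = l then 0 else 1) (if x = l then 0 else 1 :: real) < \<epsilon>"
      using e(1) \<open>0 < \<epsilon>\<close> by (intro exI[of _ e]) auto
  qed
  from continuous_on_mult[OF this mu_continuous] show ?thesis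
    by (rule continuous_on_cong[THEN iffD1, rotated 2]) (auto simp: wt_def)
qed

lemma wt_bounds: "y \<in> X \<Longrightarrow> 0 \<le> wt y \<and> wt y \<le> K"
  using mu_ge[of y] mu_le[of y] by (auto simp: wt_def)

lemma K_pos: "0 < K" using mu_ge[OF l_mem] mu_le[OF l_mem] by linarith

lemma wt_integral_continuous:
  assumes g: "continuous_on X g" and b: "\<And>y. y \<in> X \<Longrightarrow> \<bar>g y\<bar> \<le> C"
  shows "continuous_on (Sigma X A) (\<lambda>z. \<integral>y. wt y * g y \<partial>q z)"
proof -
  have "bounded ((\<lambda>y. wt y * g y) ` X)"
  proof (rule boundedI)
    fix r assume "r \<in> (\<lambda>y. wt y * g y) ` X"
    then obtain y where y: "y \<in> X" "r = wt y * g y" by auto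
    then show "norm r \<le> K * C" using wt_bounds[OF y(1)] b[OF y(1)] K_pos
      by (auto simp: abs_mult intro!: mult_mono)
  qed
  then show ?thesis
    using q_continuous continuous_on_mult[OF wt_continuous g] by (auto simp: weakly_continuous_def)
qed

lemma wt_integrable:
  assumes z: "z \<in> Sigma X A" and g: "continuous_on X g" and b: "\<And>y. y \<in> X \<Longrightarrow> \<bar>g y\<bar> \<le> C"
  shows "integrable (q z) (\<lambda>y. wt y * g y)"
proof -
  interpret finite_measure "q z" by (rule q_finite[OF z])
  show ?thesis
  proof (rule integrable_const_bound[of _ "K * C"])
    show "AE y in q z. norm (wt y * g y) \<le> K * C"
      using wt_bounds b K_pos by (intro AE_I2) (auto simp: q_space[OF z] abs_mult intro!: mult_mono)
    show "(\<lambda>y. wt y * g y) \<in> borel_measurable (q z)"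
      by (rule continuous_on_borel_measurable_kernel[OF q_sets[OF z] continuous_on_mult[OF wt_continuous g]])
  qed
qed

definition mass :: "'s \<times> 'b \<Rightarrow> real" where
  "mass z = (\<integral>y. wt y \<partial>q z)"

lemma mass_eq: "z \<in> Sigma X A \<Longrightarrow> (LINT y:X - {l}|q z. \<mu> y) = mass z"
  unfolding mass_def set_lebesgue_integral_def
  by (intro Bochner_Integration.integral_cong) (auto simp: q_space wt_def indicator_def)

lemma mass_continuous: "continuous_on (Sigma X A) mass"
  using wt_integral_continuous[of "\<lambda>_. 1" 1] by (simp add: mass_def[abs_def])

lemma mass_nonneg: "z \<in> Sigma X A \<Longrightarrow> 0 \<le> mass z"
  unfolding mass_def using wt_bounds q_space by (intro Bochner_Integration.integral_nonneg) auto

lemma mass_le: "(x, a) \<in> Sigma X A \<Longrightarrow> mass (x, a) \<le> \<mu> x - 1"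
  using weight mass_eq[of "(x, a)"] by (force simp: hv_weight_def)

lemma scale_pos: "x \<in> X \<Longrightarrow> 0 < \<beta> * \<mu> x"
  using discount(2) mu_ge[of x] by simp

text \<open>Since \<open>\<mu> x \<le> K\<close>, the ratio \<open>(\<mu> x - 1) / \<mu> x\<close>
  is at most \<open>(K - 1) / K\<close>, hence at most \<open>\<beta>\<close>; this is the origin of
  the lower bound on the discount factor.\<close>

lemma absorb_nonneg:
  assumes x: "x \<in> X" shows "0 \<le> 1 - (\<mu> x - 1) / (\<beta> * \<mu> x)"
proof -
  have "\<mu> x * (K - 1) \<le> \<mu> x * (\<beta> * K)"
    using discount(1) K_pos mu_ge[OF x] by (intro mult_left_mono) (auto simp: field_simps)
  moreover have "(\<mu> x - 1) * K \<le> \<mu> x * (K - 1)" using mu_le[OF x] by (simp add: algebra_simps)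
  ultimately have "(\<mu> x - 1) * K \<le> (\<beta> * \<mu> x) * K" by (simp add: mult_ac)
  then have "\<mu> x - 1 \<le> \<beta> * \<mu> x" using K_pos by simp
  then show ?thesis using scale_pos[OF x] by simp
qed

abbreviation "XX \<equiv> adjoin X"
abbreviation "AA \<equiv> hv_actions A"
abbreviation "pp \<equiv> hv_kernel X q l \<mu> \<beta>"

lemma pp_None: "pp (None, None) = return (borel_on XX) None" by (simp add: hv_kernel_def)

lemma sets_pp: "sets (pp z) = sets (borel_on XX)"
proof -
  have "sets (measure_of XX (sets (borel_on XX)) f) = sets (borel_on XX)" for f
    using sets.sigma_sets_eq[of "borel_on XX"] sets.space_closed[of "borel_on XX"]
    by (simp add: sets_measure_of_conv space_restrict_space)
  then show ?thesis by (auto simp: hv_kernel_def split: prod.splits option.splits)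
qed

lemma space_pp: "space (pp z) = XX" by (rule space_borel_on[OF sets_pp])

lemma nn_integral_weight:
  assumes z: "z \<in> Sigma X A"
  shows "(\<integral>\<^sup>+y\<in>{y\<in>X - {l}. Some y \<in> B}. ennreal (\<mu> y) \<partial>q z) = (\<integral>\<^sup>+y. ennreal (wt y) * indicator B (Some y) \<partial>q z)"
  by (intro nn_integral_cong) (auto simp: q_space[OF z] wt_def indicator_def)

lemma emeasure_pp:
  assumes z: "(x, a) \<in> Sigma X A" and B: "B \<in> sets (borel_on XX)"
  shows "emeasure (pp (Some x, Some a)) B =
      ennreal (1 / (\<beta> * \<mu> x)) * (\<integral>\<^sup>+y. ennreal (wt y) * indicator B (Some y) \<partial>q (x, a))
    + ennreal (1 / (\<beta> * \<mu> x) * (\<mu> x - 1 - mass (x, a))) * indicator B (Some l)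
    + ennreal (1 - (\<mu> x - 1) / (\<beta> * \<mu> x)) * indicator B None"
  unfolding emeasure_hv_kernel[where q=q and x=x and a=a, OF q_sets[OF z] X_borel mu_continuous B]
  by (simp only: nn_integral_weight[OF z] mass_eq[OF z])

text \<open>The formula for the measure of a set is linear in its indicator, so it extends to
  nonnegative functions by the usual induction. It displays the kernel as the image of a measure
  with density, plus atoms at \<open>Some l\<close> and \<open>None\<close>.\<close>

lemma nn_integral_pp:
  assumes z: "(x, a) \<in> Sigma X A" and f: "f \<in> borel_measurable (borel_on XX)"
  shows "(\<integral>\<^sup>+y. f y \<partial>pp (Some x, Some a)) =
      ennreal (1 / (\<beta> * \<mu> x)) * (\<integral>\<^sup>+y. ennreal (wt y) * f (Some y) \<partial>q (x, a))
    + ennreal (1 / (\<beta> * \<mu> x) * (\<mu> x - 1 - mass (x, a))) * f (Some l)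
    + ennreal (1 - (\<mu> x - 1) / (\<beta> * \<mu> x)) * f None"
  using f
proof induction
  let ?M = "pp (Some x, Some a)"
  have wt_m: "(\<lambda>y. ennreal (wt y)) \<in> borel_measurable (q (x, a))"
    using continuous_on_borel_measurable_kernel[OF q_sets[OF z] wt_continuous] by measurable
  have some: "Some \<in> q (x, a) \<rightarrow>\<^sub>M borel_on XX"
    using Some_measurable measurable_cong_sets[OF q_sets[OF z] refl] by blast
  have comp: "(\<lambda>y. g (Some y)) \<in> borel_measurable (q (x, a))" if "g \<in> borel_measurable (borel_on XX)" for g :: "'s option \<Rightarrow> ennreal"
    by (rule measurable_compose[OF some that])
  note m = measurable_cong_sets[OF sets_pp[of "(Some x, Some a)"] refl, of borel]
  {
    case (cong f g)
    have eq: "f y = g y" if "y \<in> XX" for y using cong(3) that by (simp add: space_restrict_space)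
    have "(\<integral>\<^sup>+y. f y \<partial>?M) = (\<integral>\<^sup>+y. g y \<partial>?M)"
      by (intro nn_integral_cong eq) (simp add: space_pp)
    moreover have "(\<integral>\<^sup>+y. ennreal (wt y) * f (Some y) \<partial>q (x, a)) = (\<integral>\<^sup>+y. ennreal (wt y) * g (Some y) \<partial>q (x, a))"
      using eq by (intro nn_integral_cong) (simp add: q_space[OF z])
    ultimately show ?case using cong(4) eq l_mem by simp
  next
    case (set B)
    then show ?case using emeasure_pp[OF z set] by (simp add: sets_pp)
  next
    case (mult u k)
    have "(\<integral>\<^sup>+y. k * u y \<partial>?M) = k * (\<integral>\<^sup>+y. u y \<partial>?M)"
      using mult m by (intro nn_integral_cmult) auto
    moreover have "(\<integral>\<^sup>+y. ennreal (wt y) * (k * u (Some y)) \<partial>q (x, a)) = k * (\<integral>\<^sup>+y. ennreal (wt y) * u (Some y) \<partial>q (x, a))"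
      using wt_m comp[OF mult(2)] by (subst nn_integral_cmult[symmetric]) (auto simp: mult_ac)
    ultimately show ?case using mult by (simp add: distrib_left mult_ac)
  next
    case (add u v)
    have "(\<integral>\<^sup>+y. v y + u y \<partial>?M) = (\<integral>\<^sup>+y. v y \<partial>?M) + (\<integral>\<^sup>+y. u y \<partial>?M)"
      using add m by (intro nn_integral_add) auto
    moreover have "(\<integral>\<^sup>+y. ennreal (wt y) * (v (Some y) + u (Some y)) \<partial>q (x, a)) =
        (\<integral>\<^sup>+y. ennreal (wt y) * v (Some y) \<partial>q (x, a)) + (\<integral>\<^sup>+y. ennreal (wt y) * u (Some y) \<partial>q (x, a))"
      using wt_m comp[OF add(1)] comp[OF add(3)]
      by (subst nn_integral_add[symmetric]) (auto simp: distrib_left)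
    ultimately show ?case using add by (simp add: distrib_left add_ac)
  next
    case (seq U)
    have "(\<integral>\<^sup>+y. (SUP i. U i y) \<partial>?M) = (SUP i. \<integral>\<^sup>+y. U i y \<partial>?M)"
      using seq m by (intro nn_integral_monotone_convergence_SUP) auto
    moreover have "(\<integral>\<^sup>+y. ennreal (wt y) * (SUP i. U i (Some y)) \<partial>q (x, a)) =
        (SUP i. \<integral>\<^sup>+y. ennreal (wt y) * U i (Some y) \<partial>q (x, a))"
    proof -
      have "incseq (\<lambda>i y. ennreal (wt y) * U i (Some y))"
        using seq(3) by (auto simp: incseq_def le_fun_def intro!: mult_left_mono)
      moreover have "(\<lambda>y. ennreal (wt y) * U i (Some y)) \<in> borel_measurable (q (x, a))" for i
        using wt_m comp[OF seq(1)[of i]] by measurable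
      ultimately show ?thesis
        by (subst nn_integral_monotone_convergence_SUP[symmetric]) (auto simp: SUP_mult_left_ennreal)
    qed
    moreover have "incseq (\<lambda>i. k * (\<integral>\<^sup>+y. ennreal (wt y) * U i (Some y) \<partial>q (x, a)))" for k
      using seq(3) by (auto simp: incseq_def le_fun_def intro!: mult_left_mono nn_integral_mono)
    moreover have "incseq (\<lambda>i. k * U i s)" for k s
      using seq(3) by (auto simp: incseq_def le_fun_def intro!: mult_left_mono)
    moreover have "(SUP i. f i) + (SUP i. g i) + (SUP i. h i) = (SUP i. f i + g i + h i)"
      if "incseq f" "incseq g" "incseq h" for f g h :: "nat \<Rightarrow> ennreal"
    proof -
      have "incseq (\<lambda>i. f i + g i)" using that by (auto simp: incseq_def intro: add_mono)
      then show ?thesis using that by (simp add: ennreal_SUP_add[symmetric])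
    qed
    ultimately show ?case using seq(5)
      by (simp add: image_comp SUP_mult_left_ennreal)
  }
qed

text \<open>The atom at \<open>Some l\<close> is what the density part leaves of
  \<open>(\<mu> x - 1) / (\<beta> * \<mu> x)\<close>, and the atom at \<open>None\<close> is the
  complement of that ratio. Each summand is nonnegative, so the sum may be taken in the reals, where
  \<open>mass\<close> cancels.\<close>

lemma prob_space_pp:
  assumes z: "z \<in> Sigma XX AA"
  shows "prob_space (pp z)"
proof (cases "z = (None, None)")
  case True
  then show ?thesis unfolding True pp_None by (intro prob_space_return) (simp add: space_restrict_space)
next
  case False
  with z have "z \<in> map_prod Some Some ` Sigma X A" unfolding graph_hv_actions by simp
  then obtain w where w: "w \<in> Sigma X A" "z = map_prod Some Some w" by (rule imageE) simp
  obtain x a where xa: "w = (x, a)" by (cases w)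
  have g: "(x, a) \<in> Sigma X A" and x: "x \<in> X" using w xa by auto
  have "integrable (q (x, a)) wt" using wt_integrable[OF g, of "\<lambda>_. 1" 1] by simp
  then have m: "(\<integral>\<^sup>+y. ennreal (wt y) \<partial>q (x, a)) = ennreal (mass (x, a))"
    unfolding mass_def using wt_bounds by (intro nn_integral_eq_integral) (auto simp: q_space[OF g] intro!: AE_I2)
  have "emeasure (pp z) XX = (\<integral>\<^sup>+y. 1 \<partial>pp (Some x, Some a))"
    using space_pp[of "(Some x, Some a)"] by (simp add: w xa)
  also have "\<dots> = ennreal (1 / (\<beta> * \<mu> x)) * ennreal (mass (x, a))
    + ennreal (1 / (\<beta> * \<mu> x) * (\<mu> x - 1 - mass (x, a))) + ennreal (1 - (\<mu> x - 1) / (\<beta> * \<mu> x))"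
    by (subst nn_integral_pp[OF g]) (simp_all add: m)
  also have "\<dots> = ennreal (1 / (\<beta> * \<mu> x) * mass (x, a) + 1 / (\<beta> * \<mu> x) * (\<mu> x - 1 - mass (x, a))
      + (1 - (\<mu> x - 1) / (\<beta> * \<mu> x)))"
  proof -
    have "0 \<le> 1 / (\<beta> * \<mu> x)" "0 \<le> 1 / (\<beta> * \<mu> x) * mass (x, a)" "0 \<le> 1 / (\<beta> * \<mu> x) * (\<mu> x - 1 - mass (x, a))"
      using scale_pos[OF x] mass_nonneg[OF g] mass_le[OF g] by auto
    then show ?thesis using absorb_nonneg[OF x] by (simp only: ennreal_plus ennreal_mult' add_nonneg_nonneg)
  qed
  also have "1 / (\<beta> * \<mu> x) * mass (x, a) + 1 / (\<beta> * \<mu> x) * (\<mu> x - 1 - mass (x, a))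
      + (1 - (\<mu> x - 1) / (\<beta> * \<mu> x)) = 1"
    by (simp add: add_divide_distrib[symmetric])
  finally show ?thesis by (intro prob_spaceI) (simp add: space_pp)
qed

section \<open>Means of bounded continuous functions under the transformed kernel\<close>

definition mean :: "('s option \<Rightarrow> real) \<Rightarrow> 's \<times> 'b \<Rightarrow> real" where
  "mean f z = 1 / (\<beta> * \<mu> (fst z)) *
      ((\<integral>y. wt y * f (Some y) \<partial>q z) + (\<mu> (fst z) - 1 - mass z) * f (Some l))
    + (1 - (\<mu> (fst z) - 1) / (\<beta> * \<mu> (fst z))) * f None"

lemma continuous_Some_comp: "continuous_on XX f \<Longrightarrow> continuous_on X (\<lambda>y. f (Some y))"
  by (rule continuous_on_compose2[OF _ continuous_on_Some]) auto

lemma integral_pp_nonneg: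
  assumes z: "(x, a) \<in> Sigma X A" and f: "continuous_on XX f" and b: "\<And>y. y \<in> XX \<Longrightarrow> 0 \<le> f y \<and> f y \<le> C"
  shows "(\<integral>y. f y \<partial>pp (Some x, Some a)) = mean f (x, a)"
proof -
  let ?M = "pp (Some x, Some a)"
  have x: "x \<in> X" using z by auto
  have fm: "f \<in> borel_measurable ?M" using sets_pp f by (rule continuous_on_borel_measurable_kernel)
  have fm': "(\<lambda>y. ennreal (f y)) \<in> borel_measurable (borel_on XX)"
    using borel_measurable_continuous_on_restrict[OF f] by measurable
  have fS: "continuous_on X (\<lambda>y. f (Some y))" by (rule continuous_Some_comp[OF f])
  have "integrable (q (x, a)) (\<lambda>y. wt y * f (Some y))"
    using b by (intro wt_integrable[OF z fS, of C]) auto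
  then have i: "(\<integral>\<^sup>+y. ennreal (wt y * f (Some y)) \<partial>q (x, a)) = ennreal (\<integral>y. wt y * f (Some y) \<partial>q (x, a))"
    using wt_bounds b by (intro nn_integral_eq_integral) (auto simp: q_space[OF z] intro!: AE_I2)
  have "(\<integral>\<^sup>+y. ennreal (wt y) * ennreal (f (Some y)) \<partial>q (x, a)) = (\<integral>\<^sup>+y. ennreal (wt y * f (Some y)) \<partial>q (x, a))"
    using wt_bounds by (intro nn_integral_cong) (auto simp: q_space[OF z] ennreal_mult')
  note i' = this[unfolded i]
  have i0: "0 \<le> (\<integral>y. wt y * f (Some y) \<partial>q (x, a))"
    using wt_bounds b by (intro Bochner_Integration.integral_nonneg) (auto simp: q_space[OF z])
  have f0: "0 \<le> f (Some l)" "0 \<le> f None" using b l_mem by auto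
  have "(\<integral>\<^sup>+y. ennreal (f y) \<partial>?M) = ennreal (1 / (\<beta> * \<mu> x)) * ennreal (\<integral>y. wt y * f (Some y) \<partial>q (x, a))
    + ennreal (1 / (\<beta> * \<mu> x) * (\<mu> x - 1 - mass (x, a))) * ennreal (f (Some l))
    + ennreal (1 - (\<mu> x - 1) / (\<beta> * \<mu> x)) * ennreal (f None)"
    by (simp add: nn_integral_pp[OF z fm'] i')
  also have "\<dots> = ennreal (1 / (\<beta> * \<mu> x) * (\<integral>y. wt y * f (Some y) \<partial>q (x, a))
    + (1 / (\<beta> * \<mu> x) * (\<mu> x - 1 - mass (x, a))) * f (Some l)
    + (1 - (\<mu> x - 1) / (\<beta> * \<mu> x)) * f None)" (is "_ = ennreal (?a + ?b + ?c)")
  proof -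
    have "0 \<le> ?a" "0 \<le> ?b" "0 \<le> ?c" "0 \<le> 1 / (\<beta> * \<mu> x)" "0 \<le> 1 / (\<beta> * \<mu> x) * (\<mu> x - 1 - mass (x, a))"
      using absorb_nonneg[OF x] scale_pos[OF x] mass_le[OF z] i0 f0 by auto
    then show ?thesis using absorb_nonneg[OF x] by (simp only: ennreal_plus ennreal_mult' add_nonneg_nonneg)
  qed
  also have "?a + ?b + ?c = mean f (x, a)" by (simp add: mean_def algebra_simps)
  finally have nn: "(\<integral>\<^sup>+y. ennreal (f y) \<partial>?M) = ennreal (mean f (x, a))" .
  have "0 \<le> mean f (x, a)"
    unfolding mean_def using absorb_nonneg[OF x] scale_pos[OF x] mass_le[OF z] i0 f0 by auto
  then show ?thesis
    using nn b fm by (subst integral_eq_nn_integral) (auto simp: space_pp intro!: AE_I2)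
qed

text \<open>Signs are removed by adding the bound \<open>C\<close>: the shifted function falls under
  the nonnegative case, and both sides gain exactly \<open>C\<close>, the left because the kernel is
  a probability and the right because \<open>mean\<close> maps constants to themselves.\<close>

lemma integral_pp:
  assumes z: "(x, a) \<in> Sigma X A" and f: "continuous_on XX f" and b: "\<And>y. y \<in> XX \<Longrightarrow> \<bar>f y\<bar> \<le> C"
  shows "(\<integral>y. f y \<partial>pp (Some x, Some a)) = mean f (x, a)"
proof -
  let ?M = "pp (Some x, Some a)"
  have x: "x \<in> X" using z by auto
  interpret prob_space ?M
    using z by (intro prob_space_pp) (auto simp: hv_actions_def)
  have "f \<in> borel_measurable ?M" using sets_pp f by (rule continuous_on_borel_measurable_kernel)
  then have int: "integrable ?M f"
    using b by (intro integrable_const_bound[of _ C]) (auto simp: space_pp intro!: AE_I2)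
  have "(\<integral>y. f y + C \<partial>?M) = mean (\<lambda>y. f y + C) (x, a)"
  proof (rule integral_pp_nonneg[OF z])
    show "continuous_on XX (\<lambda>y. f y + C)" using f by (intro continuous_intros)
    show "0 \<le> f y + C \<and> f y + C \<le> 2 * C" if "y \<in> XX" for y using b[OF that] by auto
  qed
  moreover have "(\<integral>y. f y + C \<partial>?M) = (\<integral>y. f y \<partial>?M) + C"
    using int by (simp add: prob_space)
  moreover have "mean (\<lambda>y. f y + C) (x, a) = mean f (x, a) + C"
  proof -
    have fS: "continuous_on X (\<lambda>y. f (Some y))" by (rule continuous_Some_comp[OF f])
    have "integrable (q (x, a)) (\<lambda>y. wt y * f (Some y))" using b by (intro wt_integrable[OF z fS, of C]) auto
    moreover have "integrable (q (x, a)) (\<lambda>y. wt y * C)"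
      by (rule wt_integrable[OF z, of "\<lambda>_. C" "\<bar>C\<bar>"]) auto
    ultimately have "(\<integral>y. wt y * (f (Some y) + C) \<partial>q (x, a)) = (\<integral>y. wt y * f (Some y) \<partial>q (x, a)) + mass (x, a) * C"
      by (simp add: distrib_left mass_def)
    \<comment> \<open>With \<open>k = 1 / (\<beta> * \<mu> x)\<close>,
      \<open>u = \<mu> x - 1\<close> and \<open>m\<close> the mass, the identity says that the three
      weights add up to one.\<close>
    moreover have "k * ((i + m * C) + (u - m) * (s + C)) + (1 - u * k) * (t + C) =
        k * (i + (u - m) * s) + (1 - u * k) * t + C" for k i m u s t :: real
      by (simp add: algebra_simps)
    note this[of "1 / (\<beta> * \<mu> x)" "\<integral>y. wt y * f (Some y) \<partial>q (x, a)" "mass (x, a)" "\<mu> x - 1" "f (Some l)" "f None"]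
    ultimately show ?thesis by (simp add: mean_def)
  qed
  ultimately show ?thesis by simp
qed

lemma mu_fst_continuous: "continuous_on (Sigma X A) (\<lambda>z. \<mu> (fst z))"
  by (rule continuous_on_compose2[OF mu_continuous]) (auto intro: continuous_on_fst continuous_on_id)

lemma mu_fst_nonzero: "z \<in> Sigma X A \<Longrightarrow> \<mu> (fst z) \<noteq> 0"
  using mu_ge[of "fst z"] by auto

lemma weakly_continuous_pp: "weakly_continuous (Sigma XX AA) XX pp"
  unfolding weakly_continuous_def
proof (intro allI impI)
  fix f :: "'s option \<Rightarrow> real" assume f: "continuous_on XX f" and "bounded (f ` XX)"
  then obtain C where C: "\<And>y. y \<in> XX \<Longrightarrow> \<bar>f y\<bar> \<le> C" by (auto simp: bounded_iff)
  have "continuous_on (Sigma X A) (\<lambda>z. \<integral>y. wt y * f (Some y) \<partial>q z)"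
    using C by (intro wt_integral_continuous[of _ C] continuous_Some_comp[OF f]) auto
  then have "continuous_on (Sigma X A) (mean f)"
    unfolding mean_def[abs_def] using mu_fst_continuous mass_continuous mu_fst_nonzero discount(2)
    by (intro continuous_intros) auto
  then have "continuous_on (Sigma X A) (\<lambda>z. \<integral>y. f y \<partial>pp (map_prod Some Some z))"
    by (rule continuous_on_cong[THEN iffD1, rotated 2]) (auto intro!: integral_pp[OF _ f C, symmetric])
  then show "continuous_on (Sigma XX AA) (\<lambda>s. \<integral>y. f y \<partial>pp s)" by (rule continuous_on_graph_hv)
qed

text \<open>Measurability at a set \<open>B\<close> is read off the explicit formula for its measure
  on the copy of the old graph; adding one point to the domain preserves it.\<close>

lemma transition_kernel_pp: "transition_kernel (Sigma XX AA) XX pp"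
  unfolding transition_kernel_def
proof (intro conjI ballI)
  show "finite_measure (pp s)" if "s \<in> Sigma XX AA" for s
    using prob_space_pp[OF that] by (rule prob_space.finite_measure)
  show "sets (pp s) = sets (borel_on XX)" for s by (rule sets_pp)
  fix B assume B: "B \<in> sets (borel_on XX)"
  show "(\<lambda>s. measure (pp s) B) \<in> borel_measurable (borel_on (Sigma XX AA))"
  proof (rule measurable_graph_hv[OF graph_borel])
    have [measurable]: "(\<lambda>z. \<mu> (fst z)) \<in> borel_measurable (borel_on (Sigma X A))"
      "mass \<in> borel_measurable (borel_on (Sigma X A))"
      by (intro borel_measurable_continuous_on_restrict mu_fst_continuous mass_continuous)+
    have "(\<lambda>y. ennreal (wt y)) \<in> borel_measurable (borel_on X)"
      using borel_measurable_continuous_on_restrict[OF wt_continuous] by measurable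
    moreover have "(\<lambda>y. indicator B (Some y) :: ennreal) \<in> borel_measurable (borel_on X)"
      using B by (intro measurable_compose[OF Some_measurable] borel_measurable_indicator)
    ultimately have "(\<lambda>y. ennreal (wt y) * indicator B (Some y)) \<in> borel_measurable (borel_on X)" by measurable
    note [measurable] = nn_integral_kernel_measurable[OF q_kernel this]
    have "(\<lambda>z. enn2real (ennreal (1 / (\<beta> * \<mu> (fst z))) * (\<integral>\<^sup>+y. ennreal (wt y) * indicator B (Some y) \<partial>q z)
      + ennreal (1 / (\<beta> * \<mu> (fst z)) * (\<mu> (fst z) - 1 - mass z)) * indicator B (Some l)
      + ennreal (1 - (\<mu> (fst z) - 1) / (\<beta> * \<mu> (fst z))) * indicator B None)) \<in> borel_measurable (borel_on (Sigma X A))"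
      by measurable
    then show "(\<lambda>z. measure (pp (map_prod Some Some z)) B) \<in> borel_measurable (borel_on (Sigma X A))"
      by (rule measurable_cong[THEN iffD1, rotated])
        (auto simp: measure_def space_restrict_space emeasure_pp[OF _ B])
  qed simp
qed

lemma transition_prob_kernel_pp: "transition_prob_kernel (Sigma XX AA) XX pp"
  unfolding transition_prob_kernel_def using transition_kernel_pp prob_space_pp by blast

lemma hv_cost_measurable: "hv_cost c \<mu> \<in> borel_measurable (borel_on (Sigma XX AA))"
proof (rule measurable_graph_hv[OF graph_borel])
  have [measurable]: "(\<lambda>z. \<mu> (fst z)) \<in> borel_measurable (borel_on (Sigma X A))"
    by (intro borel_measurable_continuous_on_restrict mu_fst_continuous)
  note [measurable] = c_measurable
  have "(\<lambda>z. c z / \<mu> (fst z)) \<in> borel_measurable (borel_on (Sigma X A))" by measurable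
  then show "(\<lambda>z. hv_cost c \<mu> (map_prod Some Some z)) \<in> borel_measurable (borel_on (Sigma X A))"
    by (simp add: hv_cost_def map_prod_def case_prod_beta')
qed simp

lemma hv_cost_lsc:
  assumes c: "lower_semicontinuous_on (Sigma X A) c"
  shows "lower_semicontinuous_on (Sigma XX AA) (hv_cost c \<mu>)"
  unfolding lower_semicontinuous_on_def
proof (intro ballI allI impI)
  fix z r assume z: "z \<in> Sigma XX AA" and r: "r < hv_cost c \<mu> z"
  show "eventually (\<lambda>t. r < hv_cost c \<mu> t) (at z within Sigma XX AA)"
  proof (cases "z = (None, None)")
    case True
    then show ?thesis unfolding eventually_at_topological
      using open_None_None by (intro exI[of _ "{(None, None)}"]) auto
  next
    case False
    with z have "z \<in> map_prod Some Some ` Sigma X A" unfolding graph_hv_actions by simp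
    then obtain w where w: "w \<in> Sigma X A" "z = map_prod Some Some w" by (rule imageE) simp
    have pos: "0 < \<mu> (fst t)" if "t \<in> Sigma X A" for t using that mu_ge[of "fst t"] by auto
    have cost: "hv_cost c \<mu> (map_prod Some Some t) = c t / \<mu> (fst t)" for t by (cases t) (simp add: hv_cost_def)
    \<comment> \<open>Clearing the denominator replaces division by a comparison of
      \<open>r * \<mu>\<close> with \<open>c\<close>. A level \<open>s\<close> strictly between them
      lets continuity of \<open>\<mu>\<close> and semicontinuity of \<open>c\<close> act separately,
      for \<open>r\<close> of either sign.\<close>
    have "r * \<mu> (fst w) < c w" using r w pos[OF w(1)] by (simp add: cost field_simps)
    then obtain s where s: "r * \<mu> (fst w) < s" "s < c w" using dense by blast
    have "eventually (\<lambda>t. s < c t) (at w within Sigma X A)"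
      using c w s by (auto simp: lower_semicontinuous_on_def)
    moreover have "((\<lambda>t. r * \<mu> (fst t)) \<longlongrightarrow> r * \<mu> (fst w)) (at w within Sigma X A)"
      using mu_fst_continuous w(1) by (intro tendsto_intros) (auto simp: continuous_on_def)
    then have "eventually (\<lambda>t. r * \<mu> (fst t) < s) (at w within Sigma X A)"
      using s(1) by (rule order_tendstoD)
    ultimately have "eventually (\<lambda>t. r * \<mu> (fst t) < c t) (at w within Sigma X A)"
      by eventually_elim simp
    then obtain T where T: "open T" "w \<in> T" "\<And>t. t \<in> T \<Longrightarrow> t \<noteq> w \<Longrightarrow> t \<in> Sigma X A \<Longrightarrow> r * \<mu> (fst t) < c t"
      unfolding eventually_at_topological by metis
    have "r < hv_cost c \<mu> y" if y: "y \<in> map_prod Some Some ` T" "y \<noteq> z" "y \<in> Sigma XX AA" for y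
    proof -
      from y(1) obtain t where t: "t \<in> T" "y = map_prod Some Some t" by (rule imageE) simp
      then have "t \<in> Sigma X A" using y(3) by (cases t) (auto simp: hv_actions_def)
      then have "r * \<mu> (fst t) < c t" using T(3) t y(2) w(2) by auto
      then show ?thesis using pos[OF \<open>t \<in> Sigma X A\<close>] by (simp add: t cost field_simps)
    qed
    then show ?thesis unfolding eventually_at_topological
      using open_map_prod_Some[OF T(1)] T(2) w(2) by (intro exI[of _ "map_prod Some Some ` T"]) auto
  qed
qed

end

text \<open>Once value iteration is available for the transformed model, what remains is to remove
  the extra state \<open>None\<close> and the wrapper on actions from its optimality
  criterion.\<close>

theorem theorem6:
  fixes X :: "'x::polish_space set" and Act :: "'a::polish_space set"
    and A :: "'x \<Rightarrow> 'a set" and c :: "'x \<times> 'a \<Rightarrow> real" and q :: "'x \<times> 'a \<Rightarrow> 'x measure"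
    and l :: 'x and K :: real and \<mu> :: "'x \<Rightarrow> real" and \<beta> :: real
  assumes model: "mdp X Act A c q"
    and HT: "l \<in> X" "hitting_time_bound X Act A q l K" "isolated_from l X"
    and W_i: "compact_valued X A" "continuous_set_map X Act A"
    and W_ii: "weakly_continuous (Sigma X A) X q"
    and weight: "hv_weight X A q l K \<mu>"
    and discount: "(K - 1) / K \<le> \<beta>" "\<beta> < 1" "0 < \<beta>"
  shows
    "let XX = adjoin X; AAct = adjoin Act; AA = hv_actions A;
         cc = hv_cost c \<mu>; pp = hv_kernel X q l \<mu> \<beta>;
         v = value_function XX AAct AA cc pp \<beta>;
         optimal = (\<lambda>\<phi>. discount_optimal XX AAct AA cc pp \<beta> (stationary AAct (map_option \<phi>)));
         T = (\<lambda>x a. ennreal (cc (Some x, Some a))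
                + ennreal \<beta> * (\<integral>\<^sup>+y\<in>Some ` X. v y \<partial>pp (Some x, Some a)))
     in transition_prob_kernel (Sigma XX AA) XX pp \<and> weakly_continuous (Sigma XX AA) XX pp \<and>
        (lower_semicontinuous_on (Sigma X A) c \<longrightarrow>
          (\<exists>\<phi>\<in>stationary_policies X Act A. optimal \<phi>) \<and>
          (\<forall>\<phi>\<in>stationary_policies X Act A.
            optimal \<phi> \<longleftrightarrow>
            (\<forall>x\<in>X. v (Some x) = T x (\<phi> x) \<and> is_min_of (T x (\<phi> x)) (T x ` A x))))"
proof -
  interpret hv: hv_model X Act A c q l K \<mu> \<beta>
    using assms by unfold_locales
  define XX AAct AA cc pp where "XX = adjoin X" and "AAct = adjoin Act" and "AA = hv_actions A"
    and "cc = hv_cost c \<mu>" and "pp = hv_kernel X q l \<mu> \<beta>"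
  note defs = XX_def AAct_def AA_def cc_def pp_def
  define v where "v = value_function XX AAct AA cc pp \<beta>"
  define optimal where "optimal \<phi> = discount_optimal XX AAct AA cc pp \<beta> (stationary AAct (map_option \<phi>))" for \<phi>
  define T where "T x a = ennreal (cc (Some x, Some a))
                + ennreal \<beta> * (\<integral>\<^sup>+y\<in>Some ` X. v y \<partial>pp (Some x, Some a))" for x a
  have "transition_prob_kernel (Sigma XX AA) XX pp" "weakly_continuous (Sigma XX AA) XX pp"
    unfolding defs by (rule hv.transition_prob_kernel_pp hv.weakly_continuous_pp)+
  moreover have "(\<exists>\<phi>\<in>stationary_policies X Act A. optimal \<phi>) \<and>
          (\<forall>\<phi>\<in>stationary_policies X Act A.
            optimal \<phi> \<longleftrightarrow>
            (\<forall>x\<in>X. v (Some x) = T x (\<phi> x) \<and> is_min_of (T x (\<phi> x)) (T x ` A x)))"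
    if c: "lower_semicontinuous_on (Sigma X A) c"
  proof -
    interpret S: semicontinuous_mdp XX AAct AA cc pp \<beta>
    proof
      show "AA s \<subseteq> AAct" if "s \<in> XX" for s
        using that hv.A_subset[THEN subsetD] by (auto simp: defs hv_actions_def)
      show "AA s \<noteq> {}" if "s \<in> XX" for s
        using that hv.A_nonempty by (auto simp: defs hv_actions_def)
      show "Sigma XX AA \<in> sets borel" unfolding defs by (rule graph_hv_borel[OF hv.graph_borel])
      show "cc \<in> borel_measurable (borel_on (Sigma XX AA))" unfolding defs by (rule hv.hv_cost_measurable)
      show "transition_prob_kernel (Sigma XX AA) XX pp" by fact
      show "0 \<le> \<beta>" using discount by simp
      show "compact_valued XX AA" unfolding defs by (rule compact_valued_hv_actions[OF W_i(1)])
      show "continuous_set_map XX AAct AA" unfolding defs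
        by (rule continuous_set_map_hv_actions[OF W_i(2) hv.A_subset])
      show "weakly_continuous (Sigma XX AA) XX pp" by fact
      show "lower_semicontinuous_on (Sigma XX AA) cc" unfolding defs by (rule hv.hv_cost_lsc[OF c])
    qed
    have None: "None \<in> XX" "AA None = {None}" "(None, None) \<in> Sigma XX AA"
      by (auto simp: defs hv_actions_def)
    \<comment> \<open>The absorbing state pays nothing and is never left, so every value iterate
      vanishes there.\<close>
    have it: "S.iterate n None = 0" for n
    proof (induction n)
      case (Suc n)
      have "S.iterate n \<in> borel_measurable (borel_on XX)" by (rule lsc_on_measurable[OF S.iterate_lsc])
      then have "(\<integral>\<^sup>+y. S.iterate n y \<partial>pp (None, None)) = 0"
        using Suc None(1) by (simp add: defs hv.pp_None nn_integral_return space_restrict_space)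
      moreover have "cc (None, None) = 0" by (simp add: cc_def hv_cost_def)
      ultimately show ?case
        by (simp add: S.iterate_Suc S.bellman_def None(2) S.stage_graph[OF None(3)])
    qed (simp add: S.iterate_0)
    have v_None: "v None = 0"
      unfolding v_def S.value_eq_limit[OF None(1)] by (simp add: S.limit_value_def it)
    have stage: "S.stage v (Some x, Some a) = T x a" if "x \<in> X" "a \<in> A x" for x a
    proof -
      have "(Some x, Some a) \<in> Sigma XX AA" using that by (simp add: defs hv_actions_def)
      \<comment> \<open>Dropping \<open>None\<close> from the domain of integration changes nothing
        because \<open>v\<close> vanishes there; this reconciles \<open>stage\<close> with the
        integral over the original states.\<close>
      moreover have "(\<integral>\<^sup>+y. v y \<partial>pp (Some x, Some a)) = (\<integral>\<^sup>+y\<in>Some ` X. v y \<partial>pp (Some x, Some a))"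
        using v_None by (intro nn_integral_cong) (auto simp: defs hv.space_pp indicator_def)
      ultimately show ?thesis by (simp add: S.stage_graph T_def)
    qed
    obtain \<psi> where \<psi>: "\<psi> \<in> stationary_policies XX AAct AA" "S.optimal (stationary AAct \<psi>)"
      by (rule S.exists_stationary_optimal) blast
    note \<psi>_opt = \<psi>(2)[unfolded S.stationary_optimal_iff[OF \<psi>(1)], folded v_def]
    obtain \<phi> where \<phi>: "\<phi> \<in> stationary_policies X Act A" "\<And>s. s \<in> XX \<Longrightarrow> \<psi> s = map_option \<phi> s"
      using stationary_policies_hv_restrict[OF hv.A_subset \<psi>(1)[unfolded defs]] unfolding defs by blast
    have mem: "map_option \<phi> \<in> stationary_policies XX AAct AA" if "\<phi> \<in> stationary_policies X Act A" for \<phi>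
      unfolding defs by (rule map_option_stationary[OF hv.X_borel that])
    \<comment> \<open>The criterion sees a policy only through its values on \<open>XX\<close>,
      where \<open>\<psi>\<close> and \<open>map_option \<phi>\<close> agree, so optimality passes
      from one to the other.\<close>
    have "optimal \<phi>"
      unfolding optimal_def S.stationary_optimal_iff[OF mem[OF \<phi>(1)]]
      using \<psi>_opt \<phi>(2) by (simp add: v_def)
    moreover have "optimal \<phi> \<longleftrightarrow>
            (\<forall>x\<in>X. v (Some x) = T x (\<phi> x) \<and> is_min_of (T x (\<phi> x)) (T x ` A x))"
      if \<phi>: "\<phi> \<in> stationary_policies X Act A" for \<phi>
    proof -
      have \<phi>A: "\<phi> x \<in> A x" if "x \<in> X" for x using \<phi> that by (simp add: stationary_policies_def)
      \<comment> \<open>The general criterion also quantifies over \<open>None\<close>. Only one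
        action is available there, so the equation is the same for every policy and the instance
        supplied by the optimal \<open>\<psi>\<close> settles it.\<close>
      have "\<psi> None = None" using \<psi>(1) None by (auto simp: stationary_policies_def)
      then have 0: "v None = S.stage v (None, None)" using \<psi>_opt None by auto
      have "optimal \<phi> \<longleftrightarrow> (\<forall>s\<in>XX. v s = S.stage v (s, map_option \<phi> s) \<and>
          (\<forall>a\<in>AA s. S.stage v (s, map_option \<phi> s) \<le> S.stage v (s, a)))"
        unfolding optimal_def S.stationary_optimal_iff[OF mem[OF \<phi>]] v_def ..
      also have "\<dots> \<longleftrightarrow> (\<forall>x\<in>X. v (Some x) = S.stage v (Some x, Some (\<phi> x)) \<and>
          (\<forall>a\<in>A x. S.stage v (Some x, Some (\<phi> x)) \<le> S.stage v (Some x, Some a)))"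
        using 0 by (simp add: XX_def AA_def hv_actions_def)
      also have "\<dots> \<longleftrightarrow> (\<forall>x\<in>X. v (Some x) = T x (\<phi> x) \<and> is_min_of (T x (\<phi> x)) (T x ` A x))"
        using \<phi>A stage by (simp add: is_min_of_def)
      finally show ?thesis .
    qed
    ultimately show ?thesis using \<phi>(1) by blast
  qed
  ultimately show ?thesis
    by (simp only: Let_def defs[symmetric] v_def[symmetric] optimal_def[symmetric] T_def[symmetric]) blast
qed

end
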